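(* For each $n\ge1$ let $\mathcal T^{(n)}$ be a (deterministic or random) tree with $n$ vertices and let $r_n>0$. Conditioned on $\mathcal T^{(n)}$, let each edge $e$ be deleted at a random time $T_e$, where the $T_e$ are i.i.d. with the exponential distribution $\mathrm{Exp}(r_n)$ of rate $r_n$. Let $X^{(n)}(\cdot)=(X^{(n)}_i(\cdot))_{i=1}^\infty$ be the fragmentation process of normalized component sizes (see context), and let $Q^{(n)}(t):=\sum_{i=1}^\infty (X^{(n)}_i(t))^2$. Suppose that $$\limsup_{n\to\infty}\bigl(1-\mathbb E\,Q^{(n)}(t)\bigr)\to0\qquad\text{as } t\searrow0.$$ Then the family of processes $X^{(n)}(\cdot)$, $n\ge1$, is tight in $D(\mathbb R_+,\mathbb S^{\downarrow}_{\le1})$.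
   Context: $\mathbb R_+:=[0,\infty)$. $\mathbb S^{\downarrow}_{\le1}:=\{(x_i)_{i=1}^\infty: x_1\ge x_2\ge\dots\ge0,\ \sum_{i}x_i\le1\}$, with the product topology (as a subspace of $\mathbb R^\infty$). $D(\mathbb R_+,\mathbb S^{\downarrow}_{\le1})$ is the space of càdlàg functions $\mathbb R_+\to\mathbb S^{\downarrow}_{\le1}$ with the Skorohod $J_1$ topology. Let $\mathcal T^{(n)}(t)$ be the forest obtained from $\mathcal T^{(n)}$ by removing all edges deleted up to time $t$ (i.e. with $T_e\le t$; $\mathcal T^{(n)}(0)=\mathcal T^{(n)}$), with components $\mathcal T^{(n)}_i(t)$, $i=1,\dots,\nu^{(n)}(t)$, arranged in order of decreasing size (number of vertices). Set $X^{(n)}_i(t):=|\mathcal T^{(n)}_i(t)|/n$ for $i\le\nu^{(n)}(t)$ and $X^{(n)}_i(t):=0$ for $i>\nu^{(n)}(t)$. In particular $X^{(n)}(0)=(1,0,0,\dots)$. *)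

theory Defs
  imports "HOL-Probability.Probability"
begin

section \<open>Trees, components and fragmentation\<close>

text \<open>
  A finite simple graph is a vertex set \<open>V\<close> together with a set \<open>E\<close> of two-element subsets of \<open>V\<close>.
\<close>

definition all_edges :: "'v set \<Rightarrow> 'v set set" where
  "all_edges V = {e. e \<subseteq> V \<and> card e = 2}"

definition adjacency :: "'v set set \<Rightarrow> ('v \<times> 'v) set" where
  "adjacency E = {(u, v). {u, v} \<in> E}"

definition is_cycle :: "'v set set \<Rightarrow> 'v list \<Rightarrow> bool" where
  "is_cycle E p \<longleftrightarrow> 3 \<le> length p \<and> distinct p \<and>
     (\<forall>i<length p. {p ! i, p ! (Suc i mod length p)} \<in> E)"

definition is_tree :: "'v set \<Rightarrow> 'v set set \<Rightarrow> bool" where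
  "is_tree V E \<longleftrightarrow> finite V \<and> V \<noteq> {} \<and> E \<subseteq> all_edges V \<and>
     (\<forall>u\<in>V. \<forall>v\<in>V. (u, v) \<in> (adjacency E)\<^sup>*) \<and> (\<nexists>p. is_cycle E p)"

definition components :: "'v set \<Rightarrow> 'v set set \<Rightarrow> 'v set set" where
  "components V E = V // ((adjacency E)\<^sup>* \<inter> V \<times> V)"

definition component_sizes :: "'v set \<Rightarrow> 'v set set \<Rightarrow> nat list" where
  "component_sizes V E =
     rev (sorted_list_of_multiset (image_mset card (mset_set (components V E))))"

text \<open>
  The edge \<open>e\<close> is deleted at time \<open>d e\<close>. Sequences are indexed from \<open>0\<close>, so that
  \<open>fragmentation V E d t i\<close> is the \<open>(i+1)\<close>-st largest relative component size at time \<open>t\<close>.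
\<close>

definition surviving_edges :: "'v set set \<Rightarrow> ('v set \<Rightarrow> real) \<Rightarrow> real \<Rightarrow> 'v set set" where
  "surviving_edges E d t = {e \<in> E. \<not> d e \<le> t}"

definition fragmentation ::
    "'v set \<Rightarrow> 'v set set \<Rightarrow> ('v set \<Rightarrow> real) \<Rightarrow> real \<Rightarrow> nat \<Rightarrow> real" where
  "fragmentation V E d t i =
     (let s = component_sizes V (surviving_edges E d t)
      in if i < length s then real (s ! i) / real (card V) else 0)"

definition mass_partitions :: "(nat \<Rightarrow> real) set" where
  "mass_partitions = {x. decseq x \<and> (\<forall>i. 0 \<le> x i) \<and> summable x \<and> (\<Sum>i. x i) \<le> 1}"


section \<open>Random trees and exponential deletion times\<close>

definition random_tree :: "'w measure \<Rightarrow> 'v set \<Rightarrow> ('w \<Rightarrow> 'v set set) \<Rightarrow> bool" where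
  "random_tree M V T \<longleftrightarrow> T \<in> M \<rightarrow>\<^sub>M count_space {E. is_tree V E}"

text \<open>
  For a finite vertex set there are only finitely many trees, so conditioning on the random tree
  \<open>T\<close> is conditioning on the events \<open>T = E\<close> of positive probability; \<open>uniform_measure M A\<close> is the
  conditional probability given \<open>A\<close>. The value of \<open>\<tau> e\<close> where \<open>e\<close> is not an edge of \<open>T\<close> is irrelevant
  (say \<open>0\<close>); it is only there to make \<open>\<tau> e\<close> a measurable function on the whole space.
\<close>

definition iid_exponential_given_tree ::
    "'w measure \<Rightarrow> 'v set \<Rightarrow> ('w \<Rightarrow> 'v set set) \<Rightarrow> real \<Rightarrow> ('v set \<Rightarrow> 'w \<Rightarrow> real) \<Rightarrow> bool" where
  "iid_exponential_given_tree M V T r \<tau> \<longleftrightarrow>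
     (\<forall>e\<in>all_edges V. \<tau> e \<in> borel_measurable M) \<and>
     (\<forall>E. let A = {\<omega>\<in>space M. T \<omega> = E} in measure M A > 0 \<longrightarrow>
        prob_space.indep_vars (uniform_measure M A) (\<lambda>_. borel) \<tau> E \<and>
        (\<forall>e\<in>E. distributed (uniform_measure M A) lborel (\<tau> e) (exponential_density r)))"


section \<open>The Skorohod space\<close>

text \<open>
  Paths are functions on \<open>{0..}\<close>, represented by functions on \<open>real\<close> that are \<open>undefined\<close> at negative
  times. The state space is a subset \<open>S\<close> of a metric space; left limits are required to lie in \<open>S\<close>.
\<close>

definition cadlag :: "'b::metric_space set \<Rightarrow> (real \<Rightarrow> 'b) set" where
  "cadlag S = {x \<in> {0..} \<rightarrow>\<^sub>E S.
     (\<forall>t\<ge>0. (x \<longlongrightarrow> x t) (at_right t)) \<and> (\<forall>t>0. \<exists>l\<in>S. (x \<longlongrightarrow> l) (at_left t))}"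

text \<open>Strictly increasing bijections of \<open>{0..}\<close> are automatically homeomorphisms fixing \<open>0\<close>.\<close>

definition time_changes :: "(real \<Rightarrow> real) set" where
  "time_changes = {\<theta>. bij_betw \<theta> {0..} {0..} \<and> strict_mono_on {0..} \<theta>}"

definition J1_nbhd ::
    "'b::metric_space set \<Rightarrow> (real \<Rightarrow> 'b) \<Rightarrow> real \<Rightarrow> real \<Rightarrow> (real \<Rightarrow> 'b) set" where
  "J1_nbhd S x K \<epsilon> = {y \<in> cadlag S. \<exists>\<theta>\<in>time_changes.
     (\<forall>t\<ge>0. \<bar>\<theta> t - t\<bar> < \<epsilon>) \<and> (\<forall>t\<in>{0..K}. dist (y (\<theta> t)) (x t) < \<epsilon>)}"

text \<open>
  The sets \<open>J1_nbhd S x K \<epsilon>\<close> form a neighbourhood base at \<open>x\<close>; see \<open>limitin_J1\<close> below for the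
  usual description of the convergent sequences. The topology depends only on the topology of \<open>S\<close>,
  not on the metric. For \<open>S = mass_partitions\<close> the metric is the one on \<open>nat \<Rightarrow> real\<close> from
  \<open>HOL-Analysis.Function_Metric\<close>, which induces the product topology.
\<close>

definition J1_topology :: "'b::metric_space set \<Rightarrow> (real \<Rightarrow> 'b) topology" where
  "J1_topology S = topology (\<lambda>U. U \<subseteq> cadlag S \<and> (\<forall>x\<in>U. \<exists>K. \<exists>\<epsilon>>0. J1_nbhd S x K \<epsilon> \<subseteq> U))"

text \<open>For \<open>\<epsilon> < 1\<close> the inequality forces the event to be measurable, since \<open>measure\<close> is \<open>0\<close> otherwise.\<close>

definition tight_in ::
    "'b topology \<Rightarrow> 'i set \<Rightarrow> ('i \<Rightarrow> 'w measure) \<Rightarrow> ('i \<Rightarrow> 'w \<Rightarrow> 'b) \<Rightarrow> bool" where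
  "tight_in X I M Y \<longleftrightarrow> (\<forall>\<epsilon>>0. \<exists>C. compactin X C \<and>
     (\<forall>i\<in>I. measure (M i) {\<omega>\<in>space (M i). Y i \<omega> \<in> C} \<ge> 1 - \<epsilon>))"


subsection \<open>Basic facts on the topology\<close>

lemma J1_nbhd_mono:
  assumes "K' \<le> K" "\<epsilon> \<le> \<epsilon>'"
  shows "J1_nbhd S x K \<epsilon> \<subseteq> J1_nbhd S x K' \<epsilon>'"
proof
  fix y assume "y \<in> J1_nbhd S x K \<epsilon>"
  then obtain l where y: "y \<in> cadlag S" and l: "l \<in> time_changes"
      "\<forall>t\<ge>0. \<bar>l t - t\<bar> < \<epsilon>" "\<forall>t\<in>{0..K}. dist (y (l t)) (x t) < \<epsilon>"
    unfolding J1_nbhd_def by blast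
  have "\<forall>t\<ge>0. \<bar>l t - t\<bar> < \<epsilon>'"
    using l(2) assms(2) by (meson less_le_trans)
  moreover have "\<forall>t\<in>{0..K'}. dist (y (l t)) (x t) < \<epsilon>'"
    using l(3) assms by (meson atLeastAtMost_iff less_le_trans order_trans)
  ultimately show "y \<in> J1_nbhd S x K' \<epsilon>'"
    unfolding J1_nbhd_def using y l(1) by blast
qed

lemma time_changes_id: "(\<lambda>t. t) \<in> time_changes"
  by (auto simp: time_changes_def bij_betw_def strict_mono_on_def)

lemma time_changes_nonneg: "\<theta> \<in> time_changes \<Longrightarrow> 0 \<le> t \<Longrightarrow> 0 \<le> \<theta> t"
  by (auto simp: time_changes_def bij_betw_def)

lemma time_changes_compose:
  assumes "\<theta> \<in> time_changes" "\<mu> \<in> time_changes"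
  shows "\<mu> \<circ> \<theta> \<in> time_changes"
proof -
  have "bij_betw (\<mu> \<circ> \<theta>) {0..} {0..}"
    using assms bij_betw_trans by (auto simp: time_changes_def)
  moreover have "strict_mono_on {0..} (\<mu> \<circ> \<theta>)"
    using assms time_changes_nonneg[OF assms(1)]
    unfolding time_changes_def strict_mono_on_def by simp
  ultimately show ?thesis by (simp add: time_changes_def)
qed

lemma J1_nbhd_self: "x \<in> cadlag S \<Longrightarrow> 0 < \<epsilon> \<Longrightarrow> x \<in> J1_nbhd S x K \<epsilon>"
  unfolding J1_nbhd_def using time_changes_id
  by (auto intro!: bexI[of _ "\<lambda>t. t"])

lemma J1_nbhd_trans:
  assumes "y \<in> J1_nbhd S x K \<delta>" and "z \<in> J1_nbhd S y (K + \<delta>) \<epsilon>"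
  shows "z \<in> J1_nbhd S x K (\<delta> + \<epsilon>)"
proof -
  obtain l where l: "l \<in> time_changes" "\<And>t. t \<ge> 0 \<Longrightarrow> \<bar>l t - t\<bar> < \<delta>"
      "\<And>t. t \<in> {0..K} \<Longrightarrow> dist (y (l t)) (x t) < \<delta>"
    using assms(1) by (auto simp: J1_nbhd_def)
  obtain m where m: "m \<in> time_changes" "\<And>t. t \<ge> 0 \<Longrightarrow> \<bar>m t - t\<bar> < \<epsilon>"
      "\<And>t. t \<in> {0..K + \<delta>} \<Longrightarrow> dist (z (m t)) (y t) < \<epsilon>" and z: "z \<in> cadlag S"
    using assms(2) by (auto simp: J1_nbhd_def)
  have "\<bar>(m \<circ> l) t - t\<bar> < \<delta> + \<epsilon>" if "t \<ge> 0" for t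
    using l(2)[OF that] m(2)[of "l t"] time_changes_nonneg[OF l(1) that] by auto
  moreover have "dist (z ((m \<circ> l) t)) (x t) < \<delta> + \<epsilon>" if "t \<in> {0..K}" for t
  proof -
    have "l t \<in> {0..K + \<delta>}"
      using l(2)[of t] time_changes_nonneg[OF l(1), of t] that by auto
    then show ?thesis
      using m(3)[of "l t"] l(3)[OF that] dist_triangle[of "z (m (l t))" "x t" "y (l t)"] by auto
  qed
  ultimately show ?thesis
    unfolding J1_nbhd_def using time_changes_compose[OF l(1) m(1)] z by blast
qed

lemma openin_J1:
  "openin (J1_topology S) U \<longleftrightarrow>
     U \<subseteq> cadlag S \<and> (\<forall>x\<in>U. \<exists>K. \<exists>\<epsilon>>0. J1_nbhd S x K \<epsilon> \<subseteq> U)"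
proof -
  let ?P = "\<lambda>U. U \<subseteq> cadlag S \<and> (\<forall>x\<in>U. \<exists>K. \<exists>\<epsilon>>0. J1_nbhd S x K \<epsilon> \<subseteq> U)"
  have "?P (A \<inter> B)" if "?P A" "?P B" for A B
  proof (intro conjI ballI)
    fix x assume x: "x \<in> A \<inter> B"
    obtain K \<epsilon> where 1: "\<epsilon> > 0" "J1_nbhd S x K \<epsilon> \<subseteq> A" using \<open>?P A\<close> x by blast
    obtain L \<delta> where 2: "\<delta> > 0" "J1_nbhd S x L \<delta> \<subseteq> B" using \<open>?P B\<close> x by blast
    have "J1_nbhd S x (max K L) (min \<epsilon> \<delta>) \<subseteq> A \<inter> B"
      using J1_nbhd_mono[of K "max K L" "min \<epsilon> \<delta>" \<epsilon> S x]
            J1_nbhd_mono[of L "max K L" "min \<epsilon> \<delta>" \<delta> S x] 1 2 by auto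
    then show "\<exists>K. \<exists>\<epsilon>>0. J1_nbhd S x K \<epsilon> \<subseteq> A \<inter> B"
      using 1 2 by (meson min_less_iff_conj)
  qed (use that in blast)
  moreover have "?P (\<Union>\<A>)" if "\<forall>A\<in>\<A>. ?P A" for \<A>
  proof (intro conjI ballI)
    fix x assume "x \<in> \<Union>\<A>"
    then obtain A where "A \<in> \<A>" "x \<in> A" by blast
    then show "\<exists>K. \<exists>\<epsilon>>0. J1_nbhd S x K \<epsilon> \<subseteq> \<Union>\<A>"
      using that by (meson Union_upper subset_trans)
  qed (use that in blast)
  ultimately have "istopology ?P"
    unfolding istopology_def by blast
  then show ?thesis
    by (simp add: J1_topology_def topology_inverse')
qed

lemma topspace_J1 [simp]: "topspace (J1_topology S) = cadlag S"
proof
  have "J1_nbhd S x 0 1 \<subseteq> cadlag S" for x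
    unfolding J1_nbhd_def by blast
  then have "\<exists>K. \<exists>\<epsilon>>0. J1_nbhd S x K \<epsilon> \<subseteq> cadlag S" for x
    by (intro exI[of _ "0::real"] exI[of _ "1::real"]) simp
  then have "openin (J1_topology S) (cadlag S)"
    by (simp add: openin_J1)
  then show "cadlag S \<subseteq> topspace (J1_topology S)"
    by (rule openin_subset)
  show "topspace (J1_topology S) \<subseteq> cadlag S"
    using openin_topspace[of "J1_topology S"] openin_J1[of S "topspace (J1_topology S)"] by simp
qed

lemma J1_nbhd_interior:
  assumes x: "x \<in> cadlag S" and "0 < \<epsilon>"
  shows "\<exists>U. openin (J1_topology S) U \<and> x \<in> U \<and> U \<subseteq> J1_nbhd S x K \<epsilon>"
proof -
  define U where "U = {y \<in> cadlag S. \<exists>L. \<exists>\<delta>>0. J1_nbhd S y L \<delta> \<subseteq> J1_nbhd S x K \<epsilon>}"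
  have "\<exists>L. \<exists>\<delta>>0. J1_nbhd S y L \<delta> \<subseteq> U" if y: "y \<in> U" for y
  proof -
    obtain L \<delta> where \<delta>: "\<delta> > 0" "J1_nbhd S y L \<delta> \<subseteq> J1_nbhd S x K \<epsilon>"
      using y unfolding U_def by blast
    have "J1_nbhd S y L (\<delta>/2) \<subseteq> U"
    proof
      fix z assume z: "z \<in> J1_nbhd S y L (\<delta>/2)"
      have "J1_nbhd S z (L + \<delta>/2) (\<delta>/2) \<subseteq> J1_nbhd S y L \<delta>"
        using J1_nbhd_trans[OF z] by fastforce
      moreover have "z \<in> cadlag S" using z by (simp add: J1_nbhd_def)
      ultimately show "z \<in> U"
        unfolding U_def using \<delta>
        by (simp, intro exI[of _ "L + \<delta>/2"] exI[of _ "\<delta>/2"]) auto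
    qed
    then show ?thesis using \<delta>(1) by (intro exI[of _ L] exI[of _ "\<delta>/2"]) simp
  qed
  then have "openin (J1_topology S) U"
    unfolding openin_J1 by (auto simp: U_def)
  moreover have "x \<in> U" using assms unfolding U_def by blast
  moreover have "U \<subseteq> J1_nbhd S x K \<epsilon>" unfolding U_def using J1_nbhd_self by blast
  ultimately show ?thesis by blast
qed

theorem limitin_J1:
  "limitin (J1_topology S) xs x sequentially \<longleftrightarrow>
     x \<in> cadlag S \<and> (\<forall>\<^sub>F n in sequentially. xs n \<in> cadlag S) \<and>
     (\<exists>\<theta>. (\<forall>n. \<theta> n \<in> time_changes) \<and> uniform_limit {0..} \<theta> (\<lambda>t. t) sequentially \<and>
       (\<forall>K. uniform_limit {0..K} (\<lambda>n t. xs n (\<theta> n t)) x sequentially))"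
  (is "?L \<longleftrightarrow> ?R")
proof -
  have nbhd: "?L \<longleftrightarrow> x \<in> cadlag S \<and>
      (\<forall>K. \<forall>\<epsilon>>0. \<forall>\<^sub>F n in sequentially. xs n \<in> J1_nbhd S x K \<epsilon>)" (is "_ \<longleftrightarrow> ?N")
  proof
    assume L: ?L
    show ?N
    proof (intro conjI allI impI)
      show x: "x \<in> cadlag S" using L by (simp add: limitin_def)
      fix K \<epsilon> :: real assume "\<epsilon> > 0"
      from J1_nbhd_interior[OF x this] obtain U
        where "openin (J1_topology S) U" "x \<in> U" "U \<subseteq> J1_nbhd S x K \<epsilon>" by blast
      then show "\<forall>\<^sub>F n in sequentially. xs n \<in> J1_nbhd S x K \<epsilon>"
        using L unfolding limitin_def by (blast intro: eventually_mono)
    qed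
  next
    assume N: ?N
    show ?L
      unfolding limitin_def
    proof (intro conjI allI impI)
      fix U assume "openin (J1_topology S) U \<and> x \<in> U"
      then obtain K \<epsilon> where "\<epsilon> > 0" "J1_nbhd S x K \<epsilon> \<subseteq> U" by (auto simp: openin_J1)
      then show "\<forall>\<^sub>F n in sequentially. xs n \<in> U"
        using N by (meson eventually_mono subsetD)
    qed (use N in simp)
  qed
  show ?thesis
  proof
    assume ?L
    then have x: "x \<in> cadlag S"
      and ev: "\<And>K \<epsilon>. \<epsilon> > 0 \<Longrightarrow> \<forall>\<^sub>F n in sequentially. xs n \<in> J1_nbhd S x K \<epsilon>"
      using nbhd by auto
    define G where "G n l k \<longleftrightarrow> l \<in> time_changes \<and>
       (\<forall>t\<ge>0. \<bar>l t - t\<bar> < 1 / real (Suc k)) \<and>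
       (\<forall>t\<in>{0..real k}. dist (xs n (l t)) (x t) < 1 / real (Suc k))" for n l and k :: nat
    have G_mono: "G n l j" if "G n l k" "j \<le> k" for n l j k
    proof -
      have "1 / real (Suc k) \<le> 1 / real (Suc j)" using that(2) by (simp add: field_simps)
      moreover have "{0..real j} \<subseteq> {0..real k}" using that(2) by auto
      ultimately show ?thesis using that(1) unfolding G_def by (meson less_le_trans subsetD)
    qed
    define A where "A n = {k. k \<le> n \<and> (\<exists>l. G n l k)}" for n
    define \<theta> where "\<theta> n = (if A n = {} then (\<lambda>t. t) else SOME l. G n l (Max (A n)))" for n
    have finA: "finite (A n)" for n unfolding A_def by simp
    have G_theta: "G n (\<theta> n) (Max (A n))" if "A n \<noteq> {}" for n
    proof -
      have "Max (A n) \<in> A n" using finA that by (rule Max_in)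
      then have "\<exists>l. G n l (Max (A n))" by (simp add: A_def)
      then have "G n (SOME l. G n l (Max (A n))) (Max (A n))" by (rule someI_ex)
      then show ?thesis unfolding \<theta>_def using that by simp
    qed
    have evG: "\<forall>\<^sub>F n in sequentially. G n (\<theta> n) k" for k
    proof -
      have "\<forall>\<^sub>F n in sequentially. xs n \<in> J1_nbhd S x (real k) (1 / real (Suc k))"
        by (rule ev) simp
      then show ?thesis using eventually_ge_at_top[of k]
      proof eventually_elim
        case (elim n)
        then have "k \<in> A n" unfolding A_def G_def J1_nbhd_def by auto
        then have "A n \<noteq> {}" "k \<le> Max (A n)" using finA[of n] by auto
        then show ?case using G_theta G_mono by blast
      qed
    qed
    have "\<theta> n \<in> time_changes" for n
      using G_theta[of n] time_changes_id by (cases "A n = {}") (auto simp: \<theta>_def G_def)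
    moreover have "uniform_limit {0..} \<theta> (\<lambda>t. t) sequentially"
    proof (rule uniform_limitI)
      fix e :: real assume "e > 0"
      then obtain k where k: "1 / real (Suc k) < e" using nat_approx_posE by blast
      show "\<forall>\<^sub>F n in sequentially. \<forall>t\<in>{0..}. dist (\<theta> n t) t < e"
        using evG[of k] by eventually_elim (use k in \<open>force simp: G_def dist_real_def\<close>)
    qed
    moreover have "uniform_limit {0..K} (\<lambda>n t. xs n (\<theta> n t)) x sequentially" for K
    proof (rule uniform_limitI)
      fix e :: real assume "e > 0"
      then obtain i where i: "1 / real (Suc i) < e" using nat_approx_posE by blast
      obtain j where j: "K \<le> real j" using real_arch_simple by blast
      define k where "k = max i j"
      have "1 / real (Suc k) \<le> 1 / real (Suc i)" by (simp add: k_def field_simps)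
      with i have k: "1 / real (Suc k) < e" by linarith
      have K: "{0..K} \<subseteq> {0..real k}" using j by (auto simp: k_def)
      show "\<forall>\<^sub>F n in sequentially. \<forall>t\<in>{0..K}. dist (xs n (\<theta> n t)) (x t) < e"
        using evG[of k]
      proof eventually_elim
        case (elim n)
        then show ?case using k K unfolding G_def by (meson less_trans subsetD)
      qed
    qed
    moreover have "\<forall>\<^sub>F n in sequentially. xs n \<in> cadlag S"
      using ev[OF zero_less_one, of 0] by eventually_elim (auto simp: J1_nbhd_def)
    ultimately show ?R using x by blast
  next
    assume R: ?R
    then obtain \<theta> where \<theta>: "\<And>n. \<theta> n \<in> time_changes"
        "uniform_limit {0..} \<theta> (\<lambda>t. t) sequentially"
        "\<And>K. uniform_limit {0..K} (\<lambda>n t. xs n (\<theta> n t)) x sequentially"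
      by blast
    have "\<forall>\<^sub>F n in sequentially. xs n \<in> J1_nbhd S x K \<epsilon>" if "\<epsilon> > 0" for K \<epsilon>
    proof -
      have "\<forall>\<^sub>F n in sequentially. xs n \<in> cadlag S" using R by blast
      with uniform_limitD[OF \<theta>(2) that] uniform_limitD[OF \<theta>(3)[of K] that]
      show ?thesis
      proof eventually_elim
        case (elim n)
        then show ?case
          unfolding J1_nbhd_def using \<theta>(1)[of n] by (auto simp: dist_real_def)
      qed
    qed
    then show ?L using R nbhd by blast
  qed
qed

end

theory Submission
  imports Defs
begin

text \<open>
  Let \<open>q x = (\<Sum>i. (x i)\<^sup>2)\<close>. Along a fragmentation path \<open>X\<close> the value \<open>q (X t)\<close> is the proportion of pairs of
  vertices still connected at time \<open>t\<close>; it decreases, and it controls the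
  whole path: passing from \<open>X s\<close> to \<open>X t\<close> moves every ranked relative size by at most \<open>sqrt (q (X s) - q (X t))\<close>
  (\<open>ranked_size_drop\<close>, \<open>relative_sizes_control\<close>). So oscillations of \<open>X\<close> can be read off from the
  decreasing real function \<open>q \<circ> X\<close>, and only two things can prevent compactness: a loss of more than
  some \<open>e\<close> immediately after time \<open>0\<close>, and two losses of more than \<open>e\<close> close to each other. Paths for
  which neither happens, at a fixed rate, form a compact set for the \<open>J1\<close> topology
  (\<open>compactin_controlled_paths\<close>). This is an Arzela-Ascoli theorem: a subsequence converges at all
  rational times, the limit is extended to all times by right limits, and near each discontinuity of
  the limit the approximating paths have essentially a single jump, whose time is matched with that of
  the limit by a change of time. Compactness may be tested on sequences because the topology is
  metrizable (\<open>mtopology_J1_dist\<close>).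
  
  The probability of the two bad events is estimated for each tree separately. In a tree, vertices
  \<open>u\<close> and \<open>v\<close> are connected at time \<open>t\<close> iff all edges of the path between them survive up to \<open>t\<close>. Hence
  \<open>q (X t)\<close> is an average of indicators that sets of edges with independent lifetimes survive, and the
  absence of memory of the exponential distribution gives, for \<open>s \<le> t\<close> and conditionally on the tree,
    \<open>E[(q (X s) - q (X t)) * (q (X t) - q (X (t + h)))] \<le> E[q (X s) - q (X t)] * E[1 - q (X h)]\<close>
  (\<open>expectation_tree_Q_increments\<close>). Acyclicity is what makes this true: a pair still connected at
  time \<open>t\<close> cannot be separated more easily than it was initially. Summing over a grid of times, the factors
  \<open>q (X s) - q (X t)\<close> telescope to at most \<open>1\<close> whatever the mesh, so the probability of two drops larger than \<open>e\<close>
  within time \<open>h\<close> is at most \<open>(1 - E[q (X h)]) / e\<^sup>2\<close> (\<open>prob_close_drops\<close>); the initial loss is handled by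
  Markov's inequality (\<open>prob_early_drop\<close>). By hypothesis \<open>1 - E[q (X h)]\<close> is small for small \<open>h\<close>,
  uniformly in \<open>n\<close> (\<open>uniformly_small_near_zero\<close>), so both probabilities are small, uniformly in \<open>n\<close>.
\<close>

section \<open>A metric for the Skorohod topology\<close>

lemma time_changes_mono: "\<theta> \<in> time_changes \<Longrightarrow> 0 \<le> s \<Longrightarrow> s \<le> t \<Longrightarrow> \<theta> s \<le> \<theta> t"
  by (cases "s = t") (auto simp: time_changes_def strict_mono_on_def intro!: less_imp_le)

lemma time_changes_strict_mono: "\<theta> \<in> time_changes \<Longrightarrow> 0 \<le> s \<Longrightarrow> s < t \<Longrightarrow> \<theta> s < \<theta> t"
  unfolding time_changes_def strict_mono_on_def by auto

lemma time_changesI: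
  assumes "\<And>t. 0 \<le> t \<Longrightarrow> 0 \<le> \<theta> t" "\<And>s t. 0 \<le> s \<Longrightarrow> s < t \<Longrightarrow> \<theta> s < \<theta> t"
    and "\<And>u. 0 \<le> u \<Longrightarrow> \<exists>t\<ge>0. \<theta> t = u"
  shows "\<theta> \<in> time_changes"
proof -
  have sm: "strict_mono_on {0..} \<theta>" using assms(2) by (auto simp: strict_mono_on_def)
  have "\<theta> ` {0..} = {0..}" using assms(1,3) by (force simp: image_iff)
  with sm show ?thesis
    by (auto simp: time_changes_def bij_betw_def dest: strict_mono_on_imp_inj_on)
qed

lemma time_changes_surj:
  assumes "\<theta> \<in> time_changes" "0 \<le> u"
  shows "\<exists>t\<ge>0. \<theta> t = u"
proof -
  have "u \<in> \<theta> ` {0..}" using assms by (simp add: time_changes_def bij_betw_def)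
  then show ?thesis by auto
qed

lemma time_changes_inverse:
  assumes "\<theta> \<in> time_changes"
  obtains \<mu> where "\<mu> \<in> time_changes" "\<And>t. 0 \<le> t \<Longrightarrow> \<theta> (\<mu> t) = t" "\<And>t. 0 \<le> t \<Longrightarrow> \<mu> (\<theta> t) = t"
proof -
  let ?m = "inv_into {0..} \<theta>"
  have b: "bij_betw \<theta> {0..} {0..}" using assms by (simp add: time_changes_def)
  have r: "\<theta> (?m t) = t" "0 \<le> ?m t" if "0 \<le> t" for t
    using b that f_inv_into_f[of t \<theta> "{0..}"] inv_into_into[of t \<theta> "{0..}"]
    by (auto simp: bij_betw_def)
  have l: "?m (\<theta> t) = t" if "0 \<le> t" for t
    using b that by (auto simp: bij_betw_def inv_into_f_f)
  have "?m \<in> time_changes"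
  proof (rule time_changesI)
    fix s t :: real assume st: "0 \<le> s" "s < t"
    show "?m s < ?m t"
    proof (rule ccontr)
      assume "\<not> ?m s < ?m t"
      then have "\<theta> (?m t) \<le> \<theta> (?m s)"
        using time_changes_mono[OF assms, of "?m t" "?m s"] r st by auto
      then show False using r st by auto
    qed
  next
    fix u :: real assume "0 \<le> u"
    then show "\<exists>t\<ge>0. ?m t = u" using l[of u] time_changes_nonneg[OF assms] by blast
  qed (use r in auto)
  then show ?thesis using that r l by blast
qed

text \<open>
  The inverse time change compares the paths in the other direction; it moves the horizon by at
  most \<open>\<epsilon>\<close>, which is why the neighbourhood has to start with the larger horizon.
\<close>

lemma J1_nbhd_sym:
  assumes "y \<in> J1_nbhd S x (K + \<epsilon>) \<epsilon>" "x \<in> cadlag S"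
  shows "x \<in> J1_nbhd S y K \<epsilon>"
proof -
  obtain l where l: "l \<in> time_changes" "\<And>t. t \<ge> 0 \<Longrightarrow> \<bar>l t - t\<bar> < \<epsilon>"
      "\<And>t. t \<in> {0..K + \<epsilon>} \<Longrightarrow> dist (y (l t)) (x t) < \<epsilon>"
    using assms(1) by (auto simp: J1_nbhd_def)
  obtain m where m: "m \<in> time_changes" "\<And>t. 0 \<le> t \<Longrightarrow> l (m t) = t"
    using time_changes_inverse[OF l(1)] by metis
  have a: "\<bar>m t - t\<bar> < \<epsilon>" if "t \<ge> 0" for t
    using l(2)[of "m t"] m(2)[OF that] time_changes_nonneg[OF m(1) that] by auto
  have "dist (x (m t)) (y t) < \<epsilon>" if "t \<in> {0..K}" for t
    using l(3)[of "m t"] m(2)[of t] a[of t] time_changes_nonneg[OF m(1), of t] that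
    by (auto simp: dist_commute)
  with a m(1) assms(2) show ?thesis unfolding J1_nbhd_def by blast
qed

text \<open>
  Values of \<open>y\<close> just to the right of \<open>t\<close> are close to values of \<open>x\<close> just to the right of \<open>t\<close>, so right
  continuity of both paths forces \<open>x t = y t\<close>, even at a discontinuity.
\<close>

lemma J1_nbhd_separates:
  assumes x: "x \<in> cadlag S" and y: "y \<in> cadlag S" and "\<And>K \<epsilon>. \<epsilon> > 0 \<Longrightarrow> y \<in> J1_nbhd S x K \<epsilon>"
  shows "x = y"
proof -
  have near: "\<exists>s\<ge>0. \<bar>s - t\<bar> < \<epsilon> \<and> dist (x s) (y t) < \<epsilon>"
    if t: "t \<ge> 0" and pos: "\<epsilon> > 0" for t \<epsilon>
  proof -
    obtain l where l: "l \<in> time_changes" "\<And>t. t \<ge> 0 \<Longrightarrow> \<bar>l t - t\<bar> < \<epsilon>"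
      "\<And>s. s \<in> {0..t + \<epsilon>} \<Longrightarrow> dist (y (l s)) (x s) < \<epsilon>"
      using assms(3)[OF pos, of "t + \<epsilon>"] by (auto simp: J1_nbhd_def)
    obtain s where s: "s \<ge> 0" "l s = t" using time_changes_surj[OF l(1) t] by blast
    then show ?thesis using l(2)[of s] l(3)[of s] by (intro exI[of _ s]) (auto simp: dist_commute)
  qed
  have "x t = y t" if t: "t \<ge> 0" for t
  proof (rule ccontr)
    assume ne: "x t \<noteq> y t"
    define e where "e = dist (x t) (y t) / 3"
    have e: "e > 0" using ne by (simp add: e_def)
    have "(x \<longlongrightarrow> x t) (at_right t)" "(y \<longlongrightarrow> y t) (at_right t)"
      using x y t by (auto simp: cadlag_def)
    then have "\<forall>\<^sub>F s in at_right t. dist (x s) (x t) < e" "\<forall>\<^sub>F s in at_right t. dist (y s) (y t) < e"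
      using e by (auto dest: tendstoD)
    then have "\<forall>\<^sub>F s in at_right t. dist (x s) (x t) < e \<and> dist (y s) (y t) < e"
      by (rule eventually_conj)
    then obtain b where b: "b > t" "\<And>s. t < s \<Longrightarrow> s < b \<Longrightarrow> dist (x s) (x t) < e \<and> dist (y s) (y t) < e"
      unfolding eventually_at_right_field by blast
    define s where "s = (t + b) / 2"
    obtain u where u: "\<bar>u - s\<bar> < min e ((b - t)/4)" "dist (x u) (y s) < min e ((b - t)/4)"
      using near[of s "min e ((b - t)/4)"] e b t by (auto simp: s_def)
    have "\<bar>u - s\<bar> < (b - t)/4" using u by simp
    then have "t < u" "u < b" "t < s" "s < b"
      using b(1) by (simp_all add: s_def abs_if field_simps split: if_splits)
    then have "dist (x u) (x t) < e" "dist (y s) (y t) < e" using b by auto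
    moreover have "dist (x t) (y t) \<le> dist (x u) (x t) + dist (x u) (y s) + dist (y s) (y t)"
      by metric
    ultimately show False using u by (simp add: e_def)
  qed
  then show ?thesis using x y
    unfolding cadlag_def by (intro PiE_ext[of x "{0..}" "\<lambda>_. S" y]) auto
qed

text \<open>
  The distance of two paths is the smallest \<open>\<epsilon>\<close> for which they agree up to \<open>\<epsilon>\<close>, in time and in space,
  on the horizon \<open>1/\<epsilon>\<close>. Both directions are required in order to have symmetry, and \<open>1\<close> is always admitted
  because the triangle inequality for the horizons only works below \<open>1\<close>.
\<close>

definition J1_scales :: "'b::metric_space set \<Rightarrow> (real \<Rightarrow> 'b) \<Rightarrow> (real \<Rightarrow> 'b) \<Rightarrow> real set" where
  "J1_scales S x y = {\<epsilon>. \<epsilon> = 1 \<or> \<epsilon> > 0 \<and> y \<in> J1_nbhd S x (1/\<epsilon>) \<epsilon> \<and> x \<in> J1_nbhd S y (1/\<epsilon>) \<epsilon>}"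

definition J1_dist :: "'b::metric_space set \<Rightarrow> (real \<Rightarrow> 'b) \<Rightarrow> (real \<Rightarrow> 'b) \<Rightarrow> real" where
  "J1_dist S x y = Inf (J1_scales S x y)"

lemma J1_scales_pos: "e \<in> J1_scales S x y \<Longrightarrow> e > 0"
  by (auto simp: J1_scales_def)

lemma J1_dist_le: "e \<in> J1_scales S x y \<Longrightarrow> J1_dist S x y \<le> e"
  unfolding J1_dist_def by (intro cInf_lower bdd_belowI[of _ 0]) (auto intro: less_imp_le[OF J1_scales_pos])

lemma J1_dist_less: 
  assumes "J1_dist S x y < e" 
  shows "\<exists>a\<in>J1_scales S x y. a < e"
proof -
  have "J1_scales S x y \<noteq> {}" by (auto simp: J1_scales_def)
  from cInf_lessD[OF this assms[unfolded J1_dist_def]] show ?thesis .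
qed

lemma J1_scales_nbhd:
  assumes "a \<in> J1_scales S x y" "a < e" "e \<le> 1"
  shows "y \<in> J1_nbhd S x (1/e) e"
proof -
  have "a > 0" "y \<in> J1_nbhd S x (1/a) a" using assms by (auto simp: J1_scales_def)
  then show ?thesis using J1_nbhd_mono[of "1/e" "1/a" a e S x] assms by (auto simp: frac_le)
qed

text \<open>
  Composing the approximations loses \<open>a\<close> of the horizon \<open>1/b\<close>; what is left is
  at least \<open>1/(a + b)\<close>, as long as \<open>b * (a + b) \<le> 1\<close>.
\<close>

lemma J1_scales_triangle:
  assumes a: "a \<in> J1_scales S x y" and b: "b \<in> J1_scales S y z"
  shows "\<exists>c\<in>J1_scales S x z. c \<le> a + b"
proof (cases "a + b \<ge> 1")
  case True
  then show ?thesis by (intro bexI[of _ 1]) (auto simp: J1_scales_def)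
next
  case False
  have ab: "a > 0" "b > 0" using J1_scales_pos a b by blast+
  have bound: "1 / (u + v) + u \<le> 1 / v" if "u > 0" "v > 0" "u + v < 1" for u v :: real
  proof -
    have "v * (u + v) \<le> 1 * 1" using that by (intro mult_mono) auto
    then have "u * (v * (u + v)) \<le> u" using that by simp
    then show ?thesis using that by (simp add: field_simps)
  qed
  have trans: "w \<in> J1_nbhd S p (1/(u+v)) (u+v)"
    if "q \<in> J1_nbhd S p (1/u) u" "w \<in> J1_nbhd S q (1/v) v" "u > 0" "v > 0" "u + v < 1" for p q w u v
  proof (rule J1_nbhd_trans)
    show "q \<in> J1_nbhd S p (1/(u+v)) u"
      using J1_nbhd_mono[of "1/(u+v)" "1/u" u u S p] that by (auto simp: frac_le)
    show "w \<in> J1_nbhd S q (1/(u+v) + u) v"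
      using J1_nbhd_mono[of "1/(u+v) + u" "1/v" v v S q] that bound[of u v] by auto
  qed
  have "a + b \<in> J1_scales S x z"
    using a b ab False trans[of y x a z b] trans[of y z b x a]
    by (auto simp: J1_scales_def add.commute)
  then show ?thesis by blast
qed

lemma J1_Metric_space: "Metric_space (cadlag S) (J1_dist S)"
proof
  fix x y z
  show "0 \<le> J1_dist S x y"
    unfolding J1_dist_def using J1_scales_pos
    by (intro cInf_greatest) (auto simp: J1_scales_def less_imp_le)
  have "J1_scales S x y = J1_scales S y x" by (auto simp: J1_scales_def)
  then show "J1_dist S x y = J1_dist S y x" by (simp add: J1_dist_def)
  show "J1_dist S x z \<le> J1_dist S x y + J1_dist S y z"
  proof (rule field_le_epsilon)
    fix e :: real assume e: "e > 0"
    obtain a where a: "a \<in> J1_scales S x y" "a < J1_dist S x y + e/2"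
      using J1_dist_less[of S x y "J1_dist S x y + e/2"] e by auto
    obtain b where b: "b \<in> J1_scales S y z" "b < J1_dist S y z + e/2"
      using J1_dist_less[of S y z "J1_dist S y z + e/2"] e by auto
    obtain c where "c \<in> J1_scales S x z" "c \<le> a + b" using J1_scales_triangle[OF a(1) b(1)] by blast
    then show "J1_dist S x z \<le> J1_dist S x y + J1_dist S y z + e"
      using J1_dist_le[of c S x z] a b by linarith
  qed
next
  fix x y assume x: "x \<in> cadlag S" and y: "y \<in> cadlag S"
  show "(J1_dist S x y = 0) = (x = y)"
  proof
    assume 0: "J1_dist S x y = 0"
    show "x = y"
    proof (rule J1_nbhd_separates[OF x y])
      fix K \<epsilon> :: real assume "\<epsilon> > 0"
      define e where "e = min (min \<epsilon> 1) (1 / (\<bar>K\<bar> + 1))"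
      have e: "0 < e" "e \<le> 1" "e \<le> \<epsilon>" "K \<le> 1 / e"
      proof -
        show "0 < e" "e \<le> 1" "e \<le> \<epsilon>" using \<open>\<epsilon> > 0\<close> by (auto simp: e_def)
        have "e \<le> 1 / (\<bar>K\<bar> + 1)" by (simp add: e_def)
        then have "\<bar>K\<bar> + 1 \<le> 1 / e" using \<open>0 < e\<close> by (simp add: field_simps)
        then show "K \<le> 1 / e" by linarith
      qed
      obtain a where "a \<in> J1_scales S x y" "a < e" using J1_dist_less[of S x y e] 0 e by auto
      from J1_scales_nbhd[OF this e(2)] show "y \<in> J1_nbhd S x K \<epsilon>"
        using J1_nbhd_mono[OF e(4,3)] by blast
    qed
  next
    assume "x = y"
    have "J1_dist S x y \<le> 0 + e" if "e > 0" for e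
    proof -
      have "e \<in> J1_scales S x y" using that x \<open>x = y\<close> J1_nbhd_self by (auto simp: J1_scales_def)
      then show ?thesis using J1_dist_le by force
    qed
    then have "J1_dist S x y \<le> 0" by (rule field_le_epsilon)
    moreover have "0 \<le> J1_dist S x y"
      unfolding J1_dist_def using J1_scales_pos
      by (intro cInf_greatest) (auto simp: J1_scales_def less_imp_le)
    ultimately show "J1_dist S x y = 0" by simp
  qed
qed

lemma mtopology_J1_dist: "Metric_space.mtopology (cadlag S) (J1_dist S) = J1_topology S"
proof -
  interpret J: Metric_space "cadlag S" "J1_dist S" by (rule J1_Metric_space)
  have 1: "\<exists>K. \<exists>\<epsilon>>0. J1_nbhd S x K \<epsilon> \<subseteq> J.mball x r" if x: "x \<in> cadlag S" and "r > 0" for x r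
  proof (intro exI conjI)
    define e where "e = min (r/2) (1/2)"
    have e: "0 < e" "e < r" "e < 1" using \<open>r > 0\<close> by (auto simp: e_def)
    show "0 < e" by fact
    show "J1_nbhd S x (1/e + e) e \<subseteq> J.mball x r"
    proof
      fix y assume y: "y \<in> J1_nbhd S x (1/e + e) e"
      then have "x \<in> J1_nbhd S y (1/e) e" "y \<in> J1_nbhd S x (1/e) e"
        using J1_nbhd_sym[OF y x] J1_nbhd_mono[of "1/e" "1/e + e" e e S x] e by auto
      then have "e \<in> J1_scales S x y" using e by (auto simp: J1_scales_def)
      then show "y \<in> J.mball x r"
        using x y J1_dist_le[of e S x y] e by (auto simp: J1_nbhd_def)
    qed
  qed
  have 2: "\<exists>r>0. J.mball x r \<subseteq> J1_nbhd S x K \<epsilon>" if "\<epsilon> > 0" for x K \<epsilon>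
  proof (intro exI conjI)
    define e where "e = min (min \<epsilon> 1) (1 / (\<bar>K\<bar> + 1))"
    have e: "0 < e" "e \<le> 1" "e \<le> \<epsilon>" "K \<le> 1 / e"
    proof -
      show "0 < e" "e \<le> 1" "e \<le> \<epsilon>" using \<open>\<epsilon> > 0\<close> by (auto simp: e_def)
      have "e \<le> 1 / (\<bar>K\<bar> + 1)" by (simp add: e_def)
      then have "\<bar>K\<bar> + 1 \<le> 1 / e" using \<open>0 < e\<close> by (simp add: field_simps)
      then show "K \<le> 1 / e" by linarith
    qed
    show "0 < e" by fact
    show "J.mball x e \<subseteq> J1_nbhd S x K \<epsilon>"
    proof
      fix y assume "y \<in> J.mball x e"
      then obtain a where "a \<in> J1_scales S x y" "a < e" using J1_dist_less[of S x y e] by auto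
      from J1_scales_nbhd[OF this e(2)] show "y \<in> J1_nbhd S x K \<epsilon>"
        using J1_nbhd_mono[OF e(4,3)] by blast
    qed
  qed
  have "openin J.mtopology U \<longleftrightarrow> openin (J1_topology S) U" for U
    unfolding J.openin_mtopology openin_J1 using 1 2
    by (meson order_trans subsetD)
  then show ?thesis by (simp add: topology_eq)
qed

section \<open>Compact sets of paths controlled by a monotone functional\<close>

text \<open>
  Time changes are built from left to right: beyond \<open>c\<close> the old one is discarded and replaced by
  a linear piece that reaches the prescribed value at \<open>d\<close>, followed by a translation. On the linear piece
  the displacement is a convex combination of the displacements at its ends.
\<close>

lemma time_changes_extend:
  assumes \<theta>: "\<theta> \<in> time_changes" and cd: "0 \<le> c" "c < d" and s: "\<theta> c < s"
  obtains \<theta>' where "\<theta>' \<in> time_changes" "\<And>t. t \<le> c \<Longrightarrow> \<theta>' t = \<theta> t" "\<theta>' d = s"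
    "\<And>t. c \<le> t \<Longrightarrow> \<bar>\<theta>' t - t\<bar> \<le> max \<bar>\<theta> c - c\<bar> \<bar>s - d\<bar>"
proof -
  define k where "k = (s - \<theta> c) / (d - c)"
  have k: "k > 0" "k * (d - c) = s - \<theta> c" using cd s by (auto simp: k_def)
  define \<theta>' where "\<theta>' t = (if t \<le> c then \<theta> t else if t \<le> d then \<theta> c + k * (t - c) else s + (t - d))" for t
  have mid: "\<theta> c < \<theta>' t" if "c < t" for t
    using that k s cd by (auto simp: \<theta>'_def)
  have tc: "\<theta>' \<in> time_changes"
  proof (rule time_changesI)
    show "0 \<le> \<theta>' t" if "0 \<le> t" for t
      using time_changes_nonneg[OF \<theta>] that mid[of t] cd by (cases "t \<le> c") (force simp: \<theta>'_def)+
    show "\<theta>' t < \<theta>' u" if tu: "0 \<le> t" "t < u" for t u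
    proof -
      consider "u \<le> c" | "t \<le> c" "c < u" | "c < t" "u \<le> d" | "c < t" "t \<le> d" "d < u" | "d < t" using tu cd by linarith
      then show ?thesis
      proof cases
        case 1 then show ?thesis using time_changes_strict_mono[OF \<theta> tu] tu by (simp add: \<theta>'_def)
      next
        case 2 then show ?thesis
          using mid[of u] time_changes_mono[OF \<theta>, of t c] tu by (auto simp: \<theta>'_def)
      next
        case 3 then show ?thesis using k tu by (simp add: \<theta>'_def)
      next
        case 4
        then have "k * (t - c) \<le> k * (d - c)" using k by (intro mult_left_mono) auto
        then show ?thesis using 4 k cd by (simp add: \<theta>'_def)
      next
        case 5 then show ?thesis using tu cd by (simp add: \<theta>'_def)
      qed
    qed
    show "\<exists>t\<ge>0. \<theta>' t = u" if u: "0 \<le> u" for u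
    proof -
      consider "u \<le> \<theta> c" | "\<theta> c < u" "u \<le> s" | "s < u" by linarith
      then show ?thesis
      proof cases
        case 1
        obtain t where t: "t \<ge> 0" "\<theta> t = u" using time_changes_surj[OF \<theta> u] by blast
        have "t \<le> c" using time_changes_strict_mono[OF \<theta>, of c t] t 1 cd by force
        then show ?thesis using t by (intro exI[of _ t]) (simp add: \<theta>'_def)
      next
        case 2
        have "(u - \<theta> c) / k > 0" using 2 k by simp
        moreover have "(u - \<theta> c) / k \<le> d - c" using 2 k by (simp add: pos_divide_le_eq mult.commute)
        ultimately show ?thesis using k cd by (intro exI[of _ "c + (u - \<theta> c) / k"]) (auto simp: \<theta>'_def)
      next
        case 3 then show ?thesis using cd by (intro exI[of _ "u - s + d"]) (auto simp: \<theta>'_def)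
      qed
    qed
  qed
  have d: "\<theta>' d = s" using k cd by (simp add: \<theta>'_def)
  have "\<bar>\<theta>' t - t\<bar> \<le> max \<bar>\<theta> c - c\<bar> \<bar>s - d\<bar>" if t: "c \<le> t" for t
  proof -
    consider "t = c" | "c < t" "t \<le> d" | "d < t" using t by linarith
    then show ?thesis
    proof cases
      case 2
      define l where "l = (t - c) / (d - c)"
      have l: "0 \<le> l" "l \<le> 1" "l * (d - c) = t - c" using 2 cd by (auto simp: l_def)
      have "k * (t - c) = k * (l * (d - c))" using l by simp
      also have "\<dots> = l * (k * (d - c))" by (simp only: mult_ac)
      also have "\<dots> = l * (s - \<theta> c)" by (simp only: k(2))
      finally have 1: "k * (t - c) = l * (s - \<theta> c)" .
      have 3: "\<theta>' t - t = (1 - l) * (\<theta> c - c) + l * (s - d)"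
        using 2 1 l(3) by (simp add: \<theta>'_def algebra_simps)
      show ?thesis
        unfolding 3 using l
        by (intro order_trans[OF abs_triangle_ineq]) 
          (auto simp: abs_mult intro!: convex_bound_le)
    qed (use cd in \<open>auto simp: \<theta>'_def\<close>)
  qed
  with tc d show ?thesis using that[of \<theta>'] by (auto simp: \<theta>'_def)
qed

text \<open>
  A decreasing function that cannot drop twice by more than \<open>e\<close> on an interval is, up to \<open>e\<close>, a step
  function with one jump: take the first time at which it has lost more than \<open>e\<close>.
\<close>

lemma jump_time:
  fixes f :: "real \<Rightarrow> real"
  assumes ab: "a < b" and e: "e > 0"
    and anti: "\<And>s t. a \<le> s \<Longrightarrow> s \<le> t \<Longrightarrow> t \<le> b \<Longrightarrow> f t \<le> f s"
    and cont: "\<And>t. a \<le> t \<Longrightarrow> t < b \<Longrightarrow> (f \<longlongrightarrow> f t) (at_right t)"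
    and three: "\<And>t. a < t \<Longrightarrow> t < b \<Longrightarrow> min (f a - f t) (f t - f b) \<le> e"
  obtains \<sigma> where "a < \<sigma>" "\<sigma> \<le> b" "\<And>t. a \<le> t \<Longrightarrow> t < \<sigma> \<Longrightarrow> f a - f t \<le> e" "f \<sigma> - f b \<le> e"
proof (cases "\<forall>t. a \<le> t \<longrightarrow> t < b \<longrightarrow> f a - f t \<le> e")
  case True
  then show ?thesis using that[of b] ab e by auto
next
  case False
  define J where "J = {t. a \<le> t \<and> t < b \<and> f a - f t > e}"
  have ne: "J \<noteq> {}" using False by (force simp: J_def)
  have bdd: "bdd_below J" by (rule bdd_belowI[of _ a]) (simp add: J_def)
  define \<sigma> where "\<sigma> = Inf J"
  have below: "t \<notin> J" if "t < \<sigma>" for t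
    using that cInf_lower[OF _ bdd] unfolding \<sigma>_def by force
  have above: "f a - f t > e" if t: "\<sigma> < t" "t < b" for t
  proof -
    obtain j where "j \<in> J" "j < t" using cInf_lessD[OF ne, of t] t by (auto simp: \<sigma>_def)
    then show ?thesis using anti[of j t] t by (auto simp: J_def)
  qed
  have "\<forall>\<^sub>F t in at_right a. dist (f t) (f a) < e"
    using cont[of a] ab e by (auto dest: tendstoD)
  then obtain w where w: "w > a" "\<And>t. a < t \<Longrightarrow> t < w \<Longrightarrow> dist (f t) (f a) < e"
    unfolding eventually_at_right_field by blast
  have "w \<le> \<sigma>" unfolding \<sigma>_def
  proof (rule cInf_greatest[OF ne])
    fix j assume "j \<in> J"
    then have "a \<le> j" "f a - f j > e" by (auto simp: J_def)
    then show "w \<le> j" using w(2)[of j] e by (cases "a = j") (force simp: dist_real_def)+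
  qed
  with w have a: "a < \<sigma>" by simp
  have b: "\<sigma> < b" using ne cInf_lower[OF _ bdd] unfolding \<sigma>_def by (force simp: J_def)
  have "f \<sigma> - f b \<le> e"
  proof (rule tendsto_upperbound)
    show "((\<lambda>t. f t - f b) \<longlongrightarrow> f \<sigma> - f b) (at_right \<sigma>)"
      using cont[of \<sigma>] a b by (auto intro!: tendsto_intros)
    have "\<forall>\<^sub>F t in at_right \<sigma>. \<sigma> < t \<and> t < b"
      using b by (auto simp: eventually_at_right_field)
    then show "\<forall>\<^sub>F t in at_right \<sigma>. f t - f b \<le> e"
    proof eventually_elim
      case (elim t)
      then show ?case using above[of t] three[of t] a by auto
    qed
  qed simp
  moreover have "f a - f t \<le> e" if "a \<le> t" "t < \<sigma>" for t
    using below[OF that(2)] that b by (auto simp: J_def)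
  ultimately show ?thesis using that[of \<sigma>] a b by auto
qed

text \<open>
  Besides the control by \<open>q\<close>, a path must lose at most \<open>e m\<close> before time \<open>h m\<close>, and it may not lose more
  than \<open>e m\<close> twice within a time shorter than \<open>h m\<close>. The bounds on times are strict and those on losses weak, so that
  the conditions survive limits along rational times approached from the right.
\<close>

definition controlled_paths ::
    "'b::metric_space set \<Rightarrow> ('b \<Rightarrow> real) \<Rightarrow> real \<Rightarrow> (nat \<Rightarrow> real) \<Rightarrow> (nat \<Rightarrow> real) \<Rightarrow> (real \<Rightarrow> 'b) set" where
  "controlled_paths S q c h e = {x \<in> cadlag S.
     (\<forall>s t. 0 \<le> s \<longrightarrow> s \<le> t \<longrightarrow> (dist (x s) (x t))\<^sup>2 \<le> c * (q (x s) - q (x t))) \<and>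
     (\<forall>m t. 0 \<le> t \<longrightarrow> t < h m \<longrightarrow> q (x 0) - q (x t) \<le> e m) \<and>
     (\<forall>m s t u. 0 \<le> s \<longrightarrow> s < t \<longrightarrow> t < u \<longrightarrow> u < s + h m \<longrightarrow>
        min (q (x s) - q (x t)) (q (x t) - q (x u)) \<le> e m)}"

lemma cadlag_in: "x \<in> cadlag S \<Longrightarrow> 0 \<le> t \<Longrightarrow> x t \<in> S"
  by (auto simp: cadlag_def PiE_iff)

lemma cadlag_comp_right:
  assumes "x \<in> cadlag S" "continuous_on S q" "0 \<le> t"
  shows "((\<lambda>t. q (x t)) \<longlongrightarrow> q (x t)) (at_right t)"
proof (rule continuous_on_tendsto_compose[OF assms(2)])
  show "(x \<longlongrightarrow> x t) (at_right t)" "x t \<in> S" using assms by (auto simp: cadlag_def)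
  show "\<forall>\<^sub>F s in at_right t. x s \<in> S"
    using assms cadlag_in[OF assms(1)] by (auto simp: eventually_at_right_field intro!: exI[of _ "t+1"])
qed

lemma cadlag_comp_left:
  assumes "x \<in> cadlag S" "continuous_on S q" "0 < t"
  obtains l where "((\<lambda>t. q (x t)) \<longlongrightarrow> l) (at_left t)"
proof -
  obtain l where l: "l \<in> S" "(x \<longlongrightarrow> l) (at_left t)" using assms by (auto simp: cadlag_def)
  have "\<forall>\<^sub>F s in at_left t. x s \<in> S"
    using assms cadlag_in[OF assms(1)] by (auto simp: eventually_at_left_field intro!: exI[of _ 0])
  from that[OF continuous_on_tendsto_compose[OF assms(2) l(2,1) this]] show ?thesis .
qed

text \<open>
  The time changes are constructed up to larger and larger times. The predicate \<open>R a\<close> of the proof says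
  that, for large \<open>n\<close>, a time change already matches \<open>xs n\<close> with \<open>x\<close> on \<open>{0..<a}\<close> and sends \<open>a\<close> to a time after which
  \<open>xs n\<close> loses next to nothing until a rational time \<open>b\<close> slightly larger than \<open>a\<close>. If \<open>q \<circ> x\<close> hardly oscillates on
  \<open>{a..<d}\<close>, then \<open>R a\<close> implies \<open>R d\<close>, since the only jump of \<open>xs n\<close> that matters is located by \<open>jump_time\<close> near \<open>d\<close>.
  Such steps reach every horizon by the bisection principle \<open>Bolzano\<close>, because a cadlag path
  hardly oscillates on small intervals on either side of any given point.
\<close>

lemma controlled_J1_convergence:
  fixes x :: "real \<Rightarrow> 'b::metric_space"
  assumes q: "continuous_on S q" and c: "c > 0" and h: "\<And>m. h m > 0" and e: "e \<longlonglongrightarrow> 0"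
    and xs: "\<And>n. xs n \<in> controlled_paths S q c h e" and x: "x \<in> controlled_paths S q c h e"
    and y: "\<And>r. r \<in> \<rat> \<Longrightarrow> 0 \<le> r \<Longrightarrow> y r \<in> S"
    and lim: "\<And>r. r \<in> \<rat> \<Longrightarrow> 0 \<le> r \<Longrightarrow> (\<lambda>n. xs n r) \<longlonglongrightarrow> y r"
    and xy: "\<And>s r. 0 \<le> s \<Longrightarrow> s < r \<Longrightarrow> r \<in> \<rat> \<Longrightarrow> (dist (x s) (y r))\<^sup>2 \<le> c * (q (x s) - q (y r))"
    and yx: "\<And>r t. 0 \<le> r \<Longrightarrow> r \<le> t \<Longrightarrow> r \<in> \<rat> \<Longrightarrow> (dist (y r) (x t))\<^sup>2 \<le> c * (q (y r) - q (x t))"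
    and \<epsilon>: "\<epsilon> > 0"
  shows "\<forall>\<^sub>F n in sequentially. xs n \<in> J1_nbhd S x K \<epsilon>"
proof -
  have mono: "q v \<le> q u" if "(dist u v)\<^sup>2 \<le> c * (q u - q v)" for u v :: 'b
  proof -
    have "0 \<le> c * (q u - q v)" using that by (meson order_trans zero_le_power2)
    then show ?thesis using c by (simp add: zero_le_mult_iff)
  qed
  have ctrl: "(dist (z s) (z t))\<^sup>2 \<le> c * (q (z s) - q (z t))"
    if "z \<in> controlled_paths S q c h e" "0 \<le> s" "s \<le> t" for z s t
    using that by (auto simp: controlled_paths_def)
  note anti = mono[OF ctrl]
  have cad: "z \<in> cadlag S" if "z \<in> controlled_paths S q c h e" for z
    using that by (auto simp: controlled_paths_def)
  \<comment> \<open>Losses of \<open>q\<close> up to \<open>3 * \<epsilon>1\<close> then amount to distances up to \<open>\<epsilon> / 4\<close>.\<close>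
  define \<epsilon>1 where "\<epsilon>1 = \<epsilon>\<^sup>2 / (48 * c)"
  have \<epsilon>1: "\<epsilon>1 > 0" "c * (3 * \<epsilon>1) = (\<epsilon>/4)\<^sup>2" using \<epsilon> c by (auto simp: \<epsilon>1_def power2_eq_square)
  have near: "dist u v \<le> \<epsilon>/4" if "(dist u v)\<^sup>2 \<le> c * r" "r \<le> 3 * \<epsilon>1" for u v :: 'b and r
  proof -
    have "(dist u v)\<^sup>2 \<le> c * (3 * \<epsilon>1)" using that c by (meson mult_left_mono order_trans less_imp_le)
    then have "(dist u v)\<^sup>2 \<le> (\<epsilon>/4)\<^sup>2" by (simp only: \<epsilon>1(2))
    then show ?thesis by (rule power2_le_imp_le) (use \<epsilon> in simp)
  qed
  obtain m where m: "e m < \<epsilon>1"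
    using order_tendstoD(2)[OF e \<epsilon>1(1)] by (auto simp: eventually_sequentially)
  define R where "R a \<longleftrightarrow> (\<forall>\<delta>>0. \<exists>b\<in>\<rat>. a < b \<and> b < a + \<delta> \<and> (\<forall>\<^sub>F n in sequentially.
      \<exists>\<theta>\<in>time_changes. (\<forall>t\<ge>0. \<bar>\<theta> t - t\<bar> < \<delta>) \<and> (\<forall>t. 0 \<le> t \<longrightarrow> t < a \<longrightarrow> dist (xs n (\<theta> t)) (x t) < \<epsilon>) \<and>
        \<theta> a \<le> b \<and> q (xs n (\<theta> a)) - q (xs n b) \<le> \<epsilon>1))" for a
  have R0: "R 0"
    unfolding R_def
  proof (intro allI impI)
    fix \<delta> :: real assume "\<delta> > 0"
    then obtain b where b: "b \<in> \<rat>" "0 < b" "b < min \<delta> (h m)"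
      using Rats_dense_in_real[of 0 "min \<delta> (h m)"] h[of m] by auto
    have "q (xs n 0) - q (xs n b) \<le> \<epsilon>1" for n
    proof -
      have "q (xs n 0) - q (xs n b) \<le> e m" using xs[of n] b by (auto simp: controlled_paths_def)
      then show ?thesis using m by simp
    qed
    then show "\<exists>b\<in>\<rat>. 0 < b \<and> b < 0 + \<delta> \<and> (\<forall>\<^sub>F n in sequentially.
      \<exists>\<theta>\<in>time_changes. (\<forall>t\<ge>0. \<bar>\<theta> t - t\<bar> < \<delta>) \<and> (\<forall>t. 0 \<le> t \<longrightarrow> t < 0 \<longrightarrow> dist (xs n (\<theta> t)) (x t) < \<epsilon>) \<and>
        \<theta> 0 \<le> b \<and> q (xs n (\<theta> 0)) - q (xs n b) \<le> \<epsilon>1)"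
      using b \<open>\<delta> > 0\<close> time_changes_id
      by (intro bexI[of _ b] conjI always_eventually allI bexI[of _ "\<lambda>t. t"]) auto
  qed
  have step: "R d" if cd: "0 \<le> a" "a < d" and Ra: "R a"
    and osc: "\<And>s t. a \<le> s \<Longrightarrow> s \<le> t \<Longrightarrow> t < d \<Longrightarrow> q (x s) - q (x t) \<le> \<epsilon>1" for a d
    unfolding R_def
  proof (intro allI impI)
    fix \<delta> :: real assume "\<delta> > 0"
    define \<delta>' where "\<delta>' = min \<delta> (min (h m / 2) ((d - a) / 2))"
    have \<delta>': "\<delta>' > 0" "\<delta>' \<le> \<delta>"
      using \<open>\<delta> > 0\<close> h[of m] cd by (auto simp: \<delta>'_def)
    have "2 * \<delta>' \<le> h m" unfolding \<delta>'_def by linarith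
    moreover have "\<delta>' \<le> (d - a) / 2"
      unfolding \<delta>'_def by (intro min.coboundedI2 order_refl)
    then have "2 * \<delta>' \<le> d - a" by simp
    ultimately have \<delta>': "\<delta>' > 0" "\<delta>' \<le> \<delta>" "2 * \<delta>' \<le> h m" "2 * \<delta>' \<le> d - a"
      using \<delta>' by blast+
    obtain b where b: "b \<in> \<rat>" "a < b" "b < a + \<delta>'"
      and ev: "\<forall>\<^sub>F n in sequentially. \<exists>\<theta>\<in>time_changes. (\<forall>t\<ge>0. \<bar>\<theta> t - t\<bar> < \<delta>') \<and>
          (\<forall>t. 0 \<le> t \<longrightarrow> t < a \<longrightarrow> dist (xs n (\<theta> t)) (x t) < \<epsilon>) \<and>
          \<theta> a \<le> b \<and> q (xs n (\<theta> a)) - q (xs n b) \<le> \<epsilon>1"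
      using Ra[unfolded R_def, rule_format, OF \<delta>'(1)] by (elim bexE conjE) (rule that)
    \<comment> \<open>Before \<open>a'\<close> and after \<open>b'\<close> both paths are close by pointwise convergence; in between,
      \<open>xs n\<close> has one relevant jump, since \<open>b' - a' < h m\<close>.\<close>
    obtain a' where a': "a' \<in> \<rat>" "d - \<delta>' < a'" "a' < d"
      using Rats_dense_in_real[of "d - \<delta>'" d] \<delta>' by auto
    obtain b' where b': "b' \<in> \<rat>" "d < b'" "b' < d + \<delta>'"
      using Rats_dense_in_real[of d "d + \<delta>'"] \<delta>' by auto
    have ord: "0 < b" "b < a'" "0 < a'" "a < a'" using b a' cd \<delta>' by auto
    have ev1: "\<forall>\<^sub>F n in sequentially. dist (xs n a') (y a') < \<epsilon>/4"
      using lim[of a'] a' ord \<epsilon> by (intro tendstoD) auto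
    have qlim: "(\<lambda>n. q (xs n r)) \<longlonglongrightarrow> q (y r)" if "r \<in> \<rat>" "0 \<le> r" for r
      using continuous_on_tendsto_compose[OF q lim[OF that] y[OF that]] cadlag_in[OF cad[OF xs] that(2)] by simp
    have "q (y b) - q (y a') \<le> q (x a) - q (x a')"
      using mono[OF xy, of a b] mono[OF yx, of a' a'] b a' cd ord by force
    also have "\<dots> \<le> \<epsilon>1" using osc[of a a'] ord a' by auto
    finally have "q (y b) - q (y a') < 2 * \<epsilon>1" using \<epsilon>1 by simp
    moreover have "(\<lambda>n. q (xs n b) - q (xs n a')) \<longlonglongrightarrow> q (y b) - q (y a')"
      using qlim b a' ord by (intro tendsto_diff) auto
    ultimately have ev2: "\<forall>\<^sub>F n in sequentially. q (xs n b) - q (xs n a') < 2 * \<epsilon>1"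
      by (metis order_tendstoD(2))
    have xnear: "dist (y a') (x t) \<le> \<epsilon>/4" if t: "a \<le> t" "t < d" for t
    proof (cases "t < a'")
      case True
      have "q (x t) - q (y a') \<le> q (x t) - q (x a')" using mono[OF yx, of a' a'] a' ord by auto
      also have "\<dots> \<le> 3 * \<epsilon>1" using osc[of t a'] t True a' \<epsilon>1 by auto
      finally show ?thesis using near[OF xy[of t a']] True t cd a' by (auto simp: dist_commute)
    next
      case False
      have "q (y a') - q (x t) \<le> q (x a) - q (x t)" using mono[OF xy, of a a'] a' ord cd by auto
      also have "\<dots> \<le> 3 * \<epsilon>1" using osc[of a t] t \<epsilon>1 by auto
      finally show ?thesis using near[OF yx[of a' t]] False t ord a' by auto
    qed
    have "\<forall>\<^sub>F n in sequentially. \<exists>\<theta>\<in>time_changes. (\<forall>t\<ge>0. \<bar>\<theta> t - t\<bar> < \<delta>) \<and>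
          (\<forall>t. 0 \<le> t \<longrightarrow> t < d \<longrightarrow> dist (xs n (\<theta> t)) (x t) < \<epsilon>) \<and>
          \<theta> d \<le> b' \<and> q (xs n (\<theta> d)) - q (xs n b') \<le> \<epsilon>1"
      using ev ev1 ev2
    proof eventually_elim
      case (elim n)
      define z where "z = xs n"
      have z: "z \<in> controlled_paths S q c h e" using xs by (simp add: z_def)
      obtain \<theta> where \<theta>: "\<theta> \<in> time_changes" "\<And>t. 0 \<le> t \<Longrightarrow> \<bar>\<theta> t - t\<bar> < \<delta>'"
        "\<And>t. 0 \<le> t \<Longrightarrow> t < a \<Longrightarrow> dist (z (\<theta> t)) (x t) < \<epsilon>" "\<theta> a \<le> b" "q (z (\<theta> a)) - q (z b) \<le> \<epsilon>1"
        using elim(1) unfolding z_def by blast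
      have *: "min (q (z a') - q (z t)) (q (z t) - q (z b')) \<le> \<epsilon>1" if "a' < t" "t < b'" for t
      proof -
        have "b' < a' + h m" using a' b' \<delta>' by linarith
        then have "min (q (z a') - q (z t)) (q (z t) - q (z b')) \<le> e m"
          using z that ord unfolding controlled_paths_def by auto
        then show ?thesis using m by simp
      qed
      obtain \<sigma> where \<sigma>: "a' < \<sigma>" "\<sigma> \<le> b'" "\<And>t. a' \<le> t \<Longrightarrow> t < \<sigma> \<Longrightarrow> q (z a') - q (z t) \<le> \<epsilon>1"
          "q (z \<sigma>) - q (z b') \<le> \<epsilon>1"
      proof (rule jump_time[of a' b' \<epsilon>1 "\<lambda>t. q (z t)"])
        show "a' < b'" using a' b' by simp
        show "q (z t) \<le> q (z s)" if "a' \<le> s" "s \<le> t" "t \<le> b'" for s t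
          using anti[OF z, of s t] that ord by auto
        show "((\<lambda>t. q (z t)) \<longlongrightarrow> q (z t)) (at_right t)" if "a' \<le> t" "t < b'" for t
          using cadlag_comp_right[OF cad[OF z] q, of t] that ord by auto
      qed (use \<epsilon>1 * in auto)
      have "\<theta> a < \<sigma>" using \<theta>(4) ord \<sigma> by simp
      from time_changes_extend[OF \<theta>(1) cd this] obtain \<theta>' where
        \<theta>': "\<theta>' \<in> time_changes" "\<And>t. t \<le> a \<Longrightarrow> \<theta>' t = \<theta> t" "\<theta>' d = \<sigma>"
          "\<And>t. a \<le> t \<Longrightarrow> \<bar>\<theta>' t - t\<bar> \<le> max \<bar>\<theta> a - a\<bar> \<bar>\<sigma> - d\<bar>" by blast
      have "\<bar>\<sigma> - d\<bar> < \<delta>'" using \<sigma> a' b' by (auto simp: abs_less_iff)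
      then have "max \<bar>\<theta> a - a\<bar> \<bar>\<sigma> - d\<bar> < \<delta>'" using \<theta>(2)[OF cd(1)] by simp
      then have "\<bar>\<theta>' t - t\<bar> < \<delta>" if "t \<ge> 0" for t
        using \<theta>(2)[OF that] \<theta>'(2)[of t] \<theta>'(4)[of t] \<delta>'(2) by (cases "t \<le> a") auto
      moreover have "dist (z (\<theta>' t)) (x t) < \<epsilon>" if t: "0 \<le> t" "t < d" for t
      proof (cases "t < a")
        case True
        then show ?thesis using \<theta>(3)[of t] \<theta>'(2)[of t] t by simp
      next
        case False
        \<comment> \<open>All values of \<open>z\<close> on \<open>{\<theta> a..<\<sigma>}\<close> and all values of \<open>x\<close> on \<open>{a..<d}\<close> are compared
          with those of \<open>z\<close> and \<open>y\<close> at the rational time \<open>a'\<close>.\<close>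
        define w where "w = \<theta>' t"
        have w: "\<theta> a \<le> w" "w < \<sigma>" "0 \<le> \<theta> a"
          using time_changes_mono[OF \<theta>'(1), of a t] time_changes_strict_mono[OF \<theta>'(1), of t d] False t
            \<theta>'(2)[of a] \<theta>'(3) cd time_changes_nonneg[OF \<theta>(1), of a] by (auto simp: w_def)
        have "dist (z w) (z a') \<le> \<epsilon>/4"
        proof (cases "w \<le> a'")
          case True
          have "q (z w) - q (z a') \<le> 3 * \<epsilon>1"
          proof (cases "w \<le> b")
            case True
            then show ?thesis using anti[OF z w(3,1)] \<theta>(5) elim(3) by (auto simp: z_def)
          next
            case False
            then show ?thesis using anti[OF z, of b w] ord elim(3) \<epsilon>1 by (auto simp: z_def)
          qed
          then show ?thesis using near[OF ctrl[OF z, of w a']] True w by auto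
        next
          case False
          then show ?thesis using near[OF ctrl[OF z, of a' w]] \<sigma>(3)[of w] w ord \<epsilon>1 by (auto simp: dist_commute)
        qed
        moreover have "dist (z a') (y a') < \<epsilon>/4" using elim(2) by (simp add: z_def)
        moreover have "dist (y a') (x t) \<le> \<epsilon>/4" using xnear False t by auto
        moreover have "dist (z w) (x t) \<le> dist (z w) (z a') + dist (z a') (y a') + dist (y a') (x t)"
          by metric
        ultimately show ?thesis using \<epsilon> by (simp add: w_def)
      qed
      ultimately show ?case using \<theta>'(1,3) \<sigma> unfolding z_def by (intro bexI[of _ \<theta>']) auto
    qed
    then show "\<exists>b\<in>\<rat>. d < b \<and> b < d + \<delta> \<and> (\<forall>\<^sub>F n in sequentially. \<exists>\<theta>\<in>time_changes.
          (\<forall>t\<ge>0. \<bar>\<theta> t - t\<bar> < \<delta>) \<and> (\<forall>t. 0 \<le> t \<longrightarrow> t < d \<longrightarrow> dist (xs n (\<theta> t)) (x t) < \<epsilon>) \<and>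
          \<theta> d \<le> b \<and> q (xs n (\<theta> d)) - q (xs n b) \<le> \<epsilon>1)"
      using b' \<delta>' by (intro bexI[of _ b']) auto
  qed
  define L where "L = max K 0 + 1"
  have "0 \<le> L" by (simp add: L_def)
  then have "0 \<le> (0::real) \<longrightarrow> R 0 \<longrightarrow> R L"
  proof (rule Bolzano[where P = "\<lambda>a b. 0 \<le> a \<longrightarrow> R a \<longrightarrow> R b"], goal_cases trans local)
    case (trans a b c)
    then show ?case by auto
  next
    case (local t)
    obtain b1 where b1: "b1 > t" "\<And>s. t < s \<Longrightarrow> s < b1 \<Longrightarrow> dist (q (x s)) (q (x t)) < \<epsilon>1"
      using tendstoD[OF cadlag_comp_right[OF cad[OF x] q local(1)] \<epsilon>1(1)] 
      unfolding eventually_at_right_field by blast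
    have right: "q (x r) - q (x s) \<le> \<epsilon>1" if "t \<le> r" "r \<le> s" "s < b1" for r s
      using anti[OF x, of t r] b1(2)[of s] that local(1) \<epsilon>1 by (cases "s = t") (auto simp: dist_real_def)
    have "\<exists>b0<t. \<forall>r s. 0 \<le> r \<longrightarrow> b0 < r \<longrightarrow> r \<le> s \<longrightarrow> s < t \<longrightarrow> q (x r) - q (x s) \<le> \<epsilon>1"
    proof (cases "t = 0")
      case True then show ?thesis by (intro exI[of _ "-1"]) auto
    next
      case False
      then have "t > 0" using local by simp
      obtain l where l: "((\<lambda>t. q (x t)) \<longlongrightarrow> l) (at_left t)" by (rule cadlag_comp_left[OF cad[OF x] q \<open>t > 0\<close>])
      obtain b0 where "b0 < t" "\<And>s. b0 < s \<Longrightarrow> s < t \<Longrightarrow> dist (q (x s)) l < \<epsilon>1/2"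
        using tendstoD[OF l, of "\<epsilon>1/2"] \<epsilon>1 unfolding eventually_at_left_field by auto
      then show ?thesis 
        by (intro exI[of _ b0]) (smt (verit) dist_real_def field_sum_of_halves)
    qed
    then obtain b0 where b0: "b0 < t" "\<And>r s. 0 \<le> r \<Longrightarrow> b0 < r \<Longrightarrow> r \<le> s \<Longrightarrow> s < t \<Longrightarrow> q (x r) - q (x s) \<le> \<epsilon>1"
      by blast
    show ?case
    proof (intro exI[of _ "min (t - b0) (b1 - t)"] conjI allI impI)
      show "0 < min (t - b0) (b1 - t)" using b0 b1 by simp
      fix a b assume ab: "a \<le> t \<and> t \<le> b \<and> b - a < min (t - b0) (b1 - t)" "0 \<le> a" "R a"
      have "R t"
        using step[of a t] ab b0 by (cases "a = t") auto
      then show "R b"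
        using step[of t b] ab right local(1) by (cases "b = t") auto
    qed
  qed
  then have "R L" using R0 by simp
  then obtain b where ev: "\<forall>\<^sub>F n in sequentially. \<exists>\<theta>\<in>time_changes. (\<forall>t\<ge>0. \<bar>\<theta> t - t\<bar> < \<epsilon>) \<and>
      (\<forall>t. 0 \<le> t \<longrightarrow> t < L \<longrightarrow> dist (xs n (\<theta> t)) (x t) < \<epsilon>) \<and> \<theta> L \<le> b \<and> q (xs n (\<theta> L)) - q (xs n b) \<le> \<epsilon>1"
    using \<epsilon> unfolding R_def by blast
  show ?thesis using ev
  proof eventually_elim
    case (elim n)
    then obtain \<theta> where "\<theta> \<in> time_changes" "\<forall>t\<ge>0. \<bar>\<theta> t - t\<bar> < \<epsilon>"
      "\<And>t. 0 \<le> t \<Longrightarrow> t < L \<Longrightarrow> dist (xs n (\<theta> t)) (x t) < \<epsilon>" by blast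
    then show ?case using cad[OF xs] unfolding J1_nbhd_def 
      by (auto intro!: bexI[of _ \<theta>] simp: L_def)
  qed
qed

lemma compact_Cauchy_filter_limit:
  fixes y :: "'a \<Rightarrow> 'b::metric_space"
  assumes S: "compact S" and F: "F \<noteq> bot" and yS: "\<forall>\<^sub>F r in F. y r \<in> S"
    and cauchy: "\<And>e. e > 0 \<Longrightarrow> \<exists>P. eventually P F \<and> (\<forall>r r'. P r \<longrightarrow> P r' \<longrightarrow> dist (y r) (y r') < e)"
  shows "\<exists>l\<in>S. (y \<longlongrightarrow> l) F"
proof -
  have "filtermap y F \<noteq> bot" using F by (simp add: filtermap_bot_iff)
  moreover have "\<forall>\<^sub>F z in filtermap y F. z \<in> S" using yS by (simp add: eventually_filtermap)
  ultimately obtain l where l: "l \<in> S" "inf (nhds l) (filtermap y F) \<noteq> bot"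
    using S unfolding compact_filter by blast
  have "(y \<longlongrightarrow> l) F"
  proof (rule tendstoI)
    fix e :: real assume "e > 0"
    then obtain P where P: "eventually P F" "\<And>r r'. P r \<Longrightarrow> P r' \<Longrightarrow> dist (y r) (y r') < e/2"
      using cauchy[of "e/2"] by auto
    have "\<exists>r. P r \<and> dist (y r) l < e/2"
    proof (rule ccontr)
      assume "\<nexists>r. P r \<and> dist (y r) l < e/2"
      then have "eventually (\<lambda>z. \<not> dist z l < e/2) (filtermap y F)"
        using P(1) by (auto simp: eventually_filtermap elim: eventually_mono)
      moreover have "eventually (\<lambda>z. dist z l < e/2) (nhds l)"
        unfolding eventually_nhds_metric using \<open>e > 0\<close> by (intro exI[of _ "e/2"]) auto
      ultimately have "eventually (\<lambda>z. False) (inf (nhds l) (filtermap y F))"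
        unfolding eventually_inf by blast
      then show False using l(2) by (simp add: eventually_False)
    qed
    then obtain r where r: "P r" "dist (y r) l < e/2" by blast
    show "\<forall>\<^sub>F r' in F. dist (y r') l < e" using P(1)
    proof eventually_elim
      case (elim r')
      then show ?case using P(2)[OF elim r(1)] r(2) dist_triangle[of "y r'" l "y r"] by linarith
    qed
  qed
  with l(1) show ?thesis by blast
qed

lemma rational_at_right: "(at t within {t<..} \<inter> \<rat>) \<noteq> (bot :: real filter)"
proof -
  have "t islimpt ({t<..} \<inter> \<rat>)"
    unfolding islimpt_approachable
  proof (intro allI impI)
    fix e :: real assume "e > 0"
    then obtain r where "r \<in> \<rat>" "t < r" "r < t + e" using Rats_dense_in_real[of t "t+e"] by auto
    then show "\<exists>x'\<in>{t<..} \<inter> \<rat>. x' \<noteq> t \<and> dist x' t < e"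
      by (intro bexI[of _ r]) (auto simp: dist_real_def)
  qed
  then show ?thesis by (simp add: trivial_limit_within)
qed

lemma rational_at_left: "t > 0 \<Longrightarrow> (at t within {0..<t} \<inter> \<rat>) \<noteq> (bot :: real filter)"
proof -
  assume t: "t > 0"
  have "t islimpt ({0..<t} \<inter> \<rat>)"
    unfolding islimpt_approachable
  proof (intro allI impI)
    fix e :: real assume "e > 0"
    then obtain r where "r \<in> \<rat>" "max 0 (t - e) < r" "r < t"
      using Rats_dense_in_real[of "max 0 (t-e)" t] t by auto
    then show "\<exists>x'\<in>{0..<t} \<inter> \<rat>. x' \<noteq> t \<and> dist x' t < e"
      by (intro bexI[of _ r]) (auto simp: dist_real_def)
  qed
  then show ?thesis by (simp add: trivial_limit_within)
qed

lemma eventually_rational_at_right: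
  "eventually P (at t within {t<..} \<inter> \<rat>) \<longleftrightarrow> (\<exists>b>t. \<forall>r\<in>\<rat>. t < r \<longrightarrow> r < b \<longrightarrow> P r)" for t :: real
proof
  assume "eventually P (at t within {t<..} \<inter> \<rat>)"
  then obtain d where "d > 0" "\<And>r. r \<in> {t<..} \<inter> \<rat> \<Longrightarrow> r \<noteq> t \<Longrightarrow> dist r t < d \<Longrightarrow> P r"
    unfolding eventually_at by blast
  then show "\<exists>b>t. \<forall>r\<in>\<rat>. t < r \<longrightarrow> r < b \<longrightarrow> P r"
    by (intro exI[of _ "t + d"]) (auto simp: dist_real_def)
next
  assume "\<exists>b>t. \<forall>r\<in>\<rat>. t < r \<longrightarrow> r < b \<longrightarrow> P r"
  then obtain b where "b > t" "\<forall>r\<in>\<rat>. t < r \<longrightarrow> r < b \<longrightarrow> P r" by blast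
  then show "eventually P (at t within {t<..} \<inter> \<rat>)"
    unfolding eventually_at by (intro exI[of _ "b - t"]) (auto simp: dist_real_def)
qed

lemma eventually_rational_at_left:
  "eventually P (at t within {0..<t} \<inter> \<rat>) \<longleftrightarrow> (\<exists>b<t. \<forall>r\<in>\<rat>. 0 \<le> r \<longrightarrow> b < r \<longrightarrow> r < t \<longrightarrow> P r)" for t :: real
proof
  assume "eventually P (at t within {0..<t} \<inter> \<rat>)"
  then obtain d where "d > 0" "\<And>r. r \<in> {0..<t} \<inter> \<rat> \<Longrightarrow> r \<noteq> t \<Longrightarrow> dist r t < d \<Longrightarrow> P r"
    unfolding eventually_at by blast
  then show "\<exists>b<t. \<forall>r\<in>\<rat>. 0 \<le> r \<longrightarrow> b < r \<longrightarrow> r < t \<longrightarrow> P r"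
    by (intro exI[of _ "t - d"]) (auto simp: dist_real_def)
next
  assume "\<exists>b<t. \<forall>r\<in>\<rat>. 0 \<le> r \<longrightarrow> b < r \<longrightarrow> r < t \<longrightarrow> P r"
  then obtain b where "b < t" "\<forall>r\<in>\<rat>. 0 \<le> r \<longrightarrow> b < r \<longrightarrow> r < t \<longrightarrow> P r" by blast
  then show "eventually P (at t within {0..<t} \<inter> \<rat>)"
    unfolding eventually_at by (intro exI[of _ "t - b"]) (auto simp: dist_real_def)
qed

text \<open>
  The limit \<open>y\<close> on the rationals need not be right continuous there, so the limit path is obtained
  from right limits of \<open>y\<close>. One-sided limits exist because \<open>q \<circ> y\<close> is monotone and bounded and controls the increments
  of \<open>y\<close>. The last two properties say that values of \<open>y\<close> and of the limit path interlace.
\<close>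

lemma controlled_limit_path:
  fixes y :: "real \<Rightarrow> 'b::metric_space"
  assumes S: "compact S" and q: "continuous_on S q" and c: "c > 0" and h: "\<And>m. h m > 0" and e: "e \<longlonglongrightarrow> 0"
    and xs: "\<And>n. xs n \<in> controlled_paths S q c h e"
    and y: "\<And>r. r \<in> \<rat> \<Longrightarrow> 0 \<le> r \<Longrightarrow> y r \<in> S"
    and lim: "\<And>r. r \<in> \<rat> \<Longrightarrow> 0 \<le> r \<Longrightarrow> (\<lambda>n. xs n r) \<longlonglongrightarrow> y r"
  obtains x where "x \<in> controlled_paths S q c h e"
    "\<And>s r. 0 \<le> s \<Longrightarrow> s < r \<Longrightarrow> r \<in> \<rat> \<Longrightarrow> (dist (x s) (y r))\<^sup>2 \<le> c * (q (x s) - q (y r))"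
    "\<And>r t. 0 \<le> r \<Longrightarrow> r \<le> t \<Longrightarrow> r \<in> \<rat> \<Longrightarrow> (dist (y r) (x t))\<^sup>2 \<le> c * (q (y r) - q (x t))"
proof -
  have xsS: "xs n t \<in> S" if "0 \<le> t" for n t
    using xs[of n] that by (auto simp: controlled_paths_def intro: cadlag_in)
  have qlim: "(\<lambda>n. q (xs n r)) \<longlonglongrightarrow> q (y r)" if "r \<in> \<rat>" "0 \<le> r" for r
    using continuous_on_tendsto_compose[OF q lim[OF that] y[OF that]] xsS[OF that(2)] by simp
  have yctrl: "(dist (y r) (y r'))\<^sup>2 \<le> c * (q (y r) - q (y r'))"
    if "r \<in> \<rat>" "0 \<le> r" "r' \<in> \<rat>" "r \<le> r'" for r r'
  proof (rule LIMSEQ_le)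
    show "(\<lambda>n. (dist (xs n r) (xs n r'))\<^sup>2) \<longlonglongrightarrow> (dist (y r) (y r'))\<^sup>2"
      using lim that by (intro tendsto_intros) auto
    show "(\<lambda>n. c * (q (xs n r) - q (xs n r'))) \<longlonglongrightarrow> c * (q (y r) - q (y r'))"
      using qlim that by (intro tendsto_intros) auto
    show "\<exists>N. \<forall>n\<ge>N. (dist (xs n r) (xs n r'))\<^sup>2 \<le> c * (q (xs n r) - q (xs n r'))"
      using xs that by (auto simp: controlled_paths_def)
  qed
  have yanti: "q (y r') \<le> q (y r)" if "r \<in> \<rat>" "0 \<le> r" "r' \<in> \<rat>" "r \<le> r'" for r r'
  proof -
    have "0 \<le> c * (q (y r) - q (y r'))" using yctrl[OF that] by (meson order_trans zero_le_power2)
    then show ?thesis using c by (simp add: zero_le_mult_iff)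
  qed
  have close: "dist (y r) (y r') < \<epsilon>"
    if "r \<in> \<rat>" "0 \<le> r" "r' \<in> \<rat>" "0 \<le> r'" "\<epsilon> > 0" "\<bar>q (y r) - q (y r')\<bar> < \<epsilon>\<^sup>2 / c" for r r' \<epsilon>
  proof -
    have "(dist (y r) (y r'))\<^sup>2 \<le> c * \<bar>q (y r) - q (y r')\<bar>"
    proof (cases "r \<le> r'")
      case True
      then show ?thesis using yctrl[OF that(1,2,3) True] yanti[OF that(1,2,3) True] by simp
    next
      case False
      then have "r' \<le> r" by simp
      then show ?thesis using yctrl[OF that(3,4,1)] yanti[OF that(3,4,1)] by (simp add: dist_commute)
    qed
    also have "\<dots> < c * (\<epsilon>\<^sup>2 / c)" using that(6) c by (rule mult_strict_left_mono)
    also have "\<dots> = \<epsilon>\<^sup>2" using c by simp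
    finally show ?thesis by (rule power2_less_imp_less) (use that(5) in simp)
  qed
  have "compact (q ` S)" using S q by (rule compact_continuous_image[rotated])
  then have bq: "bounded (q ` S)" by (rule compact_imp_bounded)
  let ?R = "\<lambda>t. at t within {t<..} \<inter> \<rat>"
  have right: "\<exists>l\<in>S. (y \<longlongrightarrow> l) (?R t)" if t: "0 \<le> t" for t
  proof (rule compact_Cauchy_filter_limit[OF S rational_at_right])
    show "\<forall>\<^sub>F r in ?R t. y r \<in> S"
      using y t by (auto simp: eventually_rational_at_right intro!: exI[of _ "t+1"])
    fix \<epsilon> :: real assume \<epsilon>: "\<epsilon> > 0"
    define A where "A = (\<lambda>r. q (y r)) ` ({t<..} \<inter> \<rat>)"
    have "A \<subseteq> q ` S" using y t by (auto simp: A_def)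
    then have bdd: "bdd_above A" by (intro bounded_imp_bdd_above bounded_subset[OF bq])
    have ne: "A \<noteq> {}" using Rats_dense_in_real[of t "t+1"] by (auto simp: A_def)
    have "\<exists>a\<in>A. Sup A - \<epsilon>\<^sup>2 / c < a" using \<epsilon> c by (intro less_cSupD[OF ne]) simp
    then obtain r0 where r0: "r0 \<in> \<rat>" "t < r0" "Sup A - \<epsilon>\<^sup>2 / c < q (y r0)" by (auto simp: A_def)
    have sup: "Sup A - \<epsilon>\<^sup>2 / c < q (y r) \<and> q (y r) \<le> Sup A" if "r \<in> \<rat>" "t < r" "r < r0" for r
      using yanti[of r r0] r0 that t cSup_upper[OF _ bdd, of "q (y r)"] by (auto simp: A_def)
    have "dist (y r) (y r') < \<epsilon>" if "r \<in> \<rat>" "t < r" "r < r0" "r' \<in> \<rat>" "t < r'" "r' < r0" for r r'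
    proof (rule close)
      show "\<bar>q (y r) - q (y r')\<bar> < \<epsilon>\<^sup>2 / c"
        using sup[OF that(1-3)] sup[OF that(4-6)] unfolding abs_less_iff by linarith
    qed (use that t \<epsilon> in auto)
    then show "\<exists>P. eventually P (?R t) \<and> (\<forall>r r'. P r \<longrightarrow> P r' \<longrightarrow> dist (y r) (y r') < \<epsilon>)"
      using r0 unfolding eventually_rational_at_right
      by (intro exI[of _ "\<lambda>r. r \<in> \<rat> \<and> t < r \<and> r < r0"]) auto
  qed
  let ?L = "\<lambda>t. at t within {0..<t} \<inter> \<rat>"
  have left: "\<exists>l\<in>S. (y \<longlongrightarrow> l) (?L t)" if t: "0 < t" for t
  proof (rule compact_Cauchy_filter_limit[OF S rational_at_left[OF t]])
    show "\<forall>\<^sub>F r in ?L t. y r \<in> S"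
      using y t by (auto simp: eventually_rational_at_left intro!: exI[of _ 0])
    fix \<epsilon> :: real assume \<epsilon>: "\<epsilon> > 0"
    define A where "A = (\<lambda>r. q (y r)) ` ({0..<t} \<inter> \<rat>)"
    have "A \<subseteq> q ` S" using y by (auto simp: A_def)
    then have bdd: "bdd_below A" by (intro bounded_imp_bdd_below bounded_subset[OF bq])
    have ne: "A \<noteq> {}" using t by (auto simp: A_def intro!: exI[of _ 0])
    have "\<exists>a\<in>A. a < Inf A + \<epsilon>\<^sup>2 / c" using \<epsilon> c by (intro cInf_lessD[OF ne]) simp
    then obtain r0 where r0: "r0 \<in> \<rat>" "0 \<le> r0" "r0 < t" "q (y r0) < Inf A + \<epsilon>\<^sup>2 / c" by (auto simp: A_def)
    have inf: "q (y r) < Inf A + \<epsilon>\<^sup>2 / c \<and> Inf A \<le> q (y r)" if "r \<in> \<rat>" "r0 < r" "r < t" for r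
      using yanti[of r0 r] r0 that t cInf_lower[OF _ bdd, of "q (y r)"] by (auto simp: A_def)
    have "dist (y r) (y r') < \<epsilon>" if "r \<in> \<rat>" "r0 < r" "r < t" "r' \<in> \<rat>" "r0 < r'" "r' < t" for r r'
    proof (rule close)
      show "\<bar>q (y r) - q (y r')\<bar> < \<epsilon>\<^sup>2 / c"
        using inf[OF that(1-3)] inf[OF that(4-6)] unfolding abs_less_iff by linarith
    qed (use that r0 \<epsilon> in auto)
    then show "\<exists>P. eventually P (?L t) \<and> (\<forall>r r'. P r \<longrightarrow> P r' \<longrightarrow> dist (y r) (y r') < \<epsilon>)"
      using r0 unfolding eventually_rational_at_left
      by (intro exI[of _ "\<lambda>r. r \<in> \<rat> \<and> r0 < r \<and> r < t"]) auto
  qed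
  define x where "x = (\<lambda>t\<in>{0..}. SOME l. l \<in> S \<and> (y \<longlongrightarrow> l) (?R t))"
  have x: "x t \<in> S" "(y \<longlongrightarrow> x t) (?R t)" if "0 \<le> t" for t
  proof -
    have "\<exists>l. l \<in> S \<and> (y \<longlongrightarrow> l) (?R t)" using right[OF that] by blast
    from someI_ex[OF this] show "x t \<in> S" "(y \<longlongrightarrow> x t) (?R t)" using that by (auto simp: x_def)
  qed
  have qx: "((\<lambda>r. q (y r)) \<longlongrightarrow> q (x t)) (?R t)" if t: "0 \<le> t" for t
    using y t
    by (intro continuous_on_tendsto_compose[OF q x(2,1)[OF t]])
      (auto simp: eventually_rational_at_right intro!: exI[of _ "t+1"])
  have near: "dist (x s) l \<le> \<epsilon>"
    if s: "0 \<le> s" "s < b" and "\<And>r. r \<in> \<rat> \<Longrightarrow> s < r \<Longrightarrow> r < b \<Longrightarrow> dist (y r) l < \<epsilon>" for s b l \<epsilon>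
  proof (rule tendsto_upperbound)
    show "((\<lambda>r. dist (y r) l) \<longlongrightarrow> dist (x s) l) (?R s)"
      using x(2)[OF s(1)] by (intro tendsto_intros)
    show "\<forall>\<^sub>F r in ?R s. dist (y r) l \<le> \<epsilon>"
      using that by (auto simp: eventually_rational_at_right less_imp_le intro!: exI[of _ b])
  qed (rule rational_at_right)
  have xy: "(dist (x s) (y r))\<^sup>2 \<le> c * (q (x s) - q (y r))" if "0 \<le> s" "s < r" "r \<in> \<rat>" for s r
  proof (rule tendsto_le[OF rational_at_right])
    show "((\<lambda>r'. c * (q (y r') - q (y r))) \<longlongrightarrow> c * (q (x s) - q (y r))) (?R s)"
      using qx that by (intro tendsto_intros)
    show "((\<lambda>r'. (dist (y r') (y r))\<^sup>2) \<longlongrightarrow> (dist (x s) (y r))\<^sup>2) (?R s)"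
      using x that by (intro tendsto_intros)
    show "\<forall>\<^sub>F r' in ?R s. (dist (y r') (y r))\<^sup>2 \<le> c * (q (y r') - q (y r))"
      using yctrl that by (auto simp: eventually_rational_at_right intro!: exI[of _ r])
  qed
  have yx: "(dist (y r) (x t))\<^sup>2 \<le> c * (q (y r) - q (x t))" if "0 \<le> r" "r \<le> t" "r \<in> \<rat>" for r t
  proof (rule tendsto_le[OF rational_at_right])
    show "((\<lambda>r'. c * (q (y r) - q (y r'))) \<longlongrightarrow> c * (q (y r) - q (x t))) (?R t)"
      using qx that by (intro tendsto_intros) auto
    show "((\<lambda>r'. (dist (y r) (y r'))\<^sup>2) \<longlongrightarrow> (dist (y r) (x t))\<^sup>2) (?R t)"
      using x that by (intro tendsto_intros) auto
    show "\<forall>\<^sub>F r' in ?R t. (dist (y r) (y r'))\<^sup>2 \<le> c * (q (y r) - q (y r'))"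
      using yctrl that by (auto simp: eventually_rational_at_right intro!: exI[of _ "t+1"])
  qed
  have ctrl: "(dist (x s) (x t))\<^sup>2 \<le> c * (q (x s) - q (x t))" if "0 \<le> s" "s \<le> t" for s t
  proof (cases "s = t")
    case False
    show ?thesis
    proof (rule tendsto_le[OF rational_at_right])
      show "((\<lambda>r'. c * (q (x s) - q (y r'))) \<longlongrightarrow> c * (q (x s) - q (x t))) (?R t)"
        using qx that by (intro tendsto_intros) auto
      show "((\<lambda>r'. (dist (x s) (y r'))\<^sup>2) \<longlongrightarrow> (dist (x s) (x t))\<^sup>2) (?R t)"
        using x that by (intro tendsto_intros) auto
      show "\<forall>\<^sub>F r' in ?R t. (dist (x s) (y r'))\<^sup>2 \<le> c * (q (x s) - q (y r'))"
        using xy that False by (auto simp: eventually_rational_at_right intro!: exI[of _ "t+1"])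
    qed
  qed simp
  have cad: "x \<in> cadlag S"
    unfolding cadlag_def
  proof (intro CollectI conjI allI impI)
    show "x \<in> {0..} \<rightarrow>\<^sub>E S" using x by (auto simp: x_def PiE_iff)
    show "(x \<longlongrightarrow> x t) (at_right t)" if t: "0 \<le> t" for t
    proof (rule tendstoI)
      fix \<epsilon> :: real assume "\<epsilon> > 0"
      then obtain b where b: "b > t" "\<And>r. r \<in> \<rat> \<Longrightarrow> t < r \<Longrightarrow> r < b \<Longrightarrow> dist (y r) (x t) < \<epsilon>/2"
        using tendstoD[OF x(2)[OF t], of "\<epsilon>/2"] unfolding eventually_rational_at_right by auto
      have "dist (x s) (x t) \<le> \<epsilon>/2" if "t < s" "s < b" for s
        using that t b by (intro near[of s b]) auto
      then show "\<forall>\<^sub>F s in at_right t. dist (x s) (x t) < \<epsilon>"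
        using b(1) \<open>\<epsilon> > 0\<close> unfolding eventually_at_right_field by (intro exI[of _ b]) force
    qed
    show "\<exists>l\<in>S. (x \<longlongrightarrow> l) (at_left t)" if t: "0 < t" for t
    proof -
      obtain l where l: "l \<in> S" "(y \<longlongrightarrow> l) (?L t)" using left[OF t] by blast
      have "(x \<longlongrightarrow> l) (at_left t)"
      proof (rule tendstoI)
        fix \<epsilon> :: real assume "\<epsilon> > 0"
        then obtain b where b: "b < t" "\<And>r. r \<in> \<rat> \<Longrightarrow> 0 \<le> r \<Longrightarrow> b < r \<Longrightarrow> r < t \<Longrightarrow> dist (y r) l < \<epsilon>/2"
          using tendstoD[OF l(2), of "\<epsilon>/2"] unfolding eventually_rational_at_left by auto
        have "dist (x s) l \<le> \<epsilon>/2" if "max 0 b < s" "s < t" for s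
          using that b by (intro near[of s t]) auto
        then show "\<forall>\<^sub>F s in at_left t. dist (x s) l < \<epsilon>"
          using b(1) \<open>\<epsilon> > 0\<close> t unfolding eventually_at_left_field by (intro exI[of _ "max 0 b"]) force
      qed
      with l(1) show ?thesis by blast
    qed
  qed
  have zero: "q (x 0) - q (x t) \<le> e m" if "0 \<le> t" "t < h m" for m t
  proof -
    have y0: "q (y 0) - q (y r) \<le> e m" if "r \<in> \<rat>" "0 \<le> r" "r < h m" for r m
    proof (rule LIMSEQ_le_const2)
      show "(\<lambda>n. q (xs n 0) - q (xs n r)) \<longlonglongrightarrow> q (y 0) - q (y r)"
        using qlim that by (intro tendsto_intros) auto
      show "\<exists>N. \<forall>n\<ge>N. q (xs n 0) - q (xs n r) \<le> e m"
        using xs that by (auto simp: controlled_paths_def)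
    qed
    have yx0: "q (y 0) - q (x t) \<le> e m" if "0 \<le> t" "t < h m" for t m
    proof (rule tendsto_upperbound[OF _ _ rational_at_right])
      show "((\<lambda>r. q (y 0) - q (y r)) \<longlongrightarrow> q (y 0) - q (x t)) (?R t)"
        using qx that by (intro tendsto_intros) auto
      show "\<forall>\<^sub>F r in ?R t. q (y 0) - q (y r) \<le> e m"
        using y0 that by (auto simp: eventually_rational_at_right intro!: exI[of _ "h m"])
    qed
    have "q (x 0) \<le> q (y 0)"
    proof -
      have "0 \<le> c * (q (y 0) - q (x 0))" using yx[of 0 0] by (meson Rats_0 order_refl order_trans zero_le_power2)
      then show ?thesis using c by (simp add: zero_le_mult_iff)
    qed
    then show ?thesis using yx0[OF that] by simp
  qed
  have three: "min (q (x s) - q (x t)) (q (x t) - q (x u)) \<le> e m"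
    if stu: "0 \<le> s" "s < t" "t < u" "u < s + h m" for m s t u
  proof -
    have 1: "min (q (y r1) - q (y r2)) (q (y r2) - q (y r3)) \<le> e m"
      if "r1 \<in> \<rat>" "r2 \<in> \<rat>" "r3 \<in> \<rat>" "0 \<le> r1" "r1 < r2" "r2 < r3" "r3 < r1 + h m" for r1 r2 r3
    proof (rule LIMSEQ_le_const2)
      show "(\<lambda>n. min (q (xs n r1) - q (xs n r2)) (q (xs n r2) - q (xs n r3)))
        \<longlonglongrightarrow> min (q (y r1) - q (y r2)) (q (y r2) - q (y r3))"
        using qlim that by (intro tendsto_intros tendsto_min) auto
      show "\<exists>N. \<forall>n\<ge>N. min (q (xs n r1) - q (xs n r2)) (q (xs n r2) - q (xs n r3)) \<le> e m"
        using xs that unfolding controlled_paths_def by blast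
    qed
    have 2: "min (q (x s) - q (y r2)) (q (y r2) - q (y r3)) \<le> e m"
      if "r2 \<in> \<rat>" "r3 \<in> \<rat>" "s < r2" "r2 < r3" "r3 < s + h m" for r2 r3
    proof (rule tendsto_upperbound[OF _ _ rational_at_right])
      show "((\<lambda>r1. min (q (y r1) - q (y r2)) (q (y r2) - q (y r3))) \<longlongrightarrow>
          min (q (x s) - q (y r2)) (q (y r2) - q (y r3))) (?R s)"
        using qx[OF stu(1)] by (intro tendsto_intros tendsto_min)
      show "\<forall>\<^sub>F r1 in ?R s. min (q (y r1) - q (y r2)) (q (y r2) - q (y r3)) \<le> e m"
        unfolding eventually_rational_at_right
        using that stu by (intro exI[of _ r2] conjI ballI impI 1) auto
    qed
    have 3: "min (q (x s) - q (x t)) (q (x t) - q (y r3)) \<le> e m"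
      if "r3 \<in> \<rat>" "t < r3" "r3 < s + h m" for r3
    proof (rule tendsto_upperbound[OF _ _ rational_at_right])
      show "((\<lambda>r2. min (q (x s) - q (y r2)) (q (y r2) - q (y r3))) \<longlongrightarrow>
          min (q (x s) - q (x t)) (q (x t) - q (y r3))) (?R t)"
        using qx[of t] stu by (intro tendsto_intros tendsto_min) auto
      show "\<forall>\<^sub>F r2 in ?R t. min (q (x s) - q (y r2)) (q (y r2) - q (y r3)) \<le> e m"
        unfolding eventually_rational_at_right
        using that stu by (intro exI[of _ r3] conjI ballI impI 2) auto
    qed
    show ?thesis
    proof (rule tendsto_upperbound[OF _ _ rational_at_right])
      show "((\<lambda>r3. min (q (x s) - q (x t)) (q (x t) - q (y r3))) \<longlongrightarrow>
          min (q (x s) - q (x t)) (q (x t) - q (x u))) (?R u)"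
        using qx[of u] stu by (intro tendsto_intros tendsto_min) auto
      show "\<forall>\<^sub>F r3 in ?R u. min (q (x s) - q (x t)) (q (x t) - q (y r3)) \<le> e m"
        unfolding eventually_rational_at_right
        using that stu by (intro exI[of _ "s + h m"] conjI ballI impI 3) auto
    qed
  qed
  have "x \<in> controlled_paths S q c h e"
    unfolding controlled_paths_def by (intro CollectI conjI allI impI cad ctrl zero three)
  then show ?thesis using xy yx by (rule that)
qed

lemma pointwise_convergent_subsequence:
  fixes f :: "nat \<Rightarrow> 'a::countable \<Rightarrow> 'b::metric_space"
  assumes S: "compact S" and f: "\<And>n a. f n a \<in> S"
  obtains g k where "\<And>a. g a \<in> S" "strict_mono (k :: nat \<Rightarrow> nat)" "\<And>a. (\<lambda>n. f (k n) a) \<longlonglongrightarrow> g a"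
proof -
  have "compact (PiE UNIV (\<lambda>_. S) :: ('a \<Rightarrow> 'b) set)"
    using compactin_PiE[of "\<lambda>_. euclidean" UNIV "\<lambda>_. S"] S
    by (simp add: euclidean_product_topology)
  then have "seq_compact (PiE UNIV (\<lambda>_. S) :: ('a \<Rightarrow> 'b) set)" by (rule compact_imp_seq_compact)
  then obtain g k where g: "g \<in> PiE UNIV (\<lambda>_. S)" "strict_mono (k :: nat \<Rightarrow> nat)" "(f \<circ> k) \<longlonglongrightarrow> g"
    using f by (auto elim!: seq_compactE)
  have "(\<lambda>n. f (k n) a) \<longlonglongrightarrow> g a" for a
    using continuous_on_tendsto_compose[OF continuous_on_product_coordinates[of a] g(3)]
    by (simp add: o_def)
  then show ?thesis using that[of g k] g by auto
qed

theorem compactin_controlled_paths: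
  assumes S: "compact S" and q: "continuous_on S q" and c: "c > 0" and h: "\<And>m. h m > 0" and e: "e \<longlonglongrightarrow> 0"
  shows "compactin (J1_topology S) (controlled_paths S q c h e)"
proof -
  interpret J: Metric_space "cadlag S" "J1_dist S" by (rule J1_Metric_space)
  have sub: "controlled_paths S q c h e \<subseteq> cadlag S" by (auto simp: controlled_paths_def)
  have "\<exists>l r. l \<in> controlled_paths S q c h e \<and> strict_mono r \<and> limitin (J1_topology S) (xs \<circ> r) l sequentially"
    if xs: "range xs \<subseteq> controlled_paths S q c h e" for xs :: "nat \<Rightarrow> _"
  proof -
    have xsc: "xs n \<in> controlled_paths S q c h e" for n using xs by auto
    \<comment> \<open>Negative rationals are sent to \<open>0\<close>, because paths carry no information at negative times.\<close>
    have "xs n (max 0 (of_rat a)) \<in> S" for n a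
      by (intro cadlag_in[OF subsetD[OF sub xsc]]) simp
    from pointwise_convergent_subsequence[of S "\<lambda>n a. xs n (max 0 (of_rat a))", OF S this]
    obtain g k where g: "\<And>a. g a \<in> S" "strict_mono (k :: nat \<Rightarrow> nat)"
        "\<And>a :: rat. (\<lambda>n. xs (k n) (max 0 (of_rat a))) \<longlonglongrightarrow> g a" by blast
    define y where "y r = g (inv of_rat r)" for r :: real
    have y: "y r \<in> S" "(\<lambda>n. xs (k n) r) \<longlonglongrightarrow> y r" if r: "r \<in> \<rat>" "0 \<le> r" for r
    proof -
      obtain a where "r = of_rat a" using r by (auto simp: Rats_def)
      then have "of_rat (inv of_rat r :: rat) = r" by (metis f_inv_into_f rangeI)
      then show "y r \<in> S" "(\<lambda>n. xs (k n) r) \<longlonglongrightarrow> y r"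
        using g(1) g(3)[of "inv of_rat r"] r by (simp_all add: y_def)
    qed
    obtain x where x: "x \<in> controlled_paths S q c h e"
      "\<And>s r. 0 \<le> s \<Longrightarrow> s < r \<Longrightarrow> r \<in> \<rat> \<Longrightarrow> (dist (x s) (y r))\<^sup>2 \<le> c * (q (x s) - q (y r))"
      "\<And>r t. 0 \<le> r \<Longrightarrow> r \<le> t \<Longrightarrow> r \<in> \<rat> \<Longrightarrow> (dist (y r) (x t))\<^sup>2 \<le> c * (q (y r) - q (x t))"
      by (rule controlled_limit_path[where xs = "\<lambda>n. xs (k n)" and y = y, OF S q c h e xsc y]) auto
    have ev: "\<forall>\<^sub>F n in sequentially. xs (k n) \<in> J1_nbhd S x K \<epsilon>" if "\<epsilon> > 0" for K \<epsilon>
      by (rule controlled_J1_convergence[where y = y, OF q c h e xsc x(1) y x(2,3) that])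
    have "limitin (J1_topology S) (xs \<circ> k) x sequentially"
      unfolding limitin_def topspace_J1
    proof (intro conjI allI impI)
      show "x \<in> cadlag S" using x(1) sub by blast
      fix U assume "openin (J1_topology S) U \<and> x \<in> U"
      then obtain K \<epsilon> where U: "\<epsilon> > 0" "J1_nbhd S x K \<epsilon> \<subseteq> U" unfolding openin_J1 by blast
      show "\<forall>\<^sub>F n in sequentially. (xs \<circ> k) n \<in> U"
        using ev[OF U(1), of K] by (rule eventually_mono) (use U(2) in auto)
    qed
    with x(1) g(2) show ?thesis by blast
  qed
  then show ?thesis
    using sub unfolding mtopology_J1_dist[symmetric, of S] J.compactin_sequentially by blast
qed

section \<open>Paths in trees and ranked component sizes\<close>

lemma adjacency_sym: "sym (adjacency E)"
  by (auto simp: adjacency_def sym_def insert_commute)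

lemma adjacency_mono: "A \<subseteq> B \<Longrightarrow> adjacency A \<subseteq> adjacency B"
  by (auto simp: adjacency_def)

lemma connected_mono: "A \<subseteq> B \<Longrightarrow> (u, v) \<in> (adjacency A)\<^sup>* \<Longrightarrow> (u, v) \<in> (adjacency B)\<^sup>*"
  using rtrancl_mono[OF adjacency_mono] by blast

lemma connected_sym: "(u, v) \<in> (adjacency E)\<^sup>* \<Longrightarrow> (v, u) \<in> (adjacency E)\<^sup>*"
  by (meson adjacency_sym sym_rtrancl symD)

lemma connected_insert:
  assumes "(u, v) \<in> (adjacency (insert {x, y} A))\<^sup>*" "(u, v) \<notin> (adjacency A)\<^sup>*"
  shows "(u, x) \<in> (adjacency A)\<^sup>* \<and> (y, v) \<in> (adjacency A)\<^sup>* \<or>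
         (u, y) \<in> (adjacency A)\<^sup>* \<and> (x, v) \<in> (adjacency A)\<^sup>*"
proof -
  have eq: "adjacency (insert {x, y} A) = insert (x, y) (insert (y, x) (adjacency A))"
    by (auto simp: adjacency_def doubleton_eq_iff)
  show ?thesis
    using assms unfolding eq rtrancl_insert[of x y] rtrancl_insert[of y x]
    by (auto dest: rtrancl_trans)
qed

text \<open>
  A shortest path from \<open>x\<close> to \<open>y\<close> avoiding the edge would close up to a cycle with it; minimality makes
  its vertices distinct.
\<close>

lemma acyclic_edge_separates:
  assumes acyc: "\<nexists>p. is_cycle E p" and e: "{x, y} \<in> E" "x \<noteq> y"
  shows "(x, y) \<notin> (adjacency (E - {{x, y}}))\<^sup>*"
proof
  let ?r = "adjacency (E - {{x, y}})"
  assume "(x, y) \<in> ?r\<^sup>*"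
  then have ex: "\<exists>n. (x, y) \<in> ?r ^^ n" by (simp add: rtrancl_power)
  define n where "n = (LEAST n. (x, y) \<in> ?r ^^ n)"
  have n: "(x, y) \<in> ?r ^^ n" using LeastI_ex[OF ex] by (simp add: n_def)
  have least: "n \<le> m" if "(x, y) \<in> ?r ^^ m" for m using Least_le[of _ m] that by (simp add: n_def)
  obtain f where f: "f 0 = x" "f n = y" "\<And>i. i < n \<Longrightarrow> (f i, f (Suc i)) \<in> ?r"
    using n unfolding relpow_fun_conv by blast
  have sub: "(f i, f (i + k)) \<in> ?r ^^ k" if "i + k \<le> n" for i k
    unfolding relpow_fun_conv using that f(3) by (intro exI[of _ "\<lambda>j. f (i + j)"]) auto
  have ne: "f i \<noteq> f j" if ij: "i < j" "j \<le> n" for i j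
  proof
    assume "f i = f j"
    have "(x, f i) \<in> ?r ^^ i" using sub[of 0 i] f(1) ij by simp
    moreover have "(f i, y) \<in> ?r ^^ (n - j)" using sub[of j "n - j"] f(2) ij \<open>f i = f j\<close> by simp
    ultimately have "(x, y) \<in> ?r ^^ (i + (n - j))" unfolding relpow_add by blast
    then show False using least[of "i + (n - j)"] ij by simp
  qed
  then have inj: "inj_on f {0..<Suc n}"
    by (intro linorder_inj_onI) auto
  have "n \<noteq> 0" using f e(2) by metis
  moreover have "n \<noteq> 1"
  proof
    assume "n = 1"
    then show False using f(1,2) f(3)[of 0] by (auto simp: adjacency_def)
  qed
  ultimately have n2: "2 \<le> n" by simp
  define p where "p = map f [0..<Suc n]"
  have nth: "p ! i = f i" if "i \<le> n" for i using that by (simp add: p_def nth_map del: upt_Suc)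
  have "is_cycle E p"
    unfolding is_cycle_def
  proof (intro conjI allI impI)
    show "3 \<le> length p" using n2 by (simp add: p_def)
    show "distinct p" using inj by (simp add: p_def distinct_map del: upt_Suc)
    fix i assume "i < length p"
    then have i: "i \<le> n" by (simp add: p_def)
    show "{p ! i, p ! (Suc i mod length p)} \<in> E"
    proof (cases "i = n")
      case True
      then show ?thesis using nth[of n] nth[of 0] f e by (simp add: p_def insert_commute del: upt_Suc)
    next
      case False
      then have "Suc i mod length p = Suc i" using i by (simp add: p_def)
      then show ?thesis using f(3)[of i] i False nth by (auto simp: adjacency_def)
    qed
  qed
  with acyc show False by blast
qed

text \<open>
  This is the uniqueness of paths in a forest, in a form that avoids paths. An edge of \<open>A\<close> outside \<open>B\<close>
  can be dropped: if it were needed to connect \<open>u\<close> and \<open>v\<close> in \<open>A\<close>, its two ends would be connected through \<open>A\<close> without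
  it and through \<open>B\<close>, contradicting \<open>acyclic_edge_separates\<close>.
\<close>

lemma acyclic_connected_Int:
  assumes acyc: "\<nexists>p. is_cycle E p" and E: "finite E" "\<And>e. e \<in> E \<Longrightarrow> card e = 2"
    and AB: "A \<subseteq> E" "B \<subseteq> E"
    and conn: "(u, v) \<in> (adjacency A)\<^sup>*" "(u, v) \<in> (adjacency B)\<^sup>*"
  shows "(u, v) \<in> (adjacency (A \<inter> B))\<^sup>*"
proof -
  have "finite (A - B)" using AB E by (meson finite_Diff finite_subset)
  then show ?thesis using AB conn
  proof (induction "A - B" arbitrary: A rule: finite_induct)
    case empty
    then have "A \<inter> B = A" by blast
    then show ?case using empty by simp
  next
    case (insert e F)
    have e: "e \<in> A" "e \<notin> B" "e \<in> E" using insert by auto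
    obtain x y where xy: "e = {x, y}" "x \<noteq> y" using E(2)[OF e(3)] by (auto simp: card_2_iff)
    define A' where "A' = A - {e}"
    have A: "A = insert {x, y} A'" using e xy by (auto simp: A'_def)
    have "(u, v) \<in> (adjacency A')\<^sup>*"
    proof (rule ccontr)
      assume not: "(u, v) \<notin> (adjacency A')\<^sup>*"
      have sub: "A' \<subseteq> E - {{x, y}}" "B \<subseteq> E - {{x, y}}" using insert.prems e xy by (auto simp: A'_def)
      have B: "(u, v) \<in> (adjacency (E - {{x, y}}))\<^sup>*" using connected_mono[OF sub(2)] insert.prems by blast
      have "(x, y) \<in> (adjacency (E - {{x, y}}))\<^sup>*"
        using connected_insert[of u v x y A'] not insert.prems(3) B
          connected_mono[OF sub(1)] unfolding A
        by (meson connected_sym rtrancl_trans)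
      then show False using acyclic_edge_separates[OF acyc, of x y] e xy by auto
    qed
    moreover have "F = A' - B" "A' \<subseteq> E" using insert e by (auto simp: A'_def)
    ultimately have "(u, v) \<in> (adjacency (A' \<inter> B))\<^sup>*" using insert by blast
    moreover have "A' \<inter> B = A \<inter> B" using e by (auto simp: A'_def)
    ultimately show ?case by simp
  qed
qed

text \<open>
  In a tree this is the edge set of the path from \<open>u\<close> to \<open>v\<close>, namely the least edge set connecting them.
\<close>

definition tree_path :: "'v set set \<Rightarrow> 'v \<Rightarrow> 'v \<Rightarrow> 'v set set" where
  "tree_path E u v = \<Inter> {A. A \<subseteq> E \<and> (u, v) \<in> (adjacency A)\<^sup>*}"

lemma finite_all_edges: "finite V \<Longrightarrow> finite (all_edges V)"
  unfolding all_edges_def by (rule finite_subset[of _ "Pow V"]) auto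

lemma is_tree_finite: "is_tree V E \<Longrightarrow> finite E"
  unfolding is_tree_def using finite_all_edges finite_subset by blast

lemma tree_path:
  assumes tree: "is_tree V E" and uv: "u \<in> V" "v \<in> V"
  shows "tree_path E u v \<subseteq> E"
    and "A \<subseteq> E \<Longrightarrow> (u, v) \<in> (adjacency A)\<^sup>* \<longleftrightarrow> tree_path E u v \<subseteq> A"
proof -
  let ?P = "\<lambda>A. A \<subseteq> E \<and> (u, v) \<in> (adjacency A)\<^sup>*"
  have fin: "finite E" using is_tree_finite[OF tree] .
  have acyc: "\<nexists>p. is_cycle E p" and ed: "\<And>e. e \<in> E \<Longrightarrow> card e = 2"
    using tree by (auto simp: is_tree_def all_edges_def)
  have PE: "?P E" using tree uv by (auto simp: is_tree_def)
  obtain A0 where A0: "?P A0" "\<And>B. ?P B \<Longrightarrow> card A0 \<le> card B"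
    using ex_has_least_nat[of ?P E card] PE by blast
  have "A0 \<subseteq> B" if B: "?P B" for B
  proof -
    have "?P (A0 \<inter> B)"
      using acyclic_connected_Int[OF acyc fin ed, of A0 B u v] A0(1) B by blast
    then have "A0 \<inter> B = A0"
      using A0 fin by (metis card_seteq finite_subset inf_le1)
    then show ?thesis by blast
  qed
  then have path: "tree_path E u v = A0" using A0(1) unfolding tree_path_def by blast
  show "tree_path E u v \<subseteq> E" using path A0(1) by simp
  show "(u, v) \<in> (adjacency A)\<^sup>* \<longleftrightarrow> tree_path E u v \<subseteq> A" if "A \<subseteq> E"
    using path A0(1) connected_mono[of A0 A u v] \<open>\<And>B. ?P B \<Longrightarrow> A0 \<subseteq> B\<close> that by blast
qed

lemma component_relation_equiv: "equiv V ((adjacency E)\<^sup>* \<inter> V \<times> V)"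
proof (rule equivI)
  show "refl_on V ((adjacency E)\<^sup>* \<inter> V \<times> V)" by (auto simp: refl_on_def)
  show "sym ((adjacency E)\<^sup>* \<inter> V \<times> V)" using connected_sym by (auto simp: sym_def)
  show "trans ((adjacency E)\<^sup>* \<inter> V \<times> V)" by (auto simp: trans_def dest: rtrancl_trans)
qed auto

lemma card_equiv_eq_sum_squares:
  assumes "equiv V r" "finite V"
  shows "card r = (\<Sum>C\<in>V // r. (card C)\<^sup>2)"
proof -
  have r: "r = (\<Union>C\<in>V // r. C \<times> C)"
  proof (intro equalityI subrelI)
    fix u v assume uv: "(u, v) \<in> r"
    then have "u \<in> V" using assms(1) equiv_class_eq_iff by fastforce
    then have "r `` {u} \<in> V // r" "u \<in> r `` {u}" "v \<in> r `` {u}"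
      using uv equiv_class_self[OF assms(1)] by (auto intro: quotientI)
    then show "(u, v) \<in> (\<Union>C\<in>V // r. C \<times> C)" by blast
  next
    fix u v assume "(u, v) \<in> (\<Union>C\<in>V // r. C \<times> C)"
    then obtain C where "C \<in> V // r" "u \<in> C" "v \<in> C" by blast
    then show "(u, v) \<in> r" using quotient_eq_iff[OF assms(1), of C C u v] by simp
  qed
  have fin: "finite (V // r)" "\<And>C. C \<in> V // r \<Longrightarrow> finite C"
    by (rule finite_quotient[OF assms(2) equiv_type[OF assms(1)]],
        rule finite_equiv_class[OF assms(2) equiv_type[OF assms(1)]])
  have "card (\<Union>C\<in>V // r. C \<times> C) = (\<Sum>C\<in>V // r. card (C \<times> C))"
  proof (rule card_UN_disjoint)
    show "\<forall>C\<in>V // r. \<forall>D\<in>V // r. C \<noteq> D \<longrightarrow> (C \<times> C) \<inter> (D \<times> D) = {}"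
      using quotient_disj[OF assms(1)] by (metis Sigma_empty1 Times_Int_Times)
  qed (use fin in auto)
  then show ?thesis using r by (simp add: card_cartesian_product power2_eq_square)
qed

lemma card_eq_sum_classes:
  assumes "equiv V r" "finite V"
  shows "card V = (\<Sum>C\<in>V // r. card C)"
proof -
  have fin: "finite (V // r)" "\<And>C. C \<in> V // r \<Longrightarrow> finite C"
    by (rule finite_quotient[OF assms(2) equiv_type[OF assms(1)]],
        rule finite_equiv_class[OF assms(2) equiv_type[OF assms(1)]])
  have "card (\<Union>(V // r)) = (\<Sum>C\<in>V // r. card C)"
  proof (rule card_Union_disjoint)
    show "pairwise disjnt (V // r)"
      using quotient_disj[OF assms(1)] unfolding pairwise_def disjnt_def by blast
  qed (use fin in auto)
  then show ?thesis using Union_quotient[OF assms(1)] by simp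
qed

definition ranked_size :: "'v set \<Rightarrow> 'v set set \<Rightarrow> nat \<Rightarrow> nat" where
  "ranked_size V E k =
     (if k < length (component_sizes V E) then component_sizes V E ! k else 0)"

lemma fragmentation_ranked_size:
  "fragmentation V E d t i = real (ranked_size V (surviving_edges E d t) i) / real (card V)"
  by (simp add: fragmentation_def ranked_size_def Let_def)

lemma mset_component_sizes:
  "mset (component_sizes V E) = image_mset card (mset_set (components V E))"
  by (simp add: component_sizes_def)

lemma component_sizes_sorted: "sorted_wrt (\<ge>) (component_sizes V E)"
  unfolding component_sizes_def sorted_wrt_rev
  using sorted_sorted_list_of_multiset by (simp add: sorted_wrt_rev)

lemma sorted_desc_nth_ge_iff:
  fixes xs :: "'a::linorder list"
  assumes "sorted_wrt (\<ge>) xs"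
  shows "k < length xs \<and> a \<le> xs ! k \<longleftrightarrow> k < length (filter ((\<le>) a) xs)"
  using assms
proof (induction xs arbitrary: k)
  case (Cons x xs)
  show ?case
  proof (cases "a \<le> x")
    case True
    then show ?thesis using Cons by (cases k) auto
  next
    case False
    then have lt: "y < a" if "y \<in> set (x # xs)" for y using that Cons.prems by fastforce
    then have "filter ((\<le>) a) (x # xs) = []" by (auto simp: filter_empty_conv not_le)
    moreover have "\<not> a \<le> (x # xs) ! k" if "k < length (x # xs)"
      using lt nth_mem[OF that] by (auto simp: not_le)
    ultimately show ?thesis by auto
  qed
qed simp

lemma components_finite: "finite V \<Longrightarrow> finite (components V E)"
  unfolding components_def by (rule finite_quotient) auto

text \<open>
  Ranked sizes are handled through the number of components of at least a given size, which is
  insensitive to the arrangement.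
\<close>

lemma ranked_size_ge_iff:
  assumes V: "finite V" and a: "1 \<le> a"
  shows "a \<le> ranked_size V E k \<longleftrightarrow> k < card {C \<in> components V E. a \<le> card C}"
proof -
  let ?xs = "component_sizes V E"
  have "length (filter ((\<le>) a) ?xs) = size (filter_mset ((\<le>) a) (mset ?xs))"
    by (metis mset_filter size_mset)
  also have "\<dots> = size (image_mset card (filter_mset (\<lambda>C. a \<le> card C) (mset_set (components V E))))"
    unfolding mset_component_sizes filter_mset_image_mset by simp
  also have "\<dots> = card {C \<in> components V E. a \<le> card C}"
    using components_finite[OF V] by (simp add: filter_mset_mset_set)
  finally have "length (filter ((\<le>) a) ?xs) = card {C \<in> components V E. a \<le> card C}" .
  moreover have "a \<le> ranked_size V E k \<longleftrightarrow> k < length ?xs \<and> a \<le> ?xs ! k"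
    using a by (auto simp: ranked_size_def)
  ultimately show ?thesis using sorted_desc_nth_ge_iff[OF component_sizes_sorted, of k V E a] by simp
qed

lemma ranked_size_decseq: "decseq (ranked_size V E)"
proof (rule decseq_SucI)
  fix k
  show "ranked_size V E (Suc k) \<le> ranked_size V E k"
    using sorted_wrt_nth_less[OF component_sizes_sorted, of k "Suc k" V E]
    by (auto simp: ranked_size_def)
qed

lemma sums_ranked_size:
  fixes f :: "nat \<Rightarrow> real"
  assumes "f 0 = 0"
  shows "(\<lambda>k. f (ranked_size V E k)) sums (\<Sum>C\<in>components V E. f (card C))"
proof -
  let ?xs = "component_sizes V E"
  have "(\<lambda>k. f (ranked_size V E k)) sums (\<Sum>k<length ?xs. f (ranked_size V E k))"
    by (rule sums_finite) (auto simp: ranked_size_def assms)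
  also have "(\<Sum>k<length ?xs. f (ranked_size V E k)) = (\<Sum>k<length ?xs. f (?xs ! k))"
    by (simp add: ranked_size_def)
  also have "\<dots> = sum_list (map f ?xs)" 
    by (simp add: sum_list_sum_nth atLeast0LessThan)
  also have "\<dots> = sum_mset (image_mset f (mset ?xs))" by (metis mset_map sum_mset_sum_list)
  also have "\<dots> = (\<Sum>C\<in>components V E. f (card C))"
    unfolding mset_component_sizes by (simp add: image_mset.compositionality o_def sum_unfold_sum_mset)
  finally show ?thesis .
qed

text \<open>
  Each vertex of \<open>C\<close> is separated from all of \<open>C\<close> except its own part, hence from at least \<open>card C - card B\<close>
  vertices, if \<open>B\<close> is the largest part.
\<close>

lemma refinement_largest_part:
  assumes eq: "equiv V r" "equiv V r'" and sub: "r' \<subseteq> r" and V: "finite V" and C: "C \<in> V // r"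
  shows "\<exists>B\<in>V // r'. B \<subseteq> C \<and> card B \<le> card C \<and> (card C - card B)\<^sup>2 \<le> card (r - r')"
proof -
  have rV: "r \<subseteq> V \<times> V" using eq(1) by (simp add: equiv_type)
  then have finr: "finite r" using V by (meson finite_SigmaI finite_subset)
  have CV: "C \<subseteq> V" using C Union_quotient[OF eq(1)] by blast
  have finC: "finite C" using CV V finite_subset by blast
  have neC: "C \<noteq> {}" using C eq(1) in_quotient_imp_non_empty by blast
  have cls: "r' `` {u} \<subseteq> C" "r' `` {u} \<in> V // r'" if u: "u \<in> C" for u
  proof -
    have "C = r `` {u}" using C u eq(1) by (metis Image_singleton_iff equiv_class_eq_iff quotientE)
    then show "r' `` {u} \<subseteq> C" using sub by blast
    show "r' `` {u} \<in> V // r'" using u CV by (auto intro: quotientI)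
  qed
  obtain w where w: "w \<in> C" "\<And>u. u \<in> C \<Longrightarrow> card (r' `` {u}) \<le> card (r' `` {w})"
  proof -
    have "Max ((\<lambda>u. card (r' `` {u})) ` C) \<in> (\<lambda>u. card (r' `` {u})) ` C"
      using finC neC by (intro Max_in) auto
    then obtain w where "w \<in> C" "Max ((\<lambda>u. card (r' `` {u})) ` C) = card (r' `` {w})" by blast
    moreover have "card (r' `` {u}) \<le> Max ((\<lambda>u. card (r' `` {u})) ` C)" if "u \<in> C" for u
      using finC that by simp
    ultimately show ?thesis using that by metis
  qed
  define B where "B = r' `` {w}"
  have B: "B \<in> V // r'" "B \<subseteq> C" "card B \<le> card C"
    using cls[OF w(1)] finC by (auto simp: B_def intro: card_mono)
  have "(card C - card B)\<^sup>2 \<le> card C * (card C - card B)" by (simp add: power2_eq_square)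
  also have "\<dots> = (\<Sum>u\<in>C. card C - card B)" by simp
  also have "\<dots> \<le> (\<Sum>u\<in>C. card (C - r' `` {u}))"
  proof (rule sum_mono)
    fix u assume u: "u \<in> C"
    have "card (C - r' `` {u}) = card C - card (r' `` {u})"
      using cls[OF u] finC finite_subset by (intro card_Diff_subset) auto
    then show "card C - card B \<le> card (C - r' `` {u})" using w(2)[OF u] by (simp add: B_def)
  qed
  also have "\<dots> = card (SIGMA u:C. C - r' `` {u})" using finC by (simp add: card_SigmaI)
  also have "\<dots> \<le> card (r - r')"
  proof (rule card_mono)
    show "(SIGMA u:C. C - r' `` {u}) \<subseteq> r - r'"
      using quotient_eq_iff[OF eq(1) C C] by auto
  qed (use finr in simp)
  finally show ?thesis using B by blast
qed

text \<open>
  Let \<open>\<Delta>\<close> be the number of separated pairs. Every component keeps a part smaller by at most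
  \<open>sqrt \<Delta>\<close>, and different components keep different parts, so a ranked size cannot decrease by
  more. It cannot increase by more either: two parts of size \<open>b\<close> of the same component are separated by at least
  \<open>b\<^sup>2\<close> pairs, hence parts larger than \<open>sqrt \<Delta>\<close> come from different components.
\<close>

lemma ranked_size_drop:
  assumes V: "finite V" and FE: "F \<subseteq> E"
  shows "(real (ranked_size V E k) - real (ranked_size V F k))\<^sup>2
    \<le> real (card (((adjacency E)\<^sup>* - (adjacency F)\<^sup>*) \<inter> V \<times> V))"
proof -
  define r where "r = (adjacency E)\<^sup>* \<inter> V \<times> V"
  define r' where "r' = (adjacency F)\<^sup>* \<inter> V \<times> V"
  have eq: "equiv V r" "equiv V r'" unfolding r_def r'_def by (rule component_relation_equiv)+
  have sub: "r' \<subseteq> r" using connected_mono[OF FE] by (auto simp: r_def r'_def)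
  have comp: "components V E = V // r" "components V F = V // r'"
    by (simp_all add: components_def r_def r'_def)
  have finr: "finite (r - r')" using V by (auto simp: r_def intro: finite_subset[of _ "V \<times> V"])
  have fin: "finite (V // r)" "finite (V // r')" using components_finite[OF V] comp by metis+
  define \<Delta> where "\<Delta> = card (r - r')"
  have \<Delta>: "card (((adjacency E)\<^sup>* - (adjacency F)\<^sup>*) \<inter> V \<times> V) = \<Delta>"
    unfolding \<Delta>_def r_def r'_def by (rule arg_cong[of _ _ card]) auto
  define a where "a = ranked_size V E k"
  define b where "b = ranked_size V F k"
  have few: "card {C \<in> V // r. a + 1 \<le> card C} \<le> k" "card {C \<in> V // r'. b + 1 \<le> card C} \<le> k"
    using ranked_size_ge_iff[OF V, of "a + 1" E k] ranked_size_ge_iff[OF V, of "b + 1" F k] comp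
    by (auto simp: a_def b_def)
  consider "a = b" | "b < a" | "a < b" by linarith
  then have "(real a - real b)\<^sup>2 \<le> real \<Delta>"
  proof cases
    case 2
    define A where "A = {C \<in> V // r. a \<le> card C}"
    have A: "k < card A" using ranked_size_ge_iff[OF V, of a E k] comp 2 by (auto simp: a_def A_def)
    have finA: "finite A" using fin by (simp add: A_def)
    have "\<forall>C\<in>A. \<exists>B\<in>V // r'. B \<subseteq> C \<and> card B \<le> card C \<and> (card C - card B)\<^sup>2 \<le> \<Delta>"
      using refinement_largest_part[OF eq sub V] by (auto simp: A_def \<Delta>_def)
    then obtain \<beta> where \<beta>: "\<And>C. C \<in> A \<Longrightarrow> \<beta> C \<in> V // r' \<and> \<beta> C \<subseteq> C \<and> card (\<beta> C) \<le> card C \<and>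
        (card C - card (\<beta> C))\<^sup>2 \<le> \<Delta>" by metis
    have inj: "inj_on \<beta> A"
    proof (rule inj_onI)
      fix C D assume CD: "C \<in> A" "D \<in> A" "\<beta> C = \<beta> D"
      have "\<beta> C \<noteq> {}" using \<beta>[OF CD(1)] in_quotient_imp_non_empty[OF eq(2)] by blast
      then have "C \<inter> D \<noteq> {}" using \<beta>[OF CD(1)] \<beta>[OF CD(2)] CD(3) by blast
      then show "C = D" using quotient_disj[OF eq(1)] CD by (auto simp: A_def)
    qed
    \<comment> \<open>There are more than \<open>k\<close> components in \<open>A\<close>, but at most \<open>k\<close> parts of size larger than \<open>b\<close>.\<close>
    have "\<exists>C\<in>A. card (\<beta> C) \<le> b"
    proof (rule ccontr)
      assume "\<not> ?thesis"
      then have "\<beta> ` A \<subseteq> {C \<in> V // r'. b + 1 \<le> card C}" using \<beta> by force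
      then have "card (\<beta> ` A) \<le> card {C \<in> V // r'. b + 1 \<le> card C}"
        by (rule card_mono[rotated]) (use fin in simp)
      then have "card (\<beta> ` A) \<le> k" using few(2) by simp
      then show False using A card_image[OF inj] by simp
    qed
    then obtain C where C: "C \<in> A" "card (\<beta> C) \<le> b" by blast
    have "(a - b)\<^sup>2 \<le> (card C - card (\<beta> C))\<^sup>2"
      using C by (intro power_mono) (auto simp: A_def)
    also have "\<dots> \<le> \<Delta>" using \<beta>[OF C(1)] by simp
    finally have "real ((a - b)\<^sup>2) \<le> real \<Delta>" by (simp only: of_nat_le_iff)
    then show ?thesis using 2 by (simp add: of_nat_diff)
  next
    case 3
    define B where "B = {C \<in> V // r'. b \<le> card C}"
    have B: "k < card B" using ranked_size_ge_iff[OF V, of b F k] comp 3 by (auto simp: b_def B_def)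
    have finB: "finite B" using fin by (simp add: B_def)
    have "\<exists>C\<in>V // r. D \<subseteq> C" if D: "D \<in> V // r'" for D
    proof -
      obtain u where "u \<in> V" "D = r' `` {u}" using D by (rule quotientE)
      moreover have "r `` {u} \<in> V // r" using \<open>u \<in> V\<close> by (rule quotientI)
      ultimately show ?thesis using sub by blast
    qed
    then obtain \<gamma> where \<gamma>: "\<And>D. D \<in> B \<Longrightarrow> \<gamma> D \<in> V // r \<and> D \<subseteq> \<gamma> D" unfolding B_def by (metis mem_Collect_eq)
    \<comment> \<open>There are more than \<open>k\<close> parts in \<open>B\<close>, but at most \<open>k\<close> components of size larger than \<open>a\<close>.\<close>
    have "\<not> inj_on \<gamma> B"
    proof
      assume "inj_on \<gamma> B"
      have "\<gamma> ` B \<subseteq> {C \<in> V // r. a + 1 \<le> card C}"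
      proof safe
        fix D assume D: "D \<in> B"
        have "finite (\<gamma> D)" using \<gamma>[OF D] V Union_quotient[OF eq(1)] by (metis Sup_upper finite_subset)
        then have "card D \<le> card (\<gamma> D)" using \<gamma>[OF D] by (intro card_mono) auto
        then show "a + 1 \<le> card (\<gamma> D)" using D 3 by (simp add: B_def)
        show "\<gamma> D \<in> V // r" using \<gamma>[OF D] by simp
      qed
      then have "card (\<gamma> ` B) \<le> card {C \<in> V // r. a + 1 \<le> card C}"
        by (rule card_mono[rotated]) (use fin in simp)
      then have "card (\<gamma> ` B) \<le> k" using few(1) by simp
      then show False using B card_image[OF \<open>inj_on \<gamma> B\<close>] by simp
    qed
    then obtain D D' where D: "D \<in> B" "D' \<in> B" "D \<noteq> D'" "\<gamma> D = \<gamma> D'" by (auto simp: inj_on_def)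
    have "D \<times> D' \<subseteq> r - r'"
    proof safe
      fix u v assume uv: "u \<in> D" "v \<in> D'"
      show "(u, v) \<in> r"
        using quotient_eq_iff[OF eq(1), of "\<gamma> D" "\<gamma> D" u v] \<gamma>[OF D(1)] \<gamma>[OF D(2)] D(4) uv by auto
      assume "(u, v) \<in> r'"
      then have "D = D'" using quotient_eq_iff[OF eq(2), of D D' u v] uv D by (auto simp: B_def)
      then show False using D by simp
    qed
    then have "card (D \<times> D') \<le> \<Delta>" unfolding \<Delta>_def using finr by (intro card_mono)
    moreover have "b * b \<le> card D * card D'" using D by (intro mult_mono) (auto simp: B_def)
    ultimately have "b\<^sup>2 \<le> \<Delta>" by (simp add: card_cartesian_product power2_eq_square)
    then have "real (b\<^sup>2) \<le> real \<Delta>" by (simp only: of_nat_le_iff)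
    then have "(real b)\<^sup>2 \<le> real \<Delta>" by (simp only: of_nat_power)
    moreover have "(real a - real b)\<^sup>2 \<le> (real b)\<^sup>2" using 3 by (intro power2_le_iff_abs_le[THEN iffD2]) auto
    ultimately show ?thesis by (rule order_trans[rotated])
  qed simp
  then show ?thesis unfolding \<Delta> a_def b_def .
qed

section \<open>Mass partitions and the sum of squares\<close>

text \<open>
  Each of these conditions involves finitely many entries, which makes the set visibly closed for
  the product topology.
\<close>

lemma mass_partitions_iff_partial_sums:
  "x \<in> mass_partitions \<longleftrightarrow> (\<forall>i. x (Suc i) \<le> x i) \<and> (\<forall>i. 0 \<le> x i) \<and> (\<forall>n. (\<Sum>i<n. x i) \<le> 1)"
proof
  assume x: "x \<in> mass_partitions"
  have "(\<Sum>i<n. x i) \<le> 1" for n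
  proof -
    have "(\<Sum>i<n. x i) \<le> (\<Sum>i. x i)"
      using x by (intro sum_le_suminf) (auto simp: mass_partitions_def)
    then show ?thesis using x by (simp add: mass_partitions_def)
  qed
  then show "(\<forall>i. x (Suc i) \<le> x i) \<and> (\<forall>i. 0 \<le> x i) \<and> (\<forall>n. (\<Sum>i<n. x i) \<le> 1)"
    using x by (auto simp: mass_partitions_def decseq_Suc_iff)
next
  assume x: "(\<forall>i. x (Suc i) \<le> x i) \<and> (\<forall>i. 0 \<le> x i) \<and> (\<forall>n. (\<Sum>i<n. x i) \<le> 1)"
  then have "summable x" by (intro summableI_nonneg_bounded[of x 1]) auto
  moreover from this have "(\<Sum>i. x i) \<le> 1" using x by (intro suminf_le_const) auto
  ultimately show "x \<in> mass_partitions" using x by (auto simp: mass_partitions_def decseq_Suc_iff)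
qed

lemma mass_partition_entry_le:
  assumes "x \<in> mass_partitions"
  shows "x i \<le> 1 / real (Suc i)"
proof -
  have "real (Suc i) * x i = (\<Sum>j<Suc i. x i)" by simp
  also have "\<dots> \<le> (\<Sum>j<Suc i. x j)"
    using assms by (intro sum_mono) (auto simp: mass_partitions_def decseq_def)
  also have "\<dots> \<le> 1" using assms by (simp only: mass_partitions_iff_partial_sums)
  finally show ?thesis by (simp add: field_simps)
qed

lemma compact_mass_partitions: "compact mass_partitions"
proof -
  have cont: "continuous_on UNIV (\<lambda>x :: nat \<Rightarrow> real. x i)" for i by simp
  have "mass_partitions = {x. (\<forall>i. x (Suc i) \<le> x i) \<and> (\<forall>i. 0 \<le> x i) \<and> (\<forall>n. (\<Sum>i<n. x i) \<le> (1::real))}"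
    using mass_partitions_iff_partial_sums by blast
  also have "closed \<dots>"
    by (intro closed_Collect_conj closed_Collect_all closed_Collect_le continuous_on_sum cont continuous_on_const)
  finally have closed: "closed mass_partitions" .
  have "compact (PiE UNIV (\<lambda>_. {0..1}) :: (nat \<Rightarrow> real) set)"
    using compactin_PiE[of "\<lambda>_. euclidean" UNIV "\<lambda>_. {0..1::real}"]
    by (simp add: euclidean_product_topology)
  then have "compact (PiE UNIV (\<lambda>_. {0..1}) \<inter> mass_partitions)" using closed by (rule compact_Int_closed)
  moreover have "mass_partitions \<subseteq> PiE UNIV (\<lambda>_. {0..1})"
  proof
    fix x assume x: "x \<in> mass_partitions"
    have "0 \<le> x i \<and> x i \<le> 1" for i
    proof -
      have "x i \<le> 1 / real (Suc i)" by (rule mass_partition_entry_le[OF x])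
      also have "\<dots> \<le> 1" by simp
      finally show ?thesis using x by (simp add: mass_partitions_def)
    qed
    then show "x \<in> PiE UNIV (\<lambda>_. {0..1})" by auto
  qed
  ultimately show ?thesis by (simp add: Int_absorb1)
qed

definition sum_of_squares :: "(nat \<Rightarrow> real) \<Rightarrow> real" where
  "sum_of_squares x = (\<Sum>i. (x i)\<^sup>2)"

text \<open>
  The \<open>i\<close>-th entry is at most \<open>1/(i+1)\<close> and squares of these bounds are summable, so the series
  converges uniformly on mass partitions. (The sum of the entries itself is not continuous there.)
\<close>

lemma continuous_on_sum_of_squares: "continuous_on mass_partitions sum_of_squares"
proof -
  have "uniform_limit mass_partitions (\<lambda>n x. \<Sum>i<n. (x i)\<^sup>2) (\<lambda>x. \<Sum>i. (x i)\<^sup>2) sequentially"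
  proof (rule Weierstrass_m_test)
    fix i and x :: "nat \<Rightarrow> real" assume x: "x \<in> mass_partitions"
    have "\<bar>x i\<bar> \<le> 1 / real (Suc i)" using x mass_partition_entry_le[OF x, of i] by (auto simp: mass_partitions_def)
    then have "(x i)\<^sup>2 \<le> (1 / real (Suc i))\<^sup>2" by (simp add: abs_le_square_iff[symmetric])
    then show "norm ((x i)\<^sup>2) \<le> inverse (real (Suc i) ^ 2)" by (simp add: power_one_over inverse_eq_divide)
  next
    show "summable (\<lambda>i. inverse (real (Suc i) ^ 2))"
      using inverse_power_summable[of 2, where 'a = real] by (subst summable_Suc_iff) simp
  qed
  then have "continuous_on mass_partitions (\<lambda>x. \<Sum>i. (x i)\<^sup>2)"
  proof (rule uniform_limit_theorem[rotated])
    have "continuous_on mass_partitions (\<lambda>x :: nat \<Rightarrow> real. \<Sum>i<n. (x i)\<^sup>2)" for n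
    proof (intro continuous_intros)
      show "continuous_on mass_partitions (\<lambda>x :: nat \<Rightarrow> real. x i)" for i
        by (rule continuous_on_subset[OF continuous_on_product_coordinates]) simp
    qed
    then show "\<forall>\<^sub>F n in sequentially. continuous_on mass_partitions (\<lambda>x :: nat \<Rightarrow> real. \<Sum>i<n. (x i)\<^sup>2)"
      by simp
  qed simp
  then show ?thesis by (simp add: sum_of_squares_def[abs_def])
qed

text \<open>
  The factor \<open>2\<close> is the total weight of the coordinates in the metric of sequences.
\<close>

lemma dist_sequence_le:
  fixes x y :: "nat \<Rightarrow> real"
  assumes "\<And>k. \<bar>x k - y k\<bar> \<le> \<delta>"
  shows "dist x y \<le> 2 * \<delta>"
proof -
  have geo: "(\<lambda>n. (1/2)^n * \<delta>) sums (2 * \<delta>)"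
    using sums_mult2[OF geometric_sums[of "1/2 :: real"], of \<delta>] by simp
  have le: "(1/2)^n * min (dist (x (from_nat n)) (y (from_nat n))) 1 \<le> (1/2)^n * \<delta>" for n
    using assms by (intro mult_left_mono min.coboundedI1) (auto simp: dist_real_def)
  have "summable (\<lambda>n. (1/2)^n * min (dist (x (from_nat n)) (y (from_nat n))) 1)"
    by (rule summable_comparison_test'[OF sums_summable[OF geo], of 0]) (use le in auto)
  from suminf_le[OF le this sums_summable[OF geo]] show ?thesis
    unfolding dist_fun_def using sums_unique[OF geo] by simp
qed

section \<open>Fragmentation paths\<close>

definition relative_sizes :: "'v set \<Rightarrow> 'v set set \<Rightarrow> nat \<Rightarrow> real" where
  "relative_sizes V E i = real (ranked_size V E i) / real (card V)"

lemma fragmentation_relative_sizes: "fragmentation V E d t = relative_sizes V (surviving_edges E d t)"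
  by (rule ext) (simp add: relative_sizes_def fragmentation_ranked_size)

lemma relative_sizes_mass_partition:
  assumes V: "finite V"
  shows "relative_sizes V E \<in> mass_partitions"
proof -
  have "(\<lambda>k. real (ranked_size V E k) / real (card V)) sums (\<Sum>C\<in>components V E. real (card C) / real (card V))"
    by (rule sums_ranked_size[of "\<lambda>a. real a / real (card V)"]) simp
  also have "(\<Sum>C\<in>components V E. real (card C) / real (card V)) = real (\<Sum>C\<in>components V E. card C) / real (card V)"
    by (simp add: sum_divide_distrib)
  also have "(\<Sum>C\<in>components V E. card C) = card V"
    unfolding components_def using card_eq_sum_classes[OF component_relation_equiv V] by simp
  finally have "relative_sizes V E sums (real (card V) / real (card V))"
    by (simp add: relative_sizes_def[abs_def])
  then have "summable (relative_sizes V E)" "(\<Sum>i. relative_sizes V E i) \<le> 1"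
    by (auto simp: sums_iff)
  moreover have "decseq (relative_sizes V E)"
    using ranked_size_decseq[of V E] by (auto simp: decseq_def relative_sizes_def divide_right_mono)
  moreover have "0 \<le> relative_sizes V E i" for i by (simp add: relative_sizes_def)
  ultimately show ?thesis by (simp add: mass_partitions_def)
qed

lemma sum_of_squares_relative_sizes:
  assumes V: "finite V"
  shows "sum_of_squares (relative_sizes V E) = real (card ((adjacency E)\<^sup>* \<inter> V \<times> V)) / (real (card V))\<^sup>2"
proof -
  have "(\<lambda>k. (real (ranked_size V E k) / real (card V))\<^sup>2) sums (\<Sum>C\<in>components V E. (real (card C) / real (card V))\<^sup>2)"
    by (rule sums_ranked_size[of "\<lambda>a. (real a / real (card V))\<^sup>2"]) simp
  then have "sum_of_squares (relative_sizes V E) = (\<Sum>C\<in>components V E. (real (card C) / real (card V))\<^sup>2)"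
    by (simp add: sum_of_squares_def relative_sizes_def sums_iff)
  also have "\<dots> = real (\<Sum>C\<in>components V E. (card C)\<^sup>2) / (real (card V))\<^sup>2"
    by (simp add: sum_divide_distrib power_divide)
  also have "(\<Sum>C\<in>components V E. (card C)\<^sup>2) = card ((adjacency E)\<^sup>* \<inter> V \<times> V)"
    unfolding components_def using card_equiv_eq_sum_squares[OF component_relation_equiv V] by simp
  finally show ?thesis .
qed

text \<open>
  The number of separated pairs divided by \<open>(card V)\<^sup>2\<close> is exactly the loss of the sum of squares.
\<close>

lemma relative_sizes_control:
  assumes V: "finite V" and FE: "F \<subseteq> E"
  shows "(dist (relative_sizes V E) (relative_sizes V F))\<^sup>2
    \<le> 4 * (sum_of_squares (relative_sizes V E) - sum_of_squares (relative_sizes V F))"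
proof -
  let ?E = "(adjacency E)\<^sup>* \<inter> V \<times> V" and ?F = "(adjacency F)\<^sup>* \<inter> V \<times> V"
  define D where "D = sum_of_squares (relative_sizes V E) - sum_of_squares (relative_sizes V F)"
  have sub: "?F \<subseteq> ?E" using connected_mono[OF FE] by auto
  have fin: "finite ?E" using V by simp
  have "((adjacency E)\<^sup>* - (adjacency F)\<^sup>*) \<inter> V \<times> V = ?E - ?F" by blast
  then have "real (card (((adjacency E)\<^sup>* - (adjacency F)\<^sup>*) \<inter> V \<times> V)) = real (card ?E) - real (card ?F)"
    using card_Diff_subset[OF finite_subset[OF sub fin] sub] card_mono[OF fin sub] by (simp add: of_nat_diff)
  then have D: "D = real (card (((adjacency E)\<^sup>* - (adjacency F)\<^sup>*) \<inter> V \<times> V)) / (real (card V))\<^sup>2"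
    unfolding D_def sum_of_squares_relative_sizes[OF V] by (simp add: diff_divide_distrib)
  have D0: "0 \<le> D" unfolding D by simp
  have "\<bar>relative_sizes V E k - relative_sizes V F k\<bar> \<le> sqrt D" for k
  proof (rule real_le_rsqrt)
    have "\<bar>relative_sizes V E k - relative_sizes V F k\<bar>\<^sup>2
        = (real (ranked_size V E k) - real (ranked_size V F k))\<^sup>2 / (real (card V))\<^sup>2"
      by (simp add: relative_sizes_def diff_divide_distrib[symmetric] power_divide)
    also have "\<dots> \<le> D" unfolding D by (intro divide_right_mono ranked_size_drop V FE) simp
    finally show "\<bar>relative_sizes V E k - relative_sizes V F k\<bar>\<^sup>2 \<le> D" .
  qed
  from dist_sequence_le[OF this]
  have "(dist (relative_sizes V E) (relative_sizes V F))\<^sup>2 \<le> (2 * sqrt D)\<^sup>2"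
    by (intro power_mono) auto
  also have "\<dots> = 4 * D" using D0 by (simp add: power_mult_distrib)
  finally show ?thesis by (simp add: D_def)
qed

lemma surviving_edges_eventually_right:
  assumes "finite E"
  shows "\<forall>\<^sub>F s in at_right t. surviving_edges E d s = surviving_edges E d t"
proof -
  have "\<forall>\<^sub>F s in at_right t. d e \<le> s \<longleftrightarrow> d e \<le> t" for e
  proof (cases "d e \<le> t")
    case True
    then show ?thesis unfolding eventually_at_right_field by (intro exI[of _ "t + 1"]) auto
  next
    case False
    then show ?thesis unfolding eventually_at_right_field by (intro exI[of _ "d e"]) auto
  qed
  then have "\<forall>\<^sub>F s in at_right t. \<forall>e\<in>E. d e \<le> s \<longleftrightarrow> d e \<le> t"
    using assms by (intro eventually_ball_finite) auto
  then show ?thesis by eventually_elim (auto simp: surviving_edges_def)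
qed

lemma surviving_edges_eventually_left:
  assumes "finite E"
  shows "\<forall>\<^sub>F s in at_left t. surviving_edges E d s = {e \<in> E. t \<le> d e}"
proof -
  have "\<forall>\<^sub>F s in at_left t. d e \<le> s \<longleftrightarrow> d e < t" for e
  proof (cases "d e < t")
    case True
    then show ?thesis unfolding eventually_at_left_field by (intro exI[of _ "d e"]) auto
  next
    case False
    then show ?thesis unfolding eventually_at_left_field by (intro exI[of _ "t - 1"]) auto
  qed
  then have "\<forall>\<^sub>F s in at_left t. \<forall>e\<in>E. d e \<le> s \<longleftrightarrow> d e < t"
    using assms by (intro eventually_ball_finite) auto
  then show ?thesis
  proof eventually_elim
    case (elim s)
    have "\<not> d e \<le> s \<longleftrightarrow> t \<le> d e" if "e \<in> E" for e
      using bspec[OF elim that] by linarith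
    then show ?case unfolding surviving_edges_def by (intro Collect_cong) blast
  qed
qed

lemma fragmentation_cadlag:
  assumes V: "finite V" and E: "finite E"
  shows "(\<lambda>t\<in>{0..}. fragmentation V E d t) \<in> cadlag mass_partitions"
proof -
  let ?x = "\<lambda>t\<in>{0..}. fragmentation V E d t"
  have "(?x \<longlongrightarrow> ?x t) (at_right t)" if "0 \<le> t" for t
  proof (rule tendsto_eventually)
    have "\<forall>\<^sub>F s in at_right t. t < s" by (rule eventually_at_right_less)
    with surviving_edges_eventually_right[OF E, of d t]
    show "\<forall>\<^sub>F s in at_right t. ?x s = ?x t"
      by eventually_elim (use that in \<open>simp add: fragmentation_relative_sizes\<close>)
  qed
  moreover have "\<exists>l\<in>mass_partitions. (?x \<longlongrightarrow> l) (at_left t)" if "0 < t" for t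
  proof (intro bexI tendsto_eventually)
    have "\<forall>\<^sub>F s in at_left t. 0 < s" using that by (auto simp: eventually_at_left_field)
    with surviving_edges_eventually_left[OF E, of d t]
    show "\<forall>\<^sub>F s in at_left t. ?x s = relative_sizes V {e \<in> E. t \<le> d e}"
      by eventually_elim (simp add: fragmentation_relative_sizes)
  qed (rule relative_sizes_mass_partition[OF V])
  moreover have "?x \<in> {0..} \<rightarrow>\<^sub>E mass_partitions"
    using relative_sizes_mass_partition[OF V] by (simp add: fragmentation_relative_sizes)
  ultimately show ?thesis unfolding cadlag_def by blast
qed

text \<open>
  Two vertices stay connected exactly as long as their tree path is intact, so the sum of squares is an
  average over pairs of products of survival indicators of edges. All expectations rest on this expression.
\<close>

lemma sum_of_squares_tree_fragmentation:
  assumes tree: "is_tree V E"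
  shows "sum_of_squares (fragmentation V E d t)
    = (\<Sum>p\<in>V \<times> V. \<Prod>e\<in>tree_path E (fst p) (snd p). indicator {t<..} (d e)) / (real (card V))\<^sup>2"
proof -
  have V: "finite V" using tree by (simp add: is_tree_def)
  have E: "finite E" by (rule is_tree_finite[OF tree])
  have "real (card ((adjacency (surviving_edges E d t))\<^sup>* \<inter> V \<times> V))
      = (\<Sum>p\<in>V \<times> V. indicator ((adjacency (surviving_edges E d t))\<^sup>*) p)"
    using V by (simp add: indicator_def of_bool_def sum.If_cases Int_commute)
  also have "\<dots> = (\<Sum>p\<in>V \<times> V. \<Prod>e\<in>tree_path E (fst p) (snd p). indicator {t<..} (d e))"
  proof (intro sum.cong refl)
    fix p assume "p \<in> V \<times> V"
    then obtain u v where p: "p = (u, v)" "u \<in> V" "v \<in> V" by blast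
    have fin: "finite (tree_path E u v)" by (rule finite_subset[OF tree_path(1)[OF tree p(2,3)] E])
    have "p \<in> (adjacency (surviving_edges E d t))\<^sup>* \<longleftrightarrow> (\<forall>e\<in>tree_path E u v. t < d e)"
      using tree_path[OF tree p(2,3)] p(1) by (auto simp: surviving_edges_def not_le)
    moreover have "(\<Prod>e\<in>tree_path E u v. indicator {t<..} (d e)) = (if \<forall>e\<in>tree_path E u v. t < d e then 1 else 0 :: real)"
      using fin by (auto simp: indicator_def)
    ultimately show "indicator ((adjacency (surviving_edges E d t))\<^sup>*) p =
      (\<Prod>e\<in>tree_path E (fst p) (snd p). indicator {t<..} (d e) :: real)"
      using p by (simp add: indicator_def)
  qed
  finally show ?thesis
    unfolding fragmentation_relative_sizes sum_of_squares_relative_sizes[OF V] by simp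
qed

section \<open>Exponential deletion times\<close>

locale exponential_fragmentation = prob_space M for M :: "'w measure" +
  fixes V :: "'v set" and T :: "'w \<Rightarrow> 'v set set" and r :: real and \<tau> :: "'v set \<Rightarrow> 'w \<Rightarrow> real"
  assumes V: "finite V" "V \<noteq> {}" and T: "random_tree M V T" and r: "r > 0"
    and \<tau>: "iid_exponential_given_tree M V T r \<tau>"
begin

definition spanning_trees :: "'v set set set" where
  "spanning_trees = {E. is_tree V E}"

lemma finite_spanning_trees: "finite spanning_trees"
proof (rule finite_subset)
  show "spanning_trees \<subseteq> Pow (all_edges V)" by (auto simp: spanning_trees_def is_tree_def)
  show "finite (Pow (all_edges V))" using finite_all_edges[OF V(1)] by simp
qed

lemma tree_finite: "E \<in> spanning_trees \<Longrightarrow> finite E"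
  unfolding spanning_trees_def by (simp add: is_tree_finite)

lemma T_tree: "\<omega> \<in> space M \<Longrightarrow> T \<omega> \<in> spanning_trees"
  using T measurable_space[of T M "count_space spanning_trees" \<omega>] by (simp add: random_tree_def spanning_trees_def)

lemma tree_event [measurable]: "E \<in> spanning_trees \<Longrightarrow> {\<omega> \<in> space M. T \<omega> = E} \<in> events"
  using T measurable_sets[of T M "count_space spanning_trees" "{E}"]
  by (simp add: random_tree_def spanning_trees_def vimage_def Int_def conj_commute)

lemma \<tau>_measurable [measurable]: "E \<in> spanning_trees \<Longrightarrow> e \<in> E \<Longrightarrow> \<tau> e \<in> borel_measurable M"
  using \<tau> by (auto simp: iid_exponential_given_tree_def spanning_trees_def is_tree_def)

lemma survival_event:
  assumes E: "E \<in> spanning_trees" and D: "D \<subseteq> E"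
  shows "{\<omega> \<in> space M. T \<omega> = E \<and> (\<forall>e\<in>D. c e < \<tau> e \<omega>)} \<in> events"
proof -
  have "finite D" using D tree_finite[OF E] finite_subset by blast
  moreover have "{\<omega> \<in> space M. c e < \<tau> e \<omega>} \<in> events" if "e \<in> D" for e
    using \<tau>_measurable[OF E, of e] D that by (intro borel_measurable_less) auto
  ultimately have "{\<omega> \<in> space M. \<forall>e\<in>D. c e < \<tau> e \<omega>} \<in> events" by (rule sets.sets_Collect_finite_All[rotated])
  from sets.Int[OF tree_event[OF E] this] show ?thesis
    by (rule back_subst[of "\<lambda>A. A \<in> events"]) auto
qed

text \<open>
  All later expectations come from this formula. Writing it for the original
  measure instead of the conditional one lets trees of probability \<open>0\<close> be treated together with the others.
\<close>

lemma survival_prob: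
  assumes E: "E \<in> spanning_trees" and D: "D \<subseteq> E" and c: "\<And>e. e \<in> D \<Longrightarrow> 0 \<le> c e"
  shows "prob {\<omega> \<in> space M. T \<omega> = E \<and> (\<forall>e\<in>D. c e < \<tau> e \<omega>)}
    = prob {\<omega> \<in> space M. T \<omega> = E} * exp (- r * (\<Sum>e\<in>D. c e))"
proof -
  define A where "A = {\<omega> \<in> space M. T \<omega> = E}"
  define B where "B = {\<omega> \<in> space M. T \<omega> = E \<and> (\<forall>e\<in>D. c e < \<tau> e \<omega>)}"
  have A: "A \<in> events" unfolding A_def by (rule tree_event[OF E])
  have B: "B \<in> events" unfolding B_def by (rule survival_event[OF E D])
  have finD: "finite D" using D tree_finite[OF E] finite_subset by blast
  have "prob B = prob A * exp (- r * (\<Sum>e\<in>D. c e))"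
  proof (cases "prob A > 0")
    case False
    have "prob B \<le> prob A" using A by (intro finite_measure_mono) (auto simp: A_def B_def)
    moreover have "prob A = 0" using False measure_nonneg[of M A] by simp
    ultimately have "prob B = 0" using measure_nonneg[of M B] by simp
    then show ?thesis using \<open>prob A = 0\<close> by simp
  next
    case True
    define N where "N = uniform_measure M A"
    have emA: "emeasure M A \<noteq> 0" using True by (simp add: emeasure_eq_measure)
    interpret N: prob_space N
      unfolding N_def using emA by (intro prob_space_uniform_measure) auto
    have spN: "space N = space M" "sets N = sets M" by (simp_all add: N_def)
    have ind: "N.indep_vars (\<lambda>_. borel) \<tau> E"
      and dist: "\<And>e. e \<in> E \<Longrightarrow> distributed N lborel (\<tau> e) (exponential_density r)"
      using \<tau> True unfolding iid_exponential_given_tree_def N_def A_def Let_def by blast+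
    have N: "N.prob C = prob (A \<inter> C) / prob A" if "C \<in> events" for C
      unfolding N_def using emA that by (intro measure_uniform_measure) auto
    have one: "N.prob (\<tau> e -` {c e<..} \<inter> space N) = exp (- r * c e)" if "e \<in> D" for e
    proof -
      have "N.prob {\<omega> \<in> space N. c e < \<tau> e \<omega>} = exp (- c e * r)"
        using N.exponential_distributedD_gt[OF dist, of e "c e"] c[OF that] that D r by auto
      moreover have "\<tau> e -` {c e<..} \<inter> space N = {\<omega> \<in> space N. c e < \<tau> e \<omega>}" by auto
      ultimately show ?thesis by (simp add: mult.commute)
    qed
    have "N.prob {\<omega> \<in> space N. \<forall>e\<in>D. c e < \<tau> e \<omega>} = exp (- r * (\<Sum>e\<in>D. c e))"
    proof (cases "D = {}")
      case True
      then show ?thesis by (simp add: N.prob_space)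
    next
      case False
      have "N.prob (\<Inter>e\<in>D. \<tau> e -` {c e<..} \<inter> space N) = (\<Prod>e\<in>D. N.prob (\<tau> e -` {c e<..} \<inter> space N))"
        by (rule N.indep_varsD[OF ind False finD D]) simp
      also have "\<dots> = exp (- r * (\<Sum>e\<in>D. c e))"
        using one finD by (simp add: exp_sum sum_distrib_left flip: sum_negf)
      also have "(\<Inter>e\<in>D. \<tau> e -` {c e<..} \<inter> space N) = {\<omega> \<in> space N. \<forall>e\<in>D. c e < \<tau> e \<omega>}"
        using False by auto
      finally show ?thesis .
    qed
    moreover have "N.prob {\<omega> \<in> space N. \<forall>e\<in>D. c e < \<tau> e \<omega>} = N.prob B"
    proof -
      have "{\<omega> \<in> space M. \<forall>e\<in>D. c e < \<tau> e \<omega>} \<in> events"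
        using finD \<tau>_measurable[OF E] D by (intro sets.sets_Collect_finite_All borel_measurable_less) auto
      from N[OF this] N[OF B] have "N.prob {\<omega> \<in> space M. \<forall>e\<in>D. c e < \<tau> e \<omega>} = N.prob B"
        by (simp add: A_def B_def Int_def conj_ac cong: conj_cong)
      then show ?thesis by (simp add: spN)
    qed
    moreover have "A \<inter> B = B" by (auto simp: A_def B_def)
    ultimately have "prob B / prob A = exp (- r * (\<Sum>e\<in>D. c e))" using N[OF B] by simp
    then show ?thesis using True by (simp add: field_simps)
  qed
  then show ?thesis by (simp add: A_def B_def)
qed

text \<open>
  The indicator that the tree is \<open>E\<close> and all edges in \<open>P\<close> survive time \<open>t\<close>. Including the event that
  the tree is \<open>E\<close> means that conditioning on the tree amounts to summing over \<open>E\<close>.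
\<close>

definition surv :: "'v set set \<Rightarrow> 'v set set \<Rightarrow> real \<Rightarrow> 'w \<Rightarrow> real" where
  "surv E P t \<omega> = indicator {\<omega>. T \<omega> = E} \<omega> * (\<Prod>e\<in>P. indicator {t<..} (\<tau> e \<omega>))"

lemma surv_eq:
  assumes "finite P"
  shows "surv E P t \<omega> = (if T \<omega> = E \<and> (\<forall>e\<in>P. t < \<tau> e \<omega>) then 1 else 0)"
proof -
  have "(\<Prod>e\<in>P. indicator {t<..} (\<tau> e \<omega>)) = (if \<forall>e\<in>P. t < \<tau> e \<omega> then 1 else 0 :: real)"
    using assms by (auto simp: indicator_def)
  then show ?thesis by (simp add: surv_def indicator_def)
qed

lemma surv_mult:
  assumes fin: "finite P" "finite P'" and st: "s \<le> t"
  shows "surv E P s \<omega> * surv E P' t \<omega> =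
    indicator {\<omega>. T \<omega> = E \<and> (\<forall>e\<in>P \<union> P'. (if e \<in> P' then t else s) < \<tau> e \<omega>)} \<omega>"
proof -
  have "(if e \<in> P' then t else s) < \<tau> e \<omega> \<longleftrightarrow> s < \<tau> e \<omega> \<and> (e \<in> P' \<longrightarrow> t < \<tau> e \<omega>)" for e
    using le_less_trans[OF st, of "\<tau> e \<omega>"] by auto
  then have "(\<forall>e\<in>P \<union> P'. (if e \<in> P' then t else s) < \<tau> e \<omega>) \<longleftrightarrow>
      (\<forall>e\<in>P \<union> P'. s < \<tau> e \<omega> \<and> (e \<in> P' \<longrightarrow> t < \<tau> e \<omega>))" by presburger
  also have "\<dots> \<longleftrightarrow> (\<forall>e\<in>P. s < \<tau> e \<omega>) \<and> (\<forall>e\<in>P'. t < \<tau> e \<omega>)"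
    using le_less_trans[OF st] by blast
  finally show ?thesis by (simp add: surv_eq[OF fin(1)] surv_eq[OF fin(2)] indicator_def)
qed

lemma surv_square: "finite P \<Longrightarrow> surv E P t \<omega> * surv E P t \<omega> = surv E P t \<omega>"
  by (simp add: surv_eq)

lemma surv_bounds: "finite P \<Longrightarrow> 0 \<le> surv E P t \<omega>" "finite P \<Longrightarrow> surv E P t \<omega> \<le> 1"
  by (simp_all add: surv_eq)

lemma surv_antimono:
  assumes "finite P" "s \<le> t"
  shows "surv E P t \<omega> \<le> surv E P s \<omega>"
  using le_less_trans[OF assms(2)] by (simp add: surv_eq[OF assms(1)])

definition tree_prob :: "'v set set \<Rightarrow> real" where
  "tree_prob E = prob {\<omega> \<in> space M. T \<omega> = E}"

lemma has_expectation_surv_mult: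
  assumes E: "E \<in> spanning_trees" and P: "P \<subseteq> E" "P' \<subseteq> E" and st: "0 \<le> s" "s \<le> t"
  shows "integrable M (\<lambda>\<omega>. surv E P s \<omega> * surv E P' t \<omega>)" (is ?I)
    and "expectation (\<lambda>\<omega>. surv E P s \<omega> * surv E P' t \<omega>)
      = tree_prob E * exp (- r * (s * card (P - P') + t * card P'))" (is ?E)
proof -
  let ?c = "\<lambda>e. if e \<in> P' then t else s"
  let ?B = "{\<omega> \<in> space M. T \<omega> = E \<and> (\<forall>e\<in>P \<union> P'. ?c e < \<tau> e \<omega>)}"
  have fin: "finite P" "finite P'" using P tree_finite[OF E] finite_subset by blast+
  have PP: "P \<union> P' \<subseteq> E" using P by blast
  have B: "?B \<in> events" by (rule survival_event[OF E PP])
  have eq: "surv E P s \<omega> * surv E P' t \<omega> = indicator ?B \<omega>" if "\<omega> \<in> space M" for \<omega>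
    unfolding surv_mult[OF fin st(2)] using that by (simp add: indicator_def)
  have "integrable M (indicator ?B :: _ \<Rightarrow> real)"
    using B by (simp add: integrable_indicator_iff emeasure_eq_measure)
  then show ?I by (subst Bochner_Integration.integrable_cong[OF refl eq])
  have "(\<Sum>e\<in>P \<union> P'. ?c e) = (\<Sum>e\<in>P - P'. ?c e) + (\<Sum>e\<in>P'. ?c e)"
    using fin by (subst sum.union_disjoint[symmetric]) (auto intro!: sum.cong)
  also have "\<dots> = s * card (P - P') + t * card P'" by simp
  finally have sum: "(\<Sum>e\<in>P \<union> P'. ?c e) = s * card (P - P') + t * card P'" .
  have "expectation (\<lambda>\<omega>. surv E P s \<omega> * surv E P' t \<omega>) = expectation (indicator ?B)"
    by (rule Bochner_Integration.integral_cong[OF refl eq])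
  also have "\<dots> = prob ?B" using B by simp
  also have "\<dots> = tree_prob E * exp (- r * (\<Sum>e\<in>P \<union> P'. ?c e))"
    unfolding tree_prob_def by (rule survival_prob[OF E PP]) (use st in auto)
  finally show ?E by (simp add: sum)
qed

lemma has_expectation_surv:
  assumes E: "E \<in> spanning_trees" and P: "P \<subseteq> E" and t: "0 \<le> t"
  shows "integrable M (surv E P t)"
    and "expectation (surv E P t) = tree_prob E * exp (- r * (t * card P))"
proof -
  have fin: "finite P" using P tree_finite[OF E] finite_subset by blast
  show "integrable M (surv E P t)"
    using has_expectation_surv_mult(1)[OF E P P t order_refl] by (simp add: surv_square[OF fin])
  show "expectation (surv E P t) = tree_prob E * exp (- r * (t * card P))"
    using has_expectation_surv_mult(2)[OF E P P t order_refl] by (simp add: surv_square[OF fin])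
qed

text \<open>
  Memorylessness: for \<open>u \<le> t\<close>, requiring \<open>P'\<close> to survive \<open>t + h\<close> instead of \<open>t\<close> multiplies the probability that \<open>P\<close> survives
  \<open>u\<close> and \<open>P'\<close> survives \<open>t\<close> by \<open>exp (- r * h * card P')\<close>, independently of \<open>u\<close> and \<open>P\<close>. Used for \<open>u = s\<close> and \<open>u = t\<close>,
  this extracts the last factor; the remaining survival indicator is bounded by \<open>1\<close>.
\<close>

lemma expectation_surv_increments:
  assumes E: "E \<in> spanning_trees" and P: "P \<subseteq> E" "P' \<subseteq> E" and st: "0 \<le> s" "s \<le> t" and h: "0 \<le> h"
  shows "integrable M (\<lambda>\<omega>. (surv E P s \<omega> - surv E P t \<omega>) * (surv E P' t \<omega> - surv E P' (t + h) \<omega>))" (is ?I)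
    and "expectation (\<lambda>\<omega>. (surv E P s \<omega> - surv E P t \<omega>) * (surv E P' t \<omega> - surv E P' (t + h) \<omega>))
      \<le> expectation (\<lambda>\<omega>. surv E P s \<omega> - surv E P t \<omega>) * (1 - exp (- r * (h * card P')))" (is ?E)
proof -
  have fin: "finite P" "finite P'" using P tree_finite[OF E] finite_subset by blast+
  have t: "0 \<le> t" "0 \<le> t + h" "t \<le> t + h" "s \<le> t + h" using st h by auto
  note i1 = has_expectation_surv_mult[OF E P st]
  note i2 = has_expectation_surv_mult[OF E P st(1) t(4)]
  note i3 = has_expectation_surv_mult[OF E P t(1) order_refl]
  note i4 = has_expectation_surv_mult[OF E P t(1) t(3)]
  have eq: "(surv E P s \<omega> - surv E P t \<omega>) * (surv E P' t \<omega> - surv E P' (t + h) \<omega>)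
    = surv E P s \<omega> * surv E P' t \<omega> - surv E P s \<omega> * surv E P' (t + h) \<omega>
      - (surv E P t \<omega> * surv E P' t \<omega> - surv E P t \<omega> * surv E P' (t + h) \<omega>)" for \<omega>
    by (simp add: algebra_simps)
  show ?I unfolding eq using i1(1) i2(1) i3(1) i4(1) by simp
  define x where "x = exp (- r * (h * card P'))"
  have shift: "exp (- r * (a + (t + h) * card P')) = exp (- r * (a + t * card P')) * x" for a
    by (simp add: x_def exp_add[symmetric] algebra_simps)
  have x: "x \<le> 1" using r h by (simp add: x_def)
  have e2: "expectation (\<lambda>\<omega>. surv E P s \<omega> * surv E P' (t + h) \<omega>) = expectation (\<lambda>\<omega>. surv E P s \<omega> * surv E P' t \<omega>) * x"
    by (simp only: i1(2) i2(2) shift mult.assoc)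
  have e4: "expectation (\<lambda>\<omega>. surv E P t \<omega> * surv E P' (t + h) \<omega>) = expectation (\<lambda>\<omega>. surv E P t \<omega> * surv E P' t \<omega>) * x"
    by (simp only: i3(2) i4(2) shift mult.assoc)
  have "expectation (\<lambda>\<omega>. (surv E P s \<omega> - surv E P t \<omega>) * (surv E P' t \<omega> - surv E P' (t + h) \<omega>))
     = (expectation (\<lambda>\<omega>. surv E P s \<omega> * surv E P' t \<omega>) - expectation (\<lambda>\<omega>. surv E P t \<omega> * surv E P' t \<omega>)) * (1 - x)"
    unfolding eq using i1(1) i2(1) i3(1) i4(1) by (simp add: e2 e4) (simp add: algebra_simps)
  also have "expectation (\<lambda>\<omega>. surv E P s \<omega> * surv E P' t \<omega>) - expectation (\<lambda>\<omega>. surv E P t \<omega> * surv E P' t \<omega>)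
      = expectation (\<lambda>\<omega>. (surv E P s \<omega> - surv E P t \<omega>) * surv E P' t \<omega>)"
    using i1(1) i3(1) by (simp add: left_diff_distrib)
  also have "\<dots> * (1 - x) \<le> expectation (\<lambda>\<omega>. surv E P s \<omega> - surv E P t \<omega>) * (1 - x)"
  proof (intro mult_right_mono integral_mono)
    show "integrable M (\<lambda>\<omega>. (surv E P s \<omega> - surv E P t \<omega>) * surv E P' t \<omega>)"
      using i1(1) i3(1) by (simp add: left_diff_distrib)
    show "integrable M (\<lambda>\<omega>. surv E P s \<omega> - surv E P t \<omega>)"
      using has_expectation_surv(1)[OF E P(1)] st t by auto
    show "(surv E P s \<omega> - surv E P t \<omega>) * surv E P' t \<omega> \<le> surv E P s \<omega> - surv E P t \<omega>" for \<omega>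
      using surv_antimono[OF fin(1) st(2), of E \<omega>] surv_bounds[OF fin(2), of E t \<omega>]
      by (intro mult_left_le) auto
  qed (use x in auto)
  finally show ?E by (simp add: x_def)
qed

definition Q :: "real \<Rightarrow> 'w \<Rightarrow> real" where
  "Q t \<omega> = sum_of_squares (fragmentation V (T \<omega>) (\<lambda>e. \<tau> e \<omega>) t)"

text \<open>
  The contribution of the tree \<open>E\<close> to \<open>Q\<close>, namely \<open>Q\<close> times the indicator that the tree is \<open>E\<close>
  (\<open>tree_Q_eq\<close>).
\<close>

definition tree_Q :: "'v set set \<Rightarrow> real \<Rightarrow> 'w \<Rightarrow> real" where
  "tree_Q E t \<omega> = (\<Sum>p\<in>V \<times> V. surv E (tree_path E (fst p) (snd p)) t \<omega>) / (real (card V))\<^sup>2"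

text \<open>
  The conditional expectation of \<open>1 - Q t\<close> given that the tree is \<open>E\<close>.
\<close>

definition tree_loss :: "'v set set \<Rightarrow> real \<Rightarrow> real" where
  "tree_loss E t = (\<Sum>p\<in>V \<times> V. 1 - exp (- r * (t * card (tree_path E (fst p) (snd p))))) / (real (card V))\<^sup>2"

lemma card_V: "real (card V) > 0" "(\<Sum>p\<in>V \<times> V. c) / (real (card V))\<^sup>2 = (c :: real)"
  using V by (auto simp: card_gt_0_iff card_cartesian_product power2_eq_square)

lemma tree_Q_eq:
  assumes "E \<in> spanning_trees"
  shows "tree_Q E t \<omega> = (if T \<omega> = E then Q t \<omega> else 0)"
  using sum_of_squares_tree_fragmentation[of V E "\<lambda>e. \<tau> e \<omega>" t] assms
  by (simp add: tree_Q_def Q_def surv_def spanning_trees_def)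

lemma tree_path_subset: "E \<in> spanning_trees \<Longrightarrow> p \<in> V \<times> V \<Longrightarrow> tree_path E (fst p) (snd p) \<subseteq> E"
  using tree_path(1)[of V E "fst p" "snd p"] by (auto simp: spanning_trees_def)

lemma has_expectation_tree_Q:
  assumes E: "E \<in> spanning_trees" and t: "0 \<le> t"
  shows "integrable M (tree_Q E t)" and "expectation (tree_Q E t) = tree_prob E * (1 - tree_loss E t)"
proof -
  note P = tree_path_subset[OF E]
  show "integrable M (tree_Q E t)"
    unfolding tree_Q_def using has_expectation_surv(1)[OF E P t]
    by (intro integrable_divide Bochner_Integration.integrable_sum) auto
  have "expectation (tree_Q E t)
     = (\<Sum>p\<in>V \<times> V. expectation (surv E (tree_path E (fst p) (snd p)) t)) / (real (card V))\<^sup>2"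
    unfolding tree_Q_def using has_expectation_surv(1)[OF E P t] by simp
  also have "\<dots> = (\<Sum>p\<in>V \<times> V. tree_prob E * exp (- r * (t * card (tree_path E (fst p) (snd p))))) / (real (card V))\<^sup>2"
    using has_expectation_surv(2)[OF E P t] by simp
  also have "\<dots> = tree_prob E * ((\<Sum>p\<in>V \<times> V. exp (- r * (t * card (tree_path E (fst p) (snd p))))) / (real (card V))\<^sup>2)"
    by (simp only: sum_distrib_left[symmetric] times_divide_eq_right)
  also have "(\<Sum>p\<in>V \<times> V. exp (- r * (t * card (tree_path E (fst p) (snd p))))) / (real (card V))\<^sup>2 = 1 - tree_loss E t"
    using card_V(2)[of 1] by (simp add: tree_loss_def sum_subtractf diff_divide_distrib)
  finally show "expectation (tree_Q E t) = tree_prob E * (1 - tree_loss E t)" .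
qed

lemma expectation_tree_Q_increments:
  assumes E: "E \<in> spanning_trees" and st: "0 \<le> s" "s \<le> t" and h: "0 \<le> h"
  shows "integrable M (\<lambda>\<omega>. (tree_Q E s \<omega> - tree_Q E t \<omega>) * (tree_Q E t \<omega> - tree_Q E (t + h) \<omega>))" (is ?I)
    and "expectation (\<lambda>\<omega>. (tree_Q E s \<omega> - tree_Q E t \<omega>) * (tree_Q E t \<omega> - tree_Q E (t + h) \<omega>))
      \<le> expectation (\<lambda>\<omega>. tree_Q E s \<omega> - tree_Q E t \<omega>) * tree_loss E h" (is ?E)
proof -
  let ?S = "\<lambda>p. surv E (tree_path E (fst p) (snd p))"
  let ?n = "(real (card V))\<^sup>2"
  note P = tree_path_subset[OF E]
  note inc = expectation_surv_increments[OF E P P st h]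
  have eq: "(tree_Q E s \<omega> - tree_Q E t \<omega>) * (tree_Q E t \<omega> - tree_Q E (t + h) \<omega>)
     = (\<Sum>p\<in>V \<times> V. \<Sum>p'\<in>V \<times> V. (?S p s \<omega> - ?S p t \<omega>) * (?S p' t \<omega> - ?S p' (t + h) \<omega>)) / (?n * ?n)" for \<omega>
    by (simp add: tree_Q_def diff_divide_distrib[symmetric] sum_subtractf[symmetric] sum_product)
  show ?I unfolding eq by (intro integrable_divide Bochner_Integration.integrable_sum inc)
  have int: "integrable M (?S p u)" if "p \<in> V \<times> V" "0 \<le> u" for p u
    using has_expectation_surv(1)[OF E P] that by auto
  have t: "0 \<le> t" using st by simp
  have "expectation (\<lambda>\<omega>. (tree_Q E s \<omega> - tree_Q E t \<omega>) * (tree_Q E t \<omega> - tree_Q E (t + h) \<omega>))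
    = (\<Sum>p\<in>V \<times> V. \<Sum>p'\<in>V \<times> V. expectation (\<lambda>\<omega>. (?S p s \<omega> - ?S p t \<omega>) * (?S p' t \<omega> - ?S p' (t + h) \<omega>))) / (?n * ?n)"
    unfolding eq by (simp add: Bochner_Integration.integral_sum Bochner_Integration.integrable_sum inc(1))
  also have "\<dots> \<le> (\<Sum>p\<in>V \<times> V. \<Sum>p'\<in>V \<times> V. expectation (\<lambda>\<omega>. ?S p s \<omega> - ?S p t \<omega>) *
      (1 - exp (- r * (h * card (tree_path E (fst p') (snd p')))))) / (?n * ?n)"
    by (intro divide_right_mono sum_mono inc(2)) auto
  also have "\<dots> = ((\<Sum>p\<in>V \<times> V. expectation (\<lambda>\<omega>. ?S p s \<omega> - ?S p t \<omega>)) / ?n) * tree_loss E h"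
    by (simp add: tree_loss_def sum_product)
  also have "(\<Sum>p\<in>V \<times> V. expectation (\<lambda>\<omega>. ?S p s \<omega> - ?S p t \<omega>)) / ?n = expectation (\<lambda>\<omega>. tree_Q E s \<omega> - tree_Q E t \<omega>)"
    using int st t by (simp add: tree_Q_def diff_divide_distrib[symmetric] sum_subtractf[symmetric])
  finally show ?E .
qed

lemma tree_loss_nonneg: "0 \<le> h \<Longrightarrow> 0 \<le> tree_loss E h"
  unfolding tree_loss_def using r by (intro divide_nonneg_nonneg sum_nonneg) auto

lemma tree_loss_mono: "s \<le> t \<Longrightarrow> tree_loss E s \<le> tree_loss E t"
  unfolding tree_loss_def using r by (intro divide_right_mono sum_mono) (auto intro!: mult_left_mono mult_right_mono)

lemma tree_Q_nonneg: "E \<in> spanning_trees \<Longrightarrow> 0 \<le> tree_Q E t \<omega>"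
  unfolding tree_Q_def
  by (intro divide_nonneg_nonneg sum_nonneg surv_bounds(1) finite_subset[OF tree_path_subset tree_finite]) auto

lemma sum_spanning_trees: "\<omega> \<in> space M \<Longrightarrow> (\<Sum>E\<in>spanning_trees. if T \<omega> = E then c else (0::real)) = c"
  using finite_spanning_trees T_tree by (simp add: sum.delta)

lemma Q_eq_sum_trees: "\<omega> \<in> space M \<Longrightarrow> Q t \<omega> = (\<Sum>E\<in>spanning_trees. tree_Q E t \<omega>)"
  using sum_spanning_trees[of \<omega> "Q t \<omega>"] by (simp add: tree_Q_eq)

lemma Q_increments_eq_sum_trees:
  "\<omega> \<in> space M \<Longrightarrow> (Q s \<omega> - Q t \<omega>) * (Q t \<omega> - Q u \<omega>) =
    (\<Sum>E\<in>spanning_trees. (tree_Q E s \<omega> - tree_Q E t \<omega>) * (tree_Q E t \<omega> - tree_Q E u \<omega>))"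
  using sum_spanning_trees[of \<omega> "(Q s \<omega> - Q t \<omega>) * (Q t \<omega> - Q u \<omega>)"]
  by (simp add: tree_Q_eq if_distrib if_distribR cong: if_cong sum.cong)

lemma sum_tree_prob: "(\<Sum>E\<in>spanning_trees. tree_prob E) = 1"
proof -
  have "(\<Sum>E\<in>spanning_trees. prob {\<omega> \<in> space M. T \<omega> = E}) = prob (\<Union>E\<in>spanning_trees. {\<omega> \<in> space M. T \<omega> = E})"
    using finite_spanning_trees tree_event
    by (intro finite_measure_finite_Union[symmetric]) (auto simp: disjoint_family_on_def)
  also have "(\<Union>E\<in>spanning_trees. {\<omega> \<in> space M. T \<omega> = E}) = space M" using T_tree by auto
  finally show ?thesis by (simp add: tree_prob_def prob_space)
qed

lemma integrable_Q: "0 \<le> t \<Longrightarrow> integrable M (Q t)"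
  using has_expectation_tree_Q(1)
  by (subst Bochner_Integration.integrable_cong[OF refl Q_eq_sum_trees]) auto

lemma expected_loss:
  assumes t: "0 \<le> t"
  shows "1 - expectation (Q t) = (\<Sum>E\<in>spanning_trees. tree_prob E * tree_loss E t)"
proof -
  have "expectation (Q t) = expectation (\<lambda>\<omega>. \<Sum>E\<in>spanning_trees. tree_Q E t \<omega>)"
    by (rule Bochner_Integration.integral_cong[OF refl Q_eq_sum_trees])
  also have "\<dots> = (\<Sum>E\<in>spanning_trees. tree_prob E * (1 - tree_loss E t))"
    using has_expectation_tree_Q[OF _ t] by simp
  also have "\<dots> = 1 - (\<Sum>E\<in>spanning_trees. tree_prob E * tree_loss E t)"
    by (simp add: right_diff_distrib sum_subtractf sum_tree_prob)
  finally show ?thesis by simp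
qed

text \<open>
  The increments over the grid telescope, so that the bound depends neither on the mesh \<open>d\<close> nor on
  the number \<open>L\<close> of grid points. The trees are treated separately because the factor \<open>tree_loss E h\<close>
  is a constant only for a given tree.
\<close>

lemma expectation_grid_increments:
  fixes L :: nat
  assumes d: "0 \<le> d" and h: "0 \<le> h"
  defines "W \<equiv> \<lambda>\<omega>. \<Sum>i<L. (Q (real i * d) \<omega> - Q (real (Suc i) * d) \<omega>) *
      (Q (real (Suc i) * d) \<omega> - Q (real (Suc i) * d + h) \<omega>)"
  shows "integrable M W" and "expectation W \<le> 1 - expectation (Q h)"
proof -
  define w where "w E i \<omega> = (tree_Q E (real i * d) \<omega> - tree_Q E (real (Suc i) * d) \<omega>) *
      (tree_Q E (real (Suc i) * d) \<omega> - tree_Q E (real (Suc i) * d + h) \<omega>)" for E i \<omega>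
  have pos: "0 \<le> real i * d" "real i * d \<le> real (Suc i) * d" "0 \<le> real (Suc i) * d" for i
    using d by (auto simp: algebra_simps)
  have W: "W \<omega> = (\<Sum>i<L. \<Sum>E\<in>spanning_trees. w E i \<omega>)" if "\<omega> \<in> space M" for \<omega>
    unfolding W_def w_def using Q_increments_eq_sum_trees[OF that] by simp
  have int: "integrable M (w E i)" if "E \<in> spanning_trees" for E i
    unfolding w_def using expectation_tree_Q_increments(1)[OF that pos(1,2) h] .
  have "integrable M (\<lambda>\<omega>. \<Sum>i<L. \<Sum>E\<in>spanning_trees. w E i \<omega>)"
    by (intro Bochner_Integration.integrable_sum int)
  then show "integrable M W" by (subst Bochner_Integration.integrable_cong[OF refl W])
  have "expectation W = expectation (\<lambda>\<omega>. \<Sum>i<L. \<Sum>E\<in>spanning_trees. w E i \<omega>)"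
    by (rule Bochner_Integration.integral_cong[OF refl W])
  also have "\<dots> = (\<Sum>i<L. \<Sum>E\<in>spanning_trees. expectation (w E i))" using int by simp
  also have "\<dots> = (\<Sum>E\<in>spanning_trees. \<Sum>i<L. expectation (w E i))" by (rule sum.swap)
  also have "\<dots> \<le> (\<Sum>E\<in>spanning_trees. tree_prob E * tree_loss E h)"
  proof (rule sum_mono)
    fix E assume E: "E \<in> spanning_trees"
    note intQ = has_expectation_tree_Q(1)[OF E]
    have "(\<Sum>i<L. expectation (w E i))
       \<le> (\<Sum>i<L. (expectation (tree_Q E (real i * d)) - expectation (tree_Q E (real (Suc i) * d))) * tree_loss E h)"
    proof (rule sum_mono)
      fix i
      have "expectation (w E i)
        \<le> expectation (\<lambda>\<omega>. tree_Q E (real i * d) \<omega> - tree_Q E (real (Suc i) * d) \<omega>) * tree_loss E h"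
        unfolding w_def by (rule expectation_tree_Q_increments(2)[OF E pos(1,2) h])
      then show "expectation (w E i)
        \<le> (expectation (tree_Q E (real i * d)) - expectation (tree_Q E (real (Suc i) * d))) * tree_loss E h"
        using intQ[OF pos(1)] intQ[OF pos(3)] by simp
    qed
    also have "\<dots> = (\<Sum>i<L. expectation (tree_Q E (real i * d)) - expectation (tree_Q E (real (Suc i) * d))) * tree_loss E h"
      by (rule sum_distrib_right[symmetric])
    also have "(\<Sum>i<L. expectation (tree_Q E (real i * d)) - expectation (tree_Q E (real (Suc i) * d)))
       = expectation (tree_Q E (real 0 * d)) - expectation (tree_Q E (real L * d))"
      by (rule sum_lessThan_telescope')
    also have "\<dots> \<le> tree_prob E"
    proof -
      have "0 \<le> expectation (tree_Q E (real L * d))" using tree_Q_nonneg[OF E] by (intro Bochner_Integration.integral_nonneg) auto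
      moreover have "expectation (tree_Q E (real 0 * d)) \<le> tree_prob E"
        using has_expectation_tree_Q(2)[OF E, of 0] tree_loss_nonneg[of 0 E]
        by (simp add: mult_left_le tree_prob_def)
      ultimately show ?thesis by simp
    qed
    finally show "(\<Sum>i<L. expectation (w E i)) \<le> tree_prob E * tree_loss E h"
      using tree_loss_nonneg[OF h] by (simp add: mult_right_mono)
  qed
  finally show "expectation W \<le> 1 - expectation (Q h)" by (simp add: expected_loss[OF h])
qed

abbreviation frag_path :: "'w \<Rightarrow> real \<Rightarrow> nat \<Rightarrow> real" where
  "frag_path \<omega> \<equiv> \<lambda>t\<in>{0..}. fragmentation V (T \<omega>) (\<lambda>e. \<tau> e \<omega>) t"

lemma Q_path: "0 \<le> t \<Longrightarrow> sum_of_squares (frag_path \<omega> t) = Q t \<omega>"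
  by (simp add: Q_def)

lemma path_cadlag: "\<omega> \<in> space M \<Longrightarrow> frag_path \<omega> \<in> cadlag mass_partitions"
  by (rule fragmentation_cadlag[OF V(1) tree_finite[OF T_tree]])

lemma path_control:
  assumes "0 \<le> s" "s \<le> t"
  shows "(dist (frag_path \<omega> s) (frag_path \<omega> t))\<^sup>2 \<le> 4 * (Q s \<omega> - Q t \<omega>)"
proof -
  have "surviving_edges (T \<omega>) (\<lambda>e. \<tau> e \<omega>) t \<subseteq> surviving_edges (T \<omega>) (\<lambda>e. \<tau> e \<omega>) s"
    using assms(2) by (auto simp: surviving_edges_def)
  from relative_sizes_control[OF V(1) this] show ?thesis
    using assms by (simp add: Q_def fragmentation_relative_sizes)
qed

lemma Q_antimono:
  assumes "0 \<le> s" "s \<le> t"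
  shows "Q t \<omega> \<le> Q s \<omega>"
proof -
  have "0 \<le> 4 * (Q s \<omega> - Q t \<omega>)" by (rule order_trans[OF zero_le_power2 path_control[OF assms]])
  then show ?thesis by simp
qed

lemma Q_right_continuous:
  assumes \<omega>: "\<omega> \<in> space M" and t: "0 \<le> t"
  shows "((\<lambda>t. Q t \<omega>) \<longlongrightarrow> Q t \<omega>) (at_right t)"
proof -
  have lim: "((\<lambda>s. sum_of_squares (frag_path \<omega> s)) \<longlongrightarrow> sum_of_squares (frag_path \<omega> t)) (at_right t)"
    by (rule cadlag_comp_right[OF path_cadlag[OF \<omega>] continuous_on_sum_of_squares t])
  have "\<forall>\<^sub>F s in at_right t. sum_of_squares (frag_path \<omega> s) = Q s \<omega>"
    using eventually_at_right_less[of t] by eventually_elim (use t in \<open>simp add: Q_def\<close>)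
  from lim[unfolded tendsto_cong[OF this] Q_path[OF t]] show ?thesis .
qed

lemma Q_le_1: "Q t \<omega> \<le> 1"
proof -
  have "card ((adjacency (surviving_edges (T \<omega>) (\<lambda>e. \<tau> e \<omega>) t))\<^sup>* \<inter> V \<times> V) \<le> card (V \<times> V)"
    using V(1) by (intro card_mono) auto
  then have "real (card ((adjacency (surviving_edges (T \<omega>) (\<lambda>e. \<tau> e \<omega>) t))\<^sup>* \<inter> V \<times> V)) \<le> (real (card V))\<^sup>2"
    by (metis card_cartesian_product of_nat_le_iff of_nat_power power2_eq_square)
  then show ?thesis
    using card_V(1) by (simp add: Q_def fragmentation_relative_sizes sum_of_squares_relative_sizes[OF V(1)])
qed

lemma Q_measurable [measurable]: "0 \<le> t \<Longrightarrow> Q t \<in> borel_measurable M"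
  using integrable_Q by (rule borel_measurable_integrable)

section \<open>Probabilities of large drops\<close>

definition close_drops :: "real \<Rightarrow> real \<Rightarrow> 'w set" where
  "close_drops h e = {\<omega> \<in> space M. \<exists>s t u. 0 \<le> s \<and> s < t \<and> t < u \<and> u < s + h \<and>
     e < Q s \<omega> - Q t \<omega> \<and> e < Q t \<omega> - Q u \<omega>}"

text \<open>
  For each \<open>k\<close> only finitely many grid times are involved: this gives an event, to which the bound
  for sums over a grid applies. The grids are nested and their union is dense.
\<close>

definition grid_close_drops :: "real \<Rightarrow> real \<Rightarrow> nat \<Rightarrow> 'w set" where
  "grid_close_drops h e k = {\<omega> \<in> space M. \<exists>i j l :: nat. i < j \<and> j < l \<and> l \<le> k * 2 ^ k \<and>
     real l * (1 / 2 ^ k) < real i * (1 / 2 ^ k) + h \<and>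
     e < Q (real i * (1 / 2 ^ k)) \<omega> - Q (real j * (1 / 2 ^ k)) \<omega> \<and>
     e < Q (real j * (1 / 2 ^ k)) \<omega> - Q (real l * (1 / 2 ^ k)) \<omega>}"

lemma grid_close_drops_event: "grid_close_drops h e k \<in> events"
proof -
  have [measurable]: "Q (real i * (1 / 2 ^ k)) \<in> borel_measurable M" for i :: nat
    by (rule Q_measurable) simp
  show ?thesis unfolding grid_close_drops_def by measurable
qed

lemma exists_grid_point_above:
  fixes x d :: real
  assumes "0 \<le> x" "0 < d"
  obtains i :: nat where "x < real i * d" "real i * d \<le> x + d"
proof -
  define n where "n = nat \<lfloor>x / d\<rfloor>"
  have "real n = of_int \<lfloor>x / d\<rfloor>" using assms by (simp add: n_def)
  then have "real n \<le> x / d" "x / d < real n + 1" by linarith+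
  then have "x < real (Suc n) * d" "real (Suc n) * d \<le> x + d"
    using assms by (simp_all add: field_simps)
  then show ?thesis by (rule that)
qed

text \<open>
  By right continuity \<open>s\<close> and \<open>t\<close> may be moved slightly to the right without spoiling the strict
  inequalities; \<open>u\<close> may always be moved to the right, since \<open>Q\<close> decreases.
\<close>

lemma close_drops_eq_grid: "close_drops h e = (\<Union>k. grid_close_drops h e k)"
proof (intro equalityI subsetI)
  fix \<omega> assume "\<omega> \<in> close_drops h e"
  then obtain s t u where \<omega>: "\<omega> \<in> space M" and stu: "0 \<le> s" "s < t" "t < u" "u < s + h"
    "e < Q s \<omega> - Q t \<omega>" "e < Q t \<omega> - Q u \<omega>" by (auto simp: close_drops_def)
  have "\<forall>\<^sub>F s' in at_right s. Q t \<omega> + e < Q s' \<omega>"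
    using stu by (intro order_tendstoD(1)[OF Q_right_continuous[OF \<omega>]]) auto
  then obtain b1 where b1: "b1 > s" "\<And>s'. s < s' \<Longrightarrow> s' < b1 \<Longrightarrow> Q t \<omega> + e < Q s' \<omega>"
    unfolding eventually_at_right_field by blast
  have "\<forall>\<^sub>F t' in at_right t. Q u \<omega> + e < Q t' \<omega>"
    using stu by (intro order_tendstoD(1)[OF Q_right_continuous[OF \<omega>]]) auto
  then obtain b2 where b2: "b2 > t" "\<And>t'. t < t' \<Longrightarrow> t' < b2 \<Longrightarrow> Q u \<omega> + e < Q t' \<omega>"
    unfolding eventually_at_right_field by blast
  define \<delta> where "\<delta> = Min {b1 - s, t - s, b2 - t, u - t, s + h - u, 1}"
  have \<delta>: "0 < \<delta>" "\<delta> \<le> b1 - s" "\<delta> \<le> t - s" "\<delta> \<le> b2 - t" "\<delta> \<le> u - t" "\<delta> \<le> s + h - u" "\<delta> \<le> 1"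
    using b1(1) b2(1) stu unfolding \<delta>_def by (auto intro: Min_le)
  have "(\<lambda>k. (1 / 2) ^ k) \<longlonglongrightarrow> (0 :: real)" by (rule LIMSEQ_power_zero) simp
  then have "\<forall>\<^sub>F k in sequentially. (1 / 2) ^ k < \<delta>" using \<delta>(1) by (rule order_tendstoD(2))
  moreover have "\<forall>\<^sub>F k in sequentially. u + 1 \<le> real k"
    using eventually_ge_at_top[of "nat \<lceil>u + 1\<rceil>"] by eventually_elim linarith
  ultimately have "\<forall>\<^sub>F k in sequentially. (1 / 2) ^ k < \<delta> \<and> u + 1 \<le> real k" by (rule eventually_conj)
  then obtain k where k: "(1 / 2) ^ k < \<delta>" "u + 1 \<le> real k" by (auto simp: eventually_sequentially)
  define d :: real where "d = 1 / 2 ^ k"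
  have d: "0 < d" "d < \<delta>" using k by (auto simp: d_def power_one_over)
  obtain i where i: "s < real i * d" "real i * d \<le> s + d" using exists_grid_point_above[OF stu(1) d(1)] .
  obtain j where j: "t < real j * d" "real j * d \<le> t + d" using exists_grid_point_above[of t d] stu d by auto
  obtain l where l: "u < real l * d" "real l * d \<le> u + d" using exists_grid_point_above[of u d] stu d by auto
  have ord: "real i * d < real j * d" "real j * d < real l * d" using i j l d \<delta> by linarith+
  have ijl: "i < j" "j < l" using ord d by simp_all
  have "real l * d \<le> real k" using l d \<delta> k by linarith
  then have "real l \<le> real k * 2 ^ k" by (simp add: d_def field_simps)
  then have "real l \<le> real (k * 2 ^ k)" by simp
  then have lk: "l \<le> k * 2 ^ k" by (simp only: of_nat_le_iff)
  have "Q (real j * d) \<omega> \<le> Q t \<omega>" "Q (real l * d) \<omega> \<le> Q u \<omega>"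
    using j l stu by (auto intro!: Q_antimono)
  moreover have "Q t \<omega> + e < Q (real i * d) \<omega>" using i d \<delta> by (intro b1(2)) auto
  moreover have "Q u \<omega> + e < Q (real j * d) \<omega>" using j d \<delta> by (intro b2(2)) auto
  moreover have "real l * d < real i * d + h" using l i d \<delta> by linarith
  ultimately have "\<omega> \<in> grid_close_drops h e k"
    unfolding grid_close_drops_def d_def[symmetric] using \<omega> ijl lk
    by (intro CollectI conjI exI[of _ i] exI[of _ j] exI[of _ l]) auto
  then show "\<omega> \<in> (\<Union>k. grid_close_drops h e k)" by blast
next
  fix \<omega> assume "\<omega> \<in> (\<Union>k. grid_close_drops h e k)"
  then obtain k i j l where "\<omega> \<in> space M" "i < j" "j < l"
     "real l * (1 / 2 ^ k) < real i * (1 / 2 ^ k) + h"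
     "e < Q (real i * (1 / 2 ^ k)) \<omega> - Q (real j * (1 / 2 ^ k)) \<omega>"
     "e < Q (real j * (1 / 2 ^ k)) \<omega> - Q (real l * (1 / 2 ^ k)) \<omega>"
    unfolding grid_close_drops_def by blast
  then show "\<omega> \<in> close_drops h e"
    unfolding close_drops_def
    by (intro CollectI conjI exI[of _ "real i * (1 / 2 ^ k)"] exI[of _ "real j * (1 / 2 ^ k)"]
        exI[of _ "real l * (1 / 2 ^ k)"]) (auto simp: divide_strict_right_mono)
qed

lemma incseq_grid_close_drops: "incseq (grid_close_drops h e)"
proof (rule incseq_SucI, rule subsetI)
  fix k \<omega> assume "\<omega> \<in> grid_close_drops h e k"
  then obtain i j l where *: "\<omega> \<in> space M" "i < j" "j < l" "l \<le> k * 2 ^ k"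
     "real l * (1 / 2 ^ k) < real i * (1 / 2 ^ k) + h"
     "e < Q (real i * (1 / 2 ^ k)) \<omega> - Q (real j * (1 / 2 ^ k)) \<omega>"
     "e < Q (real j * (1 / 2 ^ k)) \<omega> - Q (real l * (1 / 2 ^ k)) \<omega>"
    unfolding grid_close_drops_def by blast
  have half: "real (2 * a) * (1 / 2 ^ Suc k) = real a * (1 / 2 ^ k)" for a by simp
  show "\<omega> \<in> grid_close_drops h e (Suc k)"
    unfolding grid_close_drops_def
  proof (rule CollectI, rule conjI[OF *(1)], rule exI[of _ "2 * i"], rule exI[of _ "2 * j"],
      rule exI[of _ "2 * l"], unfold half, intro conjI)
    show "2 * l \<le> Suc k * 2 ^ Suc k" using *(4) by simp
  qed (use * in simp_all)
qed

text \<open>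
  If \<open>Q\<close> loses \<open>e\<close> between \<open>i\<close> and \<open>j\<close>, and again between \<open>j\<close> and \<open>l\<close>, then each grid increment between \<open>i\<close> and \<open>j\<close>
  is followed within time \<open>h\<close> by the whole second loss. Hence the sum of products is at least \<open>e\<^sup>2\<close>,
  and Markov's inequality applies.
\<close>

lemma prob_grid_close_drops:
  assumes h: "0 \<le> h" and e: "0 < e"
  shows "prob (grid_close_drops h e k) \<le> (1 - expectation (Q h)) / e\<^sup>2"
proof -
  define d :: real where "d = 1 / 2 ^ k"
  have d: "0 \<le> d" by (simp add: d_def)
  define L where "L = k * 2 ^ k"
  define w where "w i \<omega> = (Q (real i * d) \<omega> - Q (real (Suc i) * d) \<omega>) *
      (Q (real (Suc i) * d) \<omega> - Q (real (Suc i) * d + h) \<omega>)" for i \<omega>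
  define W where "W \<omega> = (\<Sum>i<L. w i \<omega>)" for \<omega>
  have W: "integrable M W" "expectation W \<le> 1 - expectation (Q h)"
    using expectation_grid_increments[OF d h, of L] by (simp_all add: W_def[abs_def] w_def)
  have anti: "Q (real j * d + y) \<omega> \<le> Q (real i * d) \<omega>" if "real i * d \<le> real j * d + y" for i j y \<omega>
    using that d by (intro Q_antimono) auto
  have pos: "0 \<le> w i \<omega>" for i \<omega>
  proof -
    have "real i * d \<le> real (Suc i) * d" using d by (intro mult_right_mono) auto
    then have "0 \<le> Q (real i * d) \<omega> - Q (real (Suc i) * d) \<omega>" using anti[of i "Suc i" 0 \<omega>] by simp
    moreover have "0 \<le> Q (real (Suc i) * d) \<omega> - Q (real (Suc i) * d + h) \<omega>"
      using anti[of "Suc i" "Suc i" h \<omega>] h by simp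
    ultimately show ?thesis unfolding w_def by (rule mult_nonneg_nonneg)
  qed
  have big: "e\<^sup>2 \<le> W \<omega>" if bad: "\<omega> \<in> grid_close_drops h e k" for \<omega>
  proof -
    obtain i j l where *: "i < j" "j < l" "l \<le> L" "real l * d < real i * d + h"
       "e < Q (real i * d) \<omega> - Q (real j * d) \<omega>" "e < Q (real j * d) \<omega> - Q (real l * d) \<omega>"
      using bad unfolding grid_close_drops_def d_def[symmetric] L_def[symmetric] by blast
    have "e * e \<le> (Q (real i * d) \<omega> - Q (real j * d) \<omega>) * (Q (real j * d) \<omega> - Q (real l * d) \<omega>)"
      using * e by (intro mult_mono) auto
    also have "Q (real i * d) \<omega> - Q (real j * d) \<omega> = (\<Sum>a\<in>{i..<j}. Q (real a * d) \<omega> - Q (real (Suc a) * d) \<omega>)"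
      using sum_Suc_diff'[of i j "\<lambda>a. - Q (real a * d) \<omega>"] *(1) by simp
    also have "\<dots> * (Q (real j * d) \<omega> - Q (real l * d) \<omega>) \<le> (\<Sum>a\<in>{i..<j}. w a \<omega>)"
      unfolding sum_distrib_right w_def
    proof (intro sum_mono mult_mono diff_mono)
      fix a assume a: "a \<in> {i..<j}"
      have "real (Suc a) * d \<le> real j * d" using a d by (intro mult_right_mono) auto
      then show "Q (real j * d) \<omega> \<le> Q (real (Suc a) * d) \<omega>" using anti[of "Suc a" j 0 \<omega>] by simp
      have "real i * d \<le> real (Suc a) * d" using a d by (intro mult_right_mono) auto
      then have "real l * d \<le> real (Suc a) * d + h" using *(4) by simp
      then show "Q (real (Suc a) * d + h) \<omega> \<le> Q (real l * d) \<omega>" by (rule anti)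
      have "real a * d \<le> real (Suc a) * d" using d by (intro mult_right_mono) auto
      then show "0 \<le> Q (real a * d) \<omega> - Q (real (Suc a) * d) \<omega>" using anti[of a "Suc a" 0 \<omega>] by simp
    qed (use * e in auto)
    also have "\<dots> \<le> W \<omega>"
      unfolding W_def using * pos by (intro sum_mono2) auto
    finally show ?thesis by (simp add: power2_eq_square)
  qed
  have "prob (grid_close_drops h e k) \<le> prob {\<omega> \<in> space M. e\<^sup>2 \<le> W \<omega>}"
  proof (rule finite_measure_mono)
    show "grid_close_drops h e k \<subseteq> {\<omega> \<in> space M. e\<^sup>2 \<le> W \<omega>}" using big by (auto simp: grid_close_drops_def)
    have [measurable]: "W \<in> borel_measurable M" using W(1) by (rule borel_measurable_integrable)
    show "{\<omega> \<in> space M. e\<^sup>2 \<le> W \<omega>} \<in> events" by measurable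
  qed
  also have "\<dots> \<le> expectation W / e\<^sup>2"
  proof (rule integral_Markov_inequality_measure[OF W(1), of "{}"])
    have "0 \<le> W \<omega>" for \<omega> unfolding W_def by (intro sum_nonneg pos)
    then show "AE \<omega> in M. 0 \<le> W \<omega>" by simp
  qed (use e in auto)
  also have "\<dots> \<le> (1 - expectation (Q h)) / e\<^sup>2" using W(2) by (intro divide_right_mono) auto
  finally show ?thesis .
qed

lemma close_drops_event: "close_drops h e \<in> events"
  unfolding close_drops_eq_grid using grid_close_drops_event by (intro sets.countable_UN) auto

lemma prob_close_drops:
  assumes h: "0 \<le> h" and e: "0 < e"
  shows "prob (close_drops h e) \<le> (1 - expectation (Q h)) / e\<^sup>2"
proof (rule LIMSEQ_le_const2)
  show "(\<lambda>k. prob (grid_close_drops h e k)) \<longlonglongrightarrow> prob (close_drops h e)"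
    unfolding close_drops_eq_grid using grid_close_drops_event incseq_grid_close_drops
    by (intro finite_Lim_measure_incseq) auto
  show "\<exists>N. \<forall>k\<ge>N. prob (grid_close_drops h e k) \<le> (1 - expectation (Q h)) / e\<^sup>2"
    using prob_grid_close_drops[OF h e] by blast
qed

definition early_drop :: "real \<Rightarrow> real \<Rightarrow> 'w set" where
  "early_drop h e = {\<omega> \<in> space M. \<exists>t. 0 \<le> t \<and> t < h \<and> e < Q 0 \<omega> - Q t \<omega>}"

text \<open>
  Since \<open>Q\<close> decreases, it suffices to look at a sequence of times increasing to \<open>h\<close>.
\<close>

lemma early_drop_event:
  assumes h: "0 < h"
  shows "early_drop h e \<in> events"
proof -
  define a where "a k = h * (real k / real (Suc k))" for k
  have a: "0 \<le> a k" "a k < h" for k using h by (auto simp: a_def field_simps)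
  have "early_drop h e = {\<omega> \<in> space M. \<exists>k. e < Q 0 \<omega> - Q (a k) \<omega>}"
  proof (intro equalityI subsetI)
    fix \<omega> assume "\<omega> \<in> early_drop h e"
    then obtain t where t: "\<omega> \<in> space M" "0 \<le> t" "t < h" "e < Q 0 \<omega> - Q t \<omega>" by (auto simp: early_drop_def)
    obtain k :: nat where "h / (h - t) \<le> real k" using real_arch_simple by blast
    then have "h \<le> (h - t) * real k" using t by (simp add: field_simps)
    then have "t \<le> a k" using t h by (simp add: a_def field_simps)
    then have "Q (a k) \<omega> \<le> Q t \<omega>" using t by (intro Q_antimono) auto
    then show "\<omega> \<in> {\<omega> \<in> space M. \<exists>k. e < Q 0 \<omega> - Q (a k) \<omega>}" using t by (auto intro!: exI[of _ k])
  qed (use a in \<open>auto simp: early_drop_def\<close>)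
  also have "\<dots> \<in> events"
  proof -
    have [measurable]: "Q (a k) \<in> borel_measurable M" "Q 0 \<in> borel_measurable M" for k
      using a by (auto intro!: Q_measurable)
    show ?thesis by measurable
  qed
  finally show ?thesis .
qed

lemma prob_early_drop:
  assumes h: "0 < h" and e: "0 < e"
  shows "prob (early_drop h e) \<le> (1 - expectation (Q h)) / e"
proof -
  have int: "integrable M (Q h)" using h by (intro integrable_Q) simp
  have [measurable]: "Q h \<in> borel_measurable M" using int by (rule borel_measurable_integrable)
  have "prob (early_drop h e) \<le> prob {\<omega> \<in> space M. e \<le> 1 - Q h \<omega>}"
  proof (rule finite_measure_mono)
    show "early_drop h e \<subseteq> {\<omega> \<in> space M. e \<le> 1 - Q h \<omega>}"
    proof
      fix \<omega> assume "\<omega> \<in> early_drop h e"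
      then obtain t where "\<omega> \<in> space M" "0 \<le> t" "t < h" "e < Q 0 \<omega> - Q t \<omega>" by (auto simp: early_drop_def)
      then show "\<omega> \<in> {\<omega> \<in> space M. e \<le> 1 - Q h \<omega>}"
        using Q_antimono[of t h \<omega>] Q_le_1[of 0 \<omega>] by auto
    qed
  qed measurable
  also have "\<dots> \<le> expectation (\<lambda>\<omega>. 1 - Q h \<omega>) / e"
    using int e Q_le_1 by (intro integral_Markov_inequality_measure[of _ _ "{}"]) auto
  also have "expectation (\<lambda>\<omega>. 1 - Q h \<omega>) = 1 - expectation (Q h)" using int by (simp add: prob_space)
  finally show ?thesis .
qed

lemma path_controlled_iff:
  assumes \<omega>: "\<omega> \<in> space M"
  shows "frag_path \<omega> \<in> controlled_paths mass_partitions sum_of_squares 4 h e \<longleftrightarrow>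
    (\<forall>m. \<omega> \<notin> early_drop (h m) (e m) \<union> close_drops (h m) (e m))"
proof -
  have 1: "(\<forall>m t. 0 \<le> t \<longrightarrow> t < h m \<longrightarrow> sum_of_squares (frag_path \<omega> 0) - sum_of_squares (frag_path \<omega> t) \<le> e m) \<longleftrightarrow>
      (\<forall>m. \<omega> \<notin> early_drop (h m) (e m))" (is "?L \<longleftrightarrow> ?R")
  proof -
    have "?L \<longleftrightarrow> (\<forall>m t. 0 \<le> t \<longrightarrow> t < h m \<longrightarrow> Q 0 \<omega> - Q t \<omega> \<le> e m)"
      by (intro iff_allI imp_cong refl) (simp add: Q_def)
    also have "\<dots> \<longleftrightarrow> ?R"
    proof -
      have "\<omega> \<in> early_drop (h m) (e m) \<longleftrightarrow> (\<exists>t. 0 \<le> t \<and> t < h m \<and> \<not> Q 0 \<omega> - Q t \<omega> \<le> e m)" for m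
        using \<omega> by (simp only: early_drop_def mem_Collect_eq not_le simp_thms)
      then show ?thesis by blast
    qed
    finally show ?thesis .
  qed
  have 2: "(\<forall>m s t u. 0 \<le> s \<longrightarrow> s < t \<longrightarrow> t < u \<longrightarrow> u < s + h m \<longrightarrow>
        min (sum_of_squares (frag_path \<omega> s) - sum_of_squares (frag_path \<omega> t))
          (sum_of_squares (frag_path \<omega> t) - sum_of_squares (frag_path \<omega> u)) \<le> e m) \<longleftrightarrow>
      (\<forall>m. \<omega> \<notin> close_drops (h m) (e m))" (is "?L \<longleftrightarrow> ?R")
  proof -
    have "?L \<longleftrightarrow> (\<forall>m s t u. 0 \<le> s \<longrightarrow> s < t \<longrightarrow> t < u \<longrightarrow> u < s + h m \<longrightarrow>
        min (Q s \<omega> - Q t \<omega>) (Q t \<omega> - Q u \<omega>) \<le> e m)"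
      by (intro iff_allI imp_cong refl) (simp add: Q_def)
    also have "\<dots> \<longleftrightarrow> ?R"
    proof -
      have "\<omega> \<in> close_drops (h m) (e m) \<longleftrightarrow> (\<exists>s t u. 0 \<le> s \<and> s < t \<and> t < u \<and> u < s + h m \<and>
          \<not> min (Q s \<omega> - Q t \<omega>) (Q t \<omega> - Q u \<omega>) \<le> e m)" for m
        using \<omega> by (simp only: close_drops_def mem_Collect_eq not_le min_less_iff_conj simp_thms)
      then show ?thesis by blast
    qed
    finally show ?thesis .
  qed
  have 3: "\<forall>s t. 0 \<le> s \<longrightarrow> s \<le> t \<longrightarrow> (dist (frag_path \<omega> s) (frag_path \<omega> t))\<^sup>2
      \<le> 4 * (sum_of_squares (frag_path \<omega> s) - sum_of_squares (frag_path \<omega> t))"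
  proof (intro allI impI)
    fix s t :: real assume st: "0 \<le> s" "s \<le> t"
    have "sum_of_squares (frag_path \<omega> s) = Q s \<omega>" by (rule Q_path[OF st(1)])
    moreover have "sum_of_squares (frag_path \<omega> t) = Q t \<omega>" by (rule Q_path[OF order_trans[OF st]])
    ultimately show "(dist (frag_path \<omega> s) (frag_path \<omega> t))\<^sup>2 \<le> 4 * (sum_of_squares (frag_path \<omega> s) - sum_of_squares (frag_path \<omega> t))"
      using path_control[OF st] by (simp only:)
  qed
  show ?thesis
    unfolding controlled_paths_def mem_Collect_eq 1 2 using 3 path_cadlag[OF \<omega>] by blast
qed

lemma prob_path_controlled:
  assumes h: "\<And>m. 0 < h m" and e: "\<And>m. 0 < e m"
    and small: "\<And>m. (1 - expectation (Q (h m))) * (1 / e m + 1 / (e m)\<^sup>2) \<le> \<delta> * (1 / 2) ^ Suc m"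
  shows "1 - \<delta> \<le> prob {\<omega> \<in> space M. frag_path \<omega> \<in> controlled_paths mass_partitions sum_of_squares 4 h e}"
proof -
  define B where "B m = early_drop (h m) (e m) \<union> close_drops (h m) (e m)" for m
  have B: "B m \<in> events" for m unfolding B_def using early_drop_event[OF h] close_drops_event by simp
  have bound: "prob (B m) \<le> \<delta> * (1 / 2) ^ Suc m" for m
  proof -
    have "prob (B m) \<le> prob (early_drop (h m) (e m)) + prob (close_drops (h m) (e m))"
      unfolding B_def using early_drop_event[OF h] close_drops_event by (intro measure_Un_le)
    also have "\<dots> \<le> (1 - expectation (Q (h m))) / e m + (1 - expectation (Q (h m))) / (e m)\<^sup>2"
      by (intro add_mono prob_early_drop prob_close_drops h e less_imp_le)
    also have "\<dots> \<le> \<delta> * (1 / 2) ^ Suc m" using small[of m] by (simp add: distrib_left)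
    finally show ?thesis .
  qed
  have geo: "(\<lambda>m. \<delta> * (1 / 2) ^ Suc m) sums (\<delta> * 1)"
    by (intro sums_mult power_half_series)
  have sumB: "summable (\<lambda>m. prob (B m))"
    by (rule summable_comparison_test'[OF sums_summable[OF geo], of 0]) (use bound in auto)
  have "prob (\<Union>m. B m) \<le> (\<Sum>m. prob (B m))"
    using B sumB by (intro finite_measure_subadditive_countably) auto
  also have "\<dots> \<le> (\<Sum>m. \<delta> * (1 / 2) ^ Suc m)" by (intro suminf_le bound sumB sums_summable[OF geo])
  also have "\<dots> = \<delta>" using sums_unique[OF geo] by simp
  finally have "1 - \<delta> \<le> 1 - prob (\<Union>m. B m)" by simp
  also have "\<dots> = prob (space M - (\<Union>m. B m))" using B by (intro prob_compl[symmetric]) auto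
  also have "space M - (\<Union>m. B m) = {\<omega> \<in> space M. frag_path \<omega> \<in> controlled_paths mass_partitions sum_of_squares 4 h e}"
    using path_controlled_iff by (auto simp: B_def)
  finally show ?thesis .
qed

lemma expected_loss_mono:
  assumes "0 \<le> s" "s \<le> t"
  shows "1 - expectation (Q s) \<le> 1 - expectation (Q t)"
  using assms unfolding expected_loss[OF assms(1)] expected_loss[OF order_trans[OF assms]]
  by (intro sum_mono mult_left_mono tree_loss_mono) (auto simp: tree_prob_def)

lemma expected_loss_small:
  assumes "0 < \<delta>"
  shows "\<exists>t>0. 1 - expectation (Q t) < \<delta>"
proof -
  have "((\<lambda>t. \<Sum>E\<in>spanning_trees. tree_prob E * tree_loss E t) \<longlongrightarrow> (\<Sum>E\<in>spanning_trees. tree_prob E * tree_loss E 0)) (at_right 0)"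
    unfolding tree_loss_def using card_V(1) by (intro tendsto_intros) auto
  then have "((\<lambda>t. \<Sum>E\<in>spanning_trees. tree_prob E * tree_loss E t) \<longlongrightarrow> 0) (at_right 0)"
    by (simp add: tree_loss_def)
  then have "\<forall>\<^sub>F t in at_right 0. (\<Sum>E\<in>spanning_trees. tree_prob E * tree_loss E t) < \<delta>"
    using assms by (rule order_tendstoD(2))
  then obtain b where "b > 0" "\<And>t. 0 < t \<Longrightarrow> t < b \<Longrightarrow> (\<Sum>E\<in>spanning_trees. tree_prob E * tree_loss E t) < \<delta>"
    unfolding eventually_at_right_field by blast
  then show ?thesis by (intro exI[of _ "b / 2"]) (simp add: expected_loss)
qed

end

section \<open>Tightness\<close>

text \<open>
  The upper limit concerns large \<open>n\<close> only; the finitely many remaining \<open>n\<close> are covered by smallness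
  for each \<open>n\<close>, and monotonicity in \<open>t\<close> yields a common time.
\<close>

lemma uniformly_small_near_zero:
  fixes l :: "nat \<Rightarrow> real \<Rightarrow> real"
  assumes mono: "\<And>n s t. 1 \<le> n \<Longrightarrow> 0 \<le> s \<Longrightarrow> s \<le> t \<Longrightarrow> l n s \<le> l n t"
    and small: "\<And>n \<delta>. 1 \<le> n \<Longrightarrow> 0 < \<delta> \<Longrightarrow> \<exists>t>0. l n t < \<delta>"
    and lim: "((\<lambda>t. limsup (\<lambda>n. ereal (l n t))) \<longlongrightarrow> 0) (at_right 0)" and \<delta>: "0 < \<delta>"
  shows "\<exists>t>0. \<forall>n\<ge>1. l n t < \<delta>"
proof -
  have "\<forall>\<^sub>F t in at_right 0. limsup (\<lambda>n. ereal (l n t)) < ereal \<delta>"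
    using \<delta> by (intro order_tendstoD(2)[OF lim]) simp
  then obtain b where "b > 0" "\<And>t. 0 < t \<Longrightarrow> t < b \<Longrightarrow> limsup (\<lambda>n. ereal (l n t)) < ereal \<delta>"
    unfolding eventually_at_right_field by blast
  then obtain t0 where t0: "0 < t0" "limsup (\<lambda>n. ereal (l n t0)) < ereal \<delta>"
    by (meson field_lbound_gt_zero)
  from Limsup_lessD[OF t0(2)] obtain N where N: "\<And>n. N \<le> n \<Longrightarrow> l n t0 < \<delta>"
    by (auto simp: eventually_sequentially)
  have "\<forall>n\<in>{1..<N}. \<exists>t>0. l n t < \<delta>" using small \<delta> by simp
  then obtain t where t: "\<And>n. n \<in> {1..<N} \<Longrightarrow> 0 < t n \<and> l n (t n) < \<delta>" by metis
  define u where "u = Min (insert t0 (t ` {1..<N}))"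
  have u: "0 < u" using t t0 by (auto simp: u_def)
  have ut: "u \<le> t0" "\<And>n. n \<in> {1..<N} \<Longrightarrow> u \<le> t n" unfolding u_def by (rule Min_le; simp)+
  have "l n u < \<delta>" if n: "1 \<le> n" for n
  proof (cases "n < N")
    case True
    then show ?thesis using mono[OF n, of u "t n"] u ut(2)[of n] t[of n] n True by fastforce
  next
    case False
    then show ?thesis using mono[OF n, of u t0] u ut(1) N[of n] False by fastforce
  qed
  with u show ?thesis by blast
qed

theorem theorem5p1:
  fixes M :: "nat \<Rightarrow> 'w measure"
    and V :: "nat \<Rightarrow> 'v set"
    and T :: "nat \<Rightarrow> 'w \<Rightarrow> 'v set set"
    and r :: "nat \<Rightarrow> real"
    and \<tau> :: "nat \<Rightarrow> 'v set \<Rightarrow> 'w \<Rightarrow> real"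
    and X :: "nat \<Rightarrow> 'w \<Rightarrow> real \<Rightarrow> nat \<Rightarrow> real"
    and Q :: "nat \<Rightarrow> real \<Rightarrow> 'w \<Rightarrow> real"
  assumes "\<And>n. n \<ge> 1 \<Longrightarrow> prob_space (M n)"
    and "\<And>n. n \<ge> 1 \<Longrightarrow> finite (V n) \<and> card (V n) = n"
    and "\<And>n. n \<ge> 1 \<Longrightarrow> random_tree (M n) (V n) (T n)"
    and "\<And>n. n \<ge> 1 \<Longrightarrow> r n > 0"
    and "\<And>n. n \<ge> 1 \<Longrightarrow> iid_exponential_given_tree (M n) (V n) (T n) (r n) (\<tau> n)"
    and "\<And>n \<omega>. X n \<omega> = (\<lambda>t\<in>{0..}. fragmentation (V n) (T n \<omega>) (\<lambda>e. \<tau> n e \<omega>) t)"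
    and "\<And>n t \<omega>. Q n t \<omega> = (\<Sum>i. (X n \<omega> t i)\<^sup>2)"
    and "((\<lambda>t. limsup (\<lambda>n. ereal (1 - integral\<^sup>L (M n) (Q n t)))) \<longlongrightarrow> 0) (at_right 0)"
  shows "tight_in (J1_topology mass_partitions) {1..} M X"
  unfolding tight_in_def
proof (intro allI impI)
  fix \<delta> :: real assume \<delta>: "\<delta> > 0"
  have loc: "exponential_fragmentation (M n) (V n) (T n) (r n) (\<tau> n)" if "n \<ge> 1" for n
    using assms(1-5)[OF that] that
    by (intro exponential_fragmentation.intro exponential_fragmentation_axioms.intro) auto
  have Q: "Q n t = exponential_fragmentation.Q (V n) (T n) (\<tau> n) t" if n: "n \<ge> 1" and t: "t \<ge> 0" for n t
    by (rule ext) (simp add: assms(6,7) exponential_fragmentation.Q_def[OF loc[OF n]] sum_of_squares_def t)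
  \<comment> \<open>The two estimates for bad events with tolerance \<open>e m\<close> add up to \<open>c m\<close> times the expected loss.\<close>
  define e where "e m = 1 / real (Suc m)" for m
  have e: "0 < e m" for m by (simp add: e_def)
  have e_lim: "e \<longlonglongrightarrow> 0" unfolding e_def using LIMSEQ_inverse_real_of_nat by (simp add: inverse_eq_divide)
  define c where "c m = 1 / e m + 1 / (e m)\<^sup>2" for m
  have c: "0 < c m" for m using e[of m] by (simp add: c_def add_pos_pos)
  have "\<exists>t>0. \<forall>n\<ge>1. 1 - integral\<^sup>L (M n) (Q n t) < \<delta> * (1 / 2) ^ Suc m / c m" for m
  proof (rule uniformly_small_near_zero[OF _ _ assms(8)])
    fix n :: nat and s t :: real assume "1 \<le> n" "0 \<le> s" "s \<le> t"
    then show "1 - integral\<^sup>L (M n) (Q n s) \<le> 1 - integral\<^sup>L (M n) (Q n t)"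
      using exponential_fragmentation.expected_loss_mono[OF loc, of n s t] by (simp add: Q)
  next
    fix n :: nat and \<epsilon> :: real assume "1 \<le> n" "0 < \<epsilon>"
    then show "\<exists>t>0. 1 - integral\<^sup>L (M n) (Q n t) < \<epsilon>"
      using exponential_fragmentation.expected_loss_small[OF loc, of n \<epsilon>] by (auto simp: Q)
  qed (use \<delta> c in simp)
  then obtain h where h: "\<And>m. 0 < h m"
    "\<And>m n. n \<ge> 1 \<Longrightarrow> 1 - integral\<^sup>L (M n) (Q n (h m)) < \<delta> * (1 / 2) ^ Suc m / c m" by metis
  define C where "C = controlled_paths mass_partitions sum_of_squares 4 h e"
  have "compactin (J1_topology mass_partitions) C"
    unfolding C_def
    by (rule compactin_controlled_paths[OF compact_mass_partitions continuous_on_sum_of_squares _ h(1) e_lim]) simp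
  moreover have "1 - \<delta> \<le> measure (M n) {\<omega> \<in> space (M n). X n \<omega> \<in> C}" if n: "n \<ge> 1" for n
    unfolding C_def assms(6)
  proof (rule exponential_fragmentation.prob_path_controlled[OF loc[OF n] h(1) e])
    fix m
    have "(1 - integral\<^sup>L (M n) (Q n (h m))) * c m \<le> \<delta> * (1 / 2) ^ Suc m"
      using h(2)[OF n, of m] c[of m] by (simp add: pos_less_divide_eq less_imp_le)
    then show "(1 - integral\<^sup>L (M n) (exponential_fragmentation.Q (V n) (T n) (\<tau> n) (h m))) *
        (1 / e m + 1 / (e m)\<^sup>2) \<le> \<delta> * (1 / 2) ^ Suc m"
      using Q[OF n less_imp_le[OF h(1)]] by (simp add: c_def)
  qed
  ultimately show "\<exists>C. compactin (J1_topology mass_partitions) C \<and>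
      (\<forall>n\<in>{1..}. 1 - \<delta> \<le> measure (M n) {\<omega> \<in> space (M n). X n \<omega> \<in> C})"
    by (intro exI[of _ C]) simp
qed

end
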